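(* Let $n\in\mathbb N$ and $\delta\in\{0,1\}$. Then, for each nonzero prime ideal $\mathfrak p$ of $\mathcal O$, with $q=|\mathcal O:\mathfrak p|$ and $\mathfrak o=\mathcal O_{\mathfrak p}$, $$\mathcal Z^{\mathrm{cc}}_{F_{n,\delta}(\mathfrak o)}(s_1,s_2)=\frac{1-q^{\binom{2n+\delta-1}{2}-(2n+\delta-1)s_1-s_2}}{\bigl(1-q^{\binom{2n+\delta}{2}-s_2}\bigr)\bigl(1-q^{\binom{2n+\delta}{2}+1-(2n+\delta-1)s_1-s_2}\bigr)}.$$ Write $T_1=q^{-s_1}$ and $T_2=q^{-s_2}$. For $n\ge 2$, $$\mathcal Z^{\mathrm{cc}}_{G_n(\mathfrak o)}(s_1,s_2)=\frac{(1-q^{2\binom n2}T_1^nT_2)(1-q^{2\binom n2+1}T_1^{2n-1}T_2)+q^{n^2}T_1^nT_2(1-q^{-n})(1-q^{-(n-1)}T_1^{n-1})}{(1-q^{n^2}T_2)(1-q^{n^2}T_1^nT_2)(1-q^{n^2+1}T_1^{2n-1}T_2)},$$ $$\mathcal Z^{\mathrm{cc}}_{H_n(\mathfrak o)}(s_1,s_2)=\frac{(1-q^{\binom n2}T_1^nT_2)(1-q^{\binom n2+2}T_1^{2n-1}T_2)+q^{\binom{n+1}2}T_1^nT_2(1-q^{-n+1})(1-q^{-(n-1)}T_1^{n-1})}{(1-q^{\binom{n+1}2}T_2)(1-q^{\binom{n+1}2+1}T_1^nT_2)(1-q^{\binom{n+1}2+1}T_1^{2n-1}T_2)}.$$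
   Context: $K$ is a number field with ring of integers $\mathcal O$. For a nonzero prime ideal $\mathfrak p$ of $\mathcal O$, $\mathfrak o=\mathcal O_{\mathfrak p}$ is the completion of $\mathcal O$ at $\mathfrak p$; its maximal ideal is again denoted $\mathfrak p$. Lie lattices. For $n\in\mathbb N=\{1,2,\dots\}$ and $\delta\in\{0,1\}$ let $\mathcal F_{n,\delta},\mathcal G_n,\mathcal H_n$ be the free $\mathbb Z$-modules, with class-$2$ nilpotent Lie bracket, with the following bases and relations (all brackets of basis elements not determined by the given ones through antisymmetry are zero; in particular all $y_{ij}$ are central): - $\mathcal F_{n,\delta}$: basis $x_k$ ($1\le k\le 2n+\delta$), $y_{ij}$ ($1\le i<j\le 2n+\delta$); $[x_i,x_j]=y_{ij}$ for $i<j$. - $\mathcal G_n$: basis $x_k$ ($1\le k\le 2n$), $y_{ij}$ ($1\le i,j\le n$); $[x_i,x_{n+j}]=y_{ij}$. - $\mathcal H_n$: basis $x_k$ ($1\le k\le 2n$), $y_{ij}$ ($1\le i\le j\le n$); $[x_i,x_{n+j}]=[x_j,x_{n+i}]=y_{ij}$ for $i\le j$. Group schemes. For $\Lambda\in\{\mathcal F_{n,\delta},\mathcal G_n,\mathcal H_n\}$, the associated unipotent group scheme over $\mathcal O$ is denoted $F_{n,\delta}$, $G_n$, $H_n$, respectively. For a commutative $\mathcal O$-algebra $R$, its group of $R$-points is the set $\Lambda\otimes_{\mathbb Z}R$ with multiplication $g*h=g+h+\beta(g,h)$, where $\beta$ is the $R$-bilinear map with $\beta(x_i,x_j)=[x_i,x_j]$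 if $i>j$, $\beta(x_i,x_j)=0$ if $i\le j$, and $\beta=0$ if one argument is some $y_{ij}$. (Thus group commutators are given by the Lie bracket.) Zeta functions. For a finite group $G$, let $c_m(G)$ be the number of conjugacy classes of $G$ of cardinality $m$, and $\zeta^{\mathrm{cc}}_G(s)=\sum_{m\ge1}c_m(G)m^{-s}$. For $\mathbf G\in\{F_{n,\delta},G_n,H_n\}$, $$\mathcal Z^{\mathrm{cc}}_{\mathbf G(\mathfrak o)}(s_1,s_2)=\sum_{N=0}^\infty \zeta^{\mathrm{cc}}_{\mathbf G(\mathfrak o/\mathfrak p^N)}(s_1)\,q^{-Ns_2},$$ for complex variables $s_1,s_2$ with sufficiently large real parts (where the series converges). *)

theory Defs
  imports
    "HOL-Analysis.Analysis"
    "HOL-Algebra.Algebraic_Closure_Type"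
    "HOL-Algebra.Ideal_Product"
    "HOL-Algebra.Group_Action"
begin

section \<open>Number fields and completions\<close>

text \<open>A number field is a subfield, of finite degree over the rationals, of some ambient field of
  characteristic zero.  The choice \<open>K = UNIV\<close> is allowed; taking the complex numbers
  as ambient field covers every number field up to isomorphism.\<close>

definition number_field :: "'a::field_char_0 set \<Rightarrow> bool" where
  "number_field K \<longleftrightarrow>
     subfield K ring_of_type_algebra \<and>
     ring.finite_dimension ring_of_type_algebra \<rat> K"

definition ring_of_integers :: "'a::field_char_0 set \<Rightarrow> 'a ring" where
  "ring_of_integers K = ring_of_type_algebra \<lparr>carrier := {x \<in> K. algebraic_int x}\<rparr>"

definition ideal_pow :: "('a, 'b) ring_scheme \<Rightarrow> 'a set \<Rightarrow> nat \<Rightarrow> 'a set" where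
  "ideal_pow R I N = I [^]\<^bsub>ideals_set R\<^esub> N"

text \<open>The \<open>I\<close>-adic completion, i.e. the inverse limit of the rings \<open>R / I\<^sup>N\<close>.  An element is a
  sequence of cosets; the transition map \<open>R / I\<^sup>N\<^sup>+\<^sup>1 \<rightarrow> R / I\<^sup>N\<close> sends a coset \<open>c\<close> to \<open>c + I\<^sup>N\<close>.\<close>

definition completion :: "('a, 'b) ring_scheme \<Rightarrow> 'a set \<Rightarrow> (nat \<Rightarrow> 'a set) ring" where
  "completion R I =
     \<lparr>carrier = {f. \<forall>N. f N \<in> carrier (R Quot ideal_pow R I N) \<and>
                       f (Suc N) <+>\<^bsub>R\<^esub> ideal_pow R I N = f N},
      monoid.mult = (\<lambda>f g N. f N \<otimes>\<^bsub>R Quot ideal_pow R I N\<^esub> g N),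
      one = (\<lambda>N. \<one>\<^bsub>R Quot ideal_pow R I N\<^esub>),
      ring.zero = (\<lambda>N. \<zero>\<^bsub>R Quot ideal_pow R I N\<^esub>),
      add = (\<lambda>f g N. f N \<oplus>\<^bsub>R Quot ideal_pow R I N\<^esub> g N)\<rparr>"

text \<open>Only meaningful for local rings.\<close>

definition the_max_ideal :: "('a, 'b) ring_scheme \<Rightarrow> 'a set" where
  "the_max_ideal R = (THE M. maximalideal M R)"


section \<open>The Lie lattices\<close>

datatype gen = Gx nat | Gy nat nat

text \<open>A lattice is presented by its basis and its defining relations, where \<open>(u, v, w) \<in> relations \<Lambda>\<close>
  stands for \<open>[u, v] = w\<close>.\<close>

record lie_lattice =
  basis :: "gen set"
  relations :: "(gen \<times> gen \<times> gen) set"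

text \<open>The coefficient of the basis element \<open>w\<close> in \<open>[u, v]\<close>: brackets of basis elements are determined
  by the relations and antisymmetry, and vanish otherwise.\<close>

definition bracket_coeff :: "lie_lattice \<Rightarrow> gen \<Rightarrow> gen \<Rightarrow> gen \<Rightarrow> int" where
  "bracket_coeff \<Lambda> u v w =
     of_bool ((u, v, w) \<in> relations \<Lambda>) - of_bool ((v, u, w) \<in> relations \<Lambda>)"

definition lattice_F :: "nat \<Rightarrow> nat \<Rightarrow> lie_lattice" where
  "lattice_F n \<delta> =
     \<lparr>basis = {Gx k | k. 1 \<le> k \<and> k \<le> 2 * n + \<delta>} \<union> {Gy i j | i j. 1 \<le> i \<and> i < j \<and> j \<le> 2 * n + \<delta>},
      relations = {(Gx i, Gx j, Gy i j) | i j. 1 \<le> i \<and> i < j \<and> j \<le> 2 * n + \<delta>}\<rparr>"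

definition lattice_G :: "nat \<Rightarrow> lie_lattice" where
  "lattice_G n =
     \<lparr>basis = {Gx k | k. 1 \<le> k \<and> k \<le> 2 * n} \<union> {Gy i j | i j. i \<in> {1..n} \<and> j \<in> {1..n}},
      relations = {(Gx i, Gx (n + j), Gy i j) | i j. i \<in> {1..n} \<and> j \<in> {1..n}}\<rparr>"

definition lattice_H :: "nat \<Rightarrow> lie_lattice" where
  "lattice_H n =
     \<lparr>basis = {Gx k | k. 1 \<le> k \<and> k \<le> 2 * n} \<union> {Gy i j | i j. 1 \<le> i \<and> i \<le> j \<and> j \<le> n},
      relations = {(Gx i, Gx (n + j), Gy i j) | i j. 1 \<le> i \<and> i \<le> j \<and> j \<le> n} \<union>
                  {(Gx j, Gx (n + i), Gy i j) | i j. 1 \<le> i \<and> i \<le> j \<and> j \<le> n}\<rparr>"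


section \<open>The unipotent group schemes\<close>

text \<open>The coefficient of \<open>w\<close> in \<open>\<beta>(u, v)\<close>, for basis elements \<open>u\<close>, \<open>v\<close>, \<open>w\<close>.\<close>

fun beta_coeff :: "lie_lattice \<Rightarrow> gen \<Rightarrow> gen \<Rightarrow> gen \<Rightarrow> int" where
  "beta_coeff \<Lambda> (Gx i) (Gx j) w = (if i > j then bracket_coeff \<Lambda> (Gx i) (Gx j) w else 0)"
| "beta_coeff \<Lambda> _ _ w = 0"

text \<open>Elements of \<open>\<Lambda> \<otimes> R\<close> are given by their coordinates with respect to the basis.\<close>

definition beta :: "lie_lattice \<Rightarrow> ('r, 'm) ring_scheme \<Rightarrow> (gen \<Rightarrow> 'r) \<Rightarrow> (gen \<Rightarrow> 'r) \<Rightarrow> gen \<Rightarrow> 'r" where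
  "beta \<Lambda> R g h w =
     (\<Oplus>\<^bsub>R\<^esub>u\<in>basis \<Lambda>. \<Oplus>\<^bsub>R\<^esub>v\<in>basis \<Lambda>. [beta_coeff \<Lambda> u v w] \<cdot>\<^bsub>R\<^esub> (g u \<otimes>\<^bsub>R\<^esub> h v))"

definition group_points :: "lie_lattice \<Rightarrow> ('r, 'm) ring_scheme \<Rightarrow> (gen \<Rightarrow> 'r) monoid" where
  "group_points \<Lambda> R =
     \<lparr>carrier = basis \<Lambda> \<rightarrow>\<^sub>E carrier R,
      monoid.mult = (\<lambda>g h. \<lambda>w \<in> basis \<Lambda>. g w \<oplus>\<^bsub>R\<^esub> h w \<oplus>\<^bsub>R\<^esub> beta \<Lambda> R g h w),
      one = (\<lambda>w \<in> basis \<Lambda>. \<zero>\<^bsub>R\<^esub>)\<rparr>"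


section \<open>Conjugacy class zeta functions\<close>

definition conj_classes :: "('g, 'm) monoid_scheme \<Rightarrow> 'g set set" where
  "conj_classes G =
     orbits G (carrier G) (\<lambda>g. \<lambda>h \<in> carrier G. g \<otimes>\<^bsub>G\<^esub> h \<otimes>\<^bsub>G\<^esub> inv\<^bsub>G\<^esub> g)"

definition class_count :: "('g, 'm) monoid_scheme \<Rightarrow> nat \<Rightarrow> nat" where
  "class_count G m = card {C \<in> conj_classes G. card C = m}"

definition zeta_cc :: "('g, 'm) monoid_scheme \<Rightarrow> complex \<Rightarrow> complex" where
  "zeta_cc G s = (\<Sum>\<^sub>\<infinity>m\<in>{1..}. of_nat (class_count G m) * of_nat m powr (- s))"

definition ideal_index :: "('a, 'b) ring_scheme \<Rightarrow> 'a set \<Rightarrow> nat" where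
  "ideal_index R I = card (carrier (R Quot I))"

text \<open>The summands, indexed by \<open>N\<close>, of the bivariate conjugacy class zeta function of the group of
  \<open>\<oo>\<close>-points, where \<open>\<oo>\<close> is the completion of the ring of integers of \<open>K\<close> at \<open>\<pp>\<close>.\<close>

definition Zcc_term ::
    "lie_lattice \<Rightarrow> 'a::field_char_0 set \<Rightarrow> 'a set \<Rightarrow> complex \<Rightarrow> complex \<Rightarrow> nat \<Rightarrow> complex" where
  "Zcc_term \<Lambda> K \<pp> s1 s2 N =
     (let \<oo> = completion (ring_of_integers K) \<pp>;
          q = ideal_index (ring_of_integers K) \<pp>
      in zeta_cc (group_points \<Lambda> (\<oo> Quot ideal_pow \<oo> (the_max_ideal \<oo>) N)) s1
         * of_nat q powr (- of_nat N * s2))"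

definition Zcc :: "lie_lattice \<Rightarrow> 'a::field_char_0 set \<Rightarrow> 'a set \<Rightarrow> complex \<Rightarrow> complex \<Rightarrow> complex" where
  "Zcc \<Lambda> K \<pp> s1 s2 = (\<Sum>N. Zcc_term \<Lambda> K \<pp> s1 s2 N)"

end

theory Submission
  imports Defs "Jordan_Normal_Form.Char_Poly"
begin

text \<open>The quotients of the completion are finite chain rings \<open>A\<close>: every element is \<open>\<pi>\<^sup>k u\<close> with \<open>u\<close> a unit,
  and \<open>\<pi>\<^sup>k A\<close> has \<open>q\<^sup>N\<^sup>-\<^sup>k\<close> elements.  In a group of class two the conjugacy class of \<open>g\<close> has as many
  elements as \<open>[g, \<Lambda> \<otimes> A]\<close>, so it is enough to count, for the vector \<open>x\<close> of \<open>x\<^sub>i\<close>-coordinates of \<open>g\<close>, the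
  solutions \<open>z\<close> of the linear system \<open>[z, x] = 0\<close>.  For \<open>\<F>\<close> it says that all \<open>2 \<times> 2\<close> minors of \<open>(x, z)\<close>
  vanish, and the number of solutions depends on the valuation of \<open>x\<close> only.  For \<open>\<G>\<close> and \<open>\<H>\<close> write
  \<open>x = (a, b)\<close>; for \<open>\<G>\<close> the number of solutions depends on the valuations of \<open>a\<close> and \<open>b\<close>, and for \<open>\<H>\<close>,
  where one may assume that the valuation of \<open>a\<close> is at most that of \<open>b\<close>, on the valuations of \<open>a\<close> and of
  \<open>b\<close> modulo multiples of \<open>a\<close>.  Summation over the valuations gives convolutions of
  geometric progressions in \<open>N\<close>, whose generating functions are rational.\<close>

section \<open>Algebraic integers\<close>

text \<open>The number field enters through one local fact: some \<pi> in P and some s outside P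
  satisfy s P \<subseteq> \<pi> \<O>. As s is invertible modulo every power of P, the completion
  behaves like a discrete valuation ring, and the counting takes place in its finite quotients. The
  families differ in which changes of (a, b) preserve the shape of [z, x] = 0. For \<G> the
  conditions form a full matrix equation between a d^T and c b^T, a and b cannot be mixed, and their
  two valuations decide. For \<H> the conditions are symmetric in i and j, so adding t a to b is
  matched by adding t c to d; the valuation of b becomes meaningful only after one entry has been
  cleared. Hence one coordinate of b is summed out and weights for n - 1 entries occur. Counting by
  the remaining length N - k instead of the valuation k turns the zeta function of each quotient
  into a power of q^N times a partial sum over l \<le> N of a sequence p that does not depend on N.
  The generating series is then that of p divided by one linear factor, the first factor of each
  denominator.\<close>

definition int_span :: "'i set \<Rightarrow> ('i \<Rightarrow> 'a::comm_ring_1) \<Rightarrow> 'a set" where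
  "int_span I w = range (\<lambda>c. \<Sum>i\<in>I. of_int (c i) * w i)"

lemma int_span_base: "finite I \<Longrightarrow> i \<in> I \<Longrightarrow> w i \<in> int_span I w"
  unfolding int_span_def
  by (rule range_eqI[where x = "\<lambda>j. if j = i then 1 else 0"])
    (simp add: if_distrib[of of_int] if_distrib[of "\<lambda>t. t * _"] cong: if_cong)

lemma int_span_zero: "0 \<in> int_span I w"
  unfolding int_span_def by (rule range_eqI[where x = "\<lambda>j. 0"]) simp

lemma int_span_add: "x \<in> int_span I w \<Longrightarrow> y \<in> int_span I w \<Longrightarrow> x + y \<in> int_span I w"
proof -
  assume "x \<in> int_span I w" "y \<in> int_span I w"
  then obtain c d where "x = (\<Sum>i\<in>I. of_int (c i) * w i)" "y = (\<Sum>i\<in>I. of_int (d i) * w i)"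
    unfolding int_span_def by blast
  then have "x + y = (\<Sum>i\<in>I. of_int (c i + d i) * w i)"
    by (simp add: algebra_simps sum.distrib)
  then show ?thesis unfolding int_span_def by (rule range_eqI[where x = "\<lambda>i. c i + d i"])
qed

lemma int_span_scale: "x \<in> int_span I w \<Longrightarrow> of_int k * x \<in> int_span I w"
proof -
  assume "x \<in> int_span I w"
  then obtain c where "x = (\<Sum>i\<in>I. of_int (c i) * w i)"
    unfolding int_span_def by blast
  then have "of_int k * x = (\<Sum>i\<in>I. of_int (k * c i) * w i)"
    by (simp add: sum_distrib_left mult.assoc)
  then show ?thesis unfolding int_span_def by (rule range_eqI[where x = "\<lambda>i. k * c i"])
qed

lemma int_span_sum: "(\<And>j. j \<in> J \<Longrightarrow> f j \<in> int_span I w) \<Longrightarrow> sum f J \<in> int_span I w"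
  by (induction J rule: infinite_finite_induct) (auto simp: int_span_zero int_span_add)

text \<open>Serves the product of two algebraic integers: the second multiplication meets an
  arbitrary element of the span instead of a generator.\<close>

lemma int_span_mult:
  assumes "\<And>i. i \<in> I \<Longrightarrow> z * w i \<in> int_span I w" and "x \<in> int_span I w"
  shows "z * x \<in> int_span I w"
proof -
  from assms(2) obtain c where x: "x = (\<Sum>i\<in>I. of_int (c i) * w i)"
    unfolding int_span_def by blast
  have "z * x = (\<Sum>i\<in>I. of_int (c i) * (z * w i))"
    unfolding x by (simp add: sum_distrib_left algebra_simps)
  then show ?thesis using assms(1) by (auto intro!: int_span_sum int_span_scale)
qed

text \<open>The determinant trick: \<open>z\<close> is an eigenvalue of an integer matrix.\<close>

lemma algebraic_int_if_stable:
  fixes z :: "'a::field_char_0"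
  assumes fin: "finite I" and i0: "i0 \<in> I" "w i0 \<noteq> 0"
    and stable: "\<And>i. i \<in> I \<Longrightarrow> z * w i \<in> int_span I w"
  shows "algebraic_int z"
proof -
  from stable have "\<forall>i\<in>I. \<exists>c. z * w i = (\<Sum>j\<in>I. of_int (c j) * w j)"
    unfolding int_span_def by blast
  then obtain A where A: "\<And>i. i \<in> I \<Longrightarrow> z * w i = (\<Sum>j\<in>I. of_int (A i j) * w j)"
    by metis
  define n where "n = card I"
  obtain h where h: "bij_betw h {0..<n} I"
    using ex_bij_betw_nat_finite[OF fin] unfolding n_def by blast
  have hI: "h i \<in> I" if "i < n" for i using h that by (auto dest: bij_betwE)
  define M where "M = mat n n (\<lambda>(i, j). A (h i) (h j))"
  define v where "v = vec n (\<lambda>i. w (h i))"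
  have M: "M \<in> carrier_mat n n" "map_mat (of_int :: int \<Rightarrow> 'a) M \<in> carrier_mat n n" by (auto simp: M_def)
  have "map_mat of_int M *\<^sub>v v = z \<cdot>\<^sub>v v"
  proof (rule eq_vecI)
    fix i assume "i < dim_vec (z \<cdot>\<^sub>v v)"
    then have i: "i < n" by (simp add: v_def)
    have "vec_index (map_mat of_int M *\<^sub>v v) i = (\<Sum>j = 0..<n. of_int (A (h i) (h j)) * w (h j))"
      using i by (simp add: M_def v_def scalar_prod_def)
    also have "\<dots> = (\<Sum>j\<in>I. of_int (A (h i) j) * w j)"
      by (rule sum.reindex_bij_betw[OF h])
    also have "\<dots> = vec_index (z \<cdot>\<^sub>v v) i" using A[OF hI[OF i]] i by (simp add: v_def)
    finally show "vec_index (map_mat of_int M *\<^sub>v v) i = vec_index (z \<cdot>\<^sub>v v) i" .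
  qed (auto simp: v_def M_def)
  moreover obtain j where "j < n" "h j = i0"
    using h i0(1) unfolding bij_betw_def by force
  then have "v \<noteq> 0\<^sub>v n" using i0(2) unfolding v_def by (metis index_vec index_zero_vec(1))
  ultimately have "eigenvalue (map_mat of_int M) z"
    unfolding eigenvalue_def eigenvector_def by (intro exI[of _ v]) (simp add: M_def v_def)
  then have "poly (char_poly (map_mat of_int M)) z = 0"
    using eigenvalue_root_char_poly[OF M(2)] by simp
  then have "poly (map_poly of_int (char_poly M)) z = 0"
    using of_int_hom.char_poly_hom[OF M(1), where 'a = 'a] by simp
  moreover have "poly.coeff (char_poly M) (Polynomial.degree (char_poly M)) = 1"
    using degree_monic_char_poly[OF M(1)] by simp
  ultimately show ?thesis unfolding algebraic_int_altdef_ipoly by blast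
qed

lemma algebraic_int_power_eq:
  fixes x :: "'a::field_char_0"
  assumes "algebraic_int x"
  obtains m c where "m > 0" "x ^ m = (\<Sum>i<m. of_int (c i) * x ^ i)"
proof -
  obtain p where p: "poly (map_poly of_int p) x = 0" "poly.coeff p (Polynomial.degree p) = 1"
    using assms unfolding algebraic_int_altdef_ipoly by blast
  define m where "m = Polynomial.degree p"
  have "0 = (\<Sum>i\<le>m. of_int (poly.coeff p i) * x ^ i)"
    using p(1) unfolding m_def by (simp add: poly_altdef)
  also have "\<dots> = (\<Sum>i<m. of_int (poly.coeff p i) * x ^ i) + x ^ m"
    using p(2) by (simp add: m_def lessThan_Suc_atMost[symmetric])
  finally have *: "x ^ m = (\<Sum>i<m. of_int (- poly.coeff p i) * x ^ i)"
    by (simp add: sum_negf eq_neg_iff_add_eq_0 add.commute)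
  \<comment> \<open>For \<open>m = 0\<close> the relation would say 1 = 0.\<close>
  have "m \<noteq> 0" using * by (cases "m = 0") auto
  with * show ?thesis using that[of m "\<lambda>i. - poly.coeff p i"] by blast
qed

text \<open>The monic equations reduce x^m and y^n to lower powers, so the group spanned by the
  finitely many monomials x^i y^j is stable under x and under y, hence under their sum and product.
  The monomial 1 is the nonzero generator that the determinant trick asks for.\<close>

lemma algebraic_int_add_mult:
  fixes x y :: "'a::field_char_0"
  assumes "algebraic_int x" "algebraic_int y"
  shows "algebraic_int (x + y) \<and> algebraic_int (x * y)"
proof -
  obtain m c where m: "m > 0" "x ^ m = (\<Sum>i<m. of_int (c i) * x ^ i)"
    using algebraic_int_power_eq[OF assms(1)] by metis
  obtain n d where n: "n > 0" "y ^ n = (\<Sum>i<n. of_int (d i) * y ^ i)"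
    using algebraic_int_power_eq[OF assms(2)] by metis
  define I where "I = {..<m} \<times> {..<n}"
  define w where "w = (\<lambda>(i, j). x ^ i * y ^ j)"
  have fin: "finite I" by (simp add: I_def)
  have base: "x ^ i * y ^ j \<in> int_span I w" if "i < m" "j < n" for i j
    using int_span_base[OF fin, of "(i, j)" w] that by (simp add: I_def w_def)
  have X: "x * w k \<in> int_span I w" if kI: "k \<in> I" for k
  proof -
    obtain i j where k: "k = (i, j)" "i < m" "j < n" using kI by (auto simp: I_def)
    show ?thesis
    proof (cases "Suc i < m")
      case True then show ?thesis using base[OF True k(3)] by (simp add: k w_def mult.assoc)
    next
      case False
      then have "m = Suc i" using k by simp
      then have "x * w k = x ^ m * y ^ j" by (simp add: k w_def)
      also have "\<dots> = (\<Sum>i<m. of_int (c i) * (x ^ i * y ^ j))"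
        unfolding m(2) by (simp add: sum_distrib_right mult.assoc)
      finally show ?thesis using base k(3) by (auto intro!: int_span_sum int_span_scale)
    qed
  qed
  have Y: "y * w k \<in> int_span I w" if kI: "k \<in> I" for k
  proof -
    obtain i j where k: "k = (i, j)" "i < m" "j < n" using kI by (auto simp: I_def)
    show ?thesis
    proof (cases "Suc j < n")
      case True then show ?thesis using base[OF k(2) True] by (simp add: k w_def algebra_simps)
    next
      case False
      then have "n = Suc j" using k by simp
      then have "y * w k = x ^ i * y ^ n" by (simp add: k w_def)
      also have "\<dots> = (\<Sum>j<n. of_int (d j) * (x ^ i * y ^ j))"
        unfolding n(2) by (simp add: sum_distrib_left algebra_simps)
      finally show ?thesis using base k(2) by (auto intro!: int_span_sum int_span_scale)
    qed
  qed
  have i0: "(0, 0) \<in> I" "w (0, 0) \<noteq> 0" using m n by (auto simp: I_def w_def)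
  have "algebraic_int (x + y)"
    by (rule algebraic_int_if_stable[OF fin i0(1), of w, OF i0(2)]) (simp add: distrib_right int_span_add X Y)
  moreover have "algebraic_int (x * y)"
    by (rule algebraic_int_if_stable[OF fin i0(1), of w, OF i0(2)]) (simp add: mult.assoc int_span_mult X Y)
  ultimately show ?thesis ..
qed

lemma algebraic_int_add: "algebraic_int x \<Longrightarrow> algebraic_int y \<Longrightarrow> algebraic_int (x + y)"
  and algebraic_int_mult: "algebraic_int x \<Longrightarrow> algebraic_int y \<Longrightarrow> algebraic_int (x * y)"
  for x y :: "'a::field_char_0"
  using algebraic_int_add_mult by blast+

section \<open>Number fields as rational vector spaces, and their integers\<close>

interpretation rat_vs: vector_space "\<lambda>r x. of_rat r * (x :: 'a::field_char_0)"
  by unfold_locales (simp_all add: algebra_simps of_rat_add of_rat_mult)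

lemma ring_of_type_algebra_simps [simp]:
  "carrier ring_of_type_algebra = UNIV"
  "x \<otimes>\<^bsub>ring_of_type_algebra\<^esub> y = x * y" "\<one>\<^bsub>ring_of_type_algebra\<^esub> = 1"
  "x \<oplus>\<^bsub>ring_of_type_algebra\<^esub> y = x + y" "\<zero>\<^bsub>ring_of_type_algebra\<^esub> = 0"
  by (simp_all add: ring_of_type_algebra_def)

lemma number_field_closed:
  fixes K :: "'a::field_char_0 set"
  assumes "number_field K"
  shows "x \<in> K \<Longrightarrow> y \<in> K \<Longrightarrow> x + y \<in> K" "x \<in> K \<Longrightarrow> y \<in> K \<Longrightarrow> x * y \<in> K"
    "x \<in> K \<Longrightarrow> - x \<in> K" "1 \<in> K" "0 \<in> K" "x \<in> K \<Longrightarrow> inverse x \<in> K"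
proof -
  interpret R: field "ring_of_type_algebra :: 'a ring" by (rule field_from_type_algebra)
  have sf: "subfield K ring_of_type_algebra" using assms unfolding number_field_def by simp
  interpret subfield K ring_of_type_algebra by (rule sf)
  have neg: "\<ominus>\<^bsub>ring_of_type_algebra\<^esub> x = - x" for x :: 'a
    by (rule R.minus_equality) simp_all
  show "x \<in> K \<Longrightarrow> y \<in> K \<Longrightarrow> x + y \<in> K" "x \<in> K \<Longrightarrow> y \<in> K \<Longrightarrow> x * y \<in> K"
    using subringE(6,7)[OF subring_axioms] by simp_all
  show "x \<in> K \<Longrightarrow> - x \<in> K" using subringE(5)[OF subring_axioms] neg by metis
  show K01: "1 \<in> K" "0 \<in> K" using subringE(2,3)[OF subring_axioms] by simp_all
  show "inverse x \<in> K" if "x \<in> K"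
  proof (cases "x = 0")
    case False
    have "inv\<^bsub>ring_of_type_algebra\<^esub> x = inverse x"
      by (rule R.comm_inv_char) (use False in simp_all)
    moreover have "x \<in> K - {\<zero>\<^bsub>ring_of_type_algebra\<^esub>}" using that False by simp
    ultimately show ?thesis using R.subfield_m_inv(1)[OF sf, of x] by simp
  qed (use K01 in simp)
qed

lemma number_field_of_int:
  assumes "number_field K" shows "of_int k \<in> (K :: 'a::field_char_0 set)"
proof -
  have nat: "of_nat n \<in> K" for n
    by (induction n) (simp_all add: number_field_closed[OF assms])
  show ?thesis
    by (cases k rule: int_cases2) (simp_all add: nat number_field_closed(3)[OF assms])
qed

text \<open>Turns the dimension hypothesis into the form required by the exchange lemma for
  \<open>rat_vs\<close>: independent subsets of K are no larger than B.\<close>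

lemma number_field_finite_span:
  fixes K :: "'a::field_char_0 set"
  assumes "number_field K"
  obtains B where "finite B" "K \<subseteq> rat_vs.span B"
proof -
  interpret R: field "ring_of_type_algebra :: 'a ring" by (rule field_from_type_algebra)
  have "R.finite_dimension \<rat> K" using assms unfolding number_field_def by simp
  then obtain n where "R.dimension n \<rat> K" unfolding R.finite_dimension_def by blast
  have sub: "R.Span \<rat> Us \<subseteq> rat_vs.span (set Us)" for Us :: "'a list"
  proof (induction Us)
    case (Cons a Us)
    show ?case
    proof
      fix x assume "x \<in> R.Span \<rat> (a # Us)"
      then obtain r e where x: "r \<in> \<rat>" "e \<in> R.Span \<rat> Us" "x = r * a + e"
        unfolding R.Span.simps by (auto simp: R.line_extension_def set_add_def' r_coset_def)
      then obtain t where "r = of_rat t" by (auto elim: Rats_cases)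
      then show "x \<in> rat_vs.span (set (a # Us))"
        using x(2) Cons rat_vs.span_mono[of "set Us" "set (a # Us)"] unfolding x(3)
        by (intro rat_vs.span_add) (auto intro: rat_vs.span_scale rat_vs.span_base)
    qed
  qed simp
  have "\<exists>Us. R.Span Q Us = E" if "R.dimension n Q E" for n Q E
    using that
  proof (induction rule: R.dimension.induct)
    case zero_dim then show ?case by (intro exI[of _ "[]"]) simp
  next
    case (Suc_dim v E n Q)
    then obtain Us where "R.Span Q Us = E" by blast
    then show ?case by (intro exI[of _ "v # Us"]) simp
  qed
  then obtain Us where "R.Span \<rat> Us = K" using \<open>R.dimension n \<rat> K\<close> by blast
  then show ?thesis using that[of "set Us"] sub by blast
qed


definition integers :: "'a::field_char_0 set \<Rightarrow> 'a set" where
  "integers K = {x \<in> K. algebraic_int x}"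

lemma integers_closed:
  fixes K :: "'a::field_char_0 set"
  assumes K: "number_field K"
  shows "x \<in> integers K \<Longrightarrow> y \<in> integers K \<Longrightarrow> x + y \<in> integers K"
    "x \<in> integers K \<Longrightarrow> y \<in> integers K \<Longrightarrow> x * y \<in> integers K"
    "x \<in> integers K \<Longrightarrow> - x \<in> integers K"
    "x \<in> integers K \<Longrightarrow> y \<in> integers K \<Longrightarrow> x - y \<in> integers K"
    "of_int k \<in> integers K" "0 \<in> integers K" "1 \<in> integers K"
    "x \<in> integers K \<Longrightarrow> x ^ n \<in> integers K"
proof -
  show add: "x + y \<in> integers K" if "x \<in> integers K" "y \<in> integers K" for x y
    using that by (simp add: integers_def number_field_closed[OF K] algebraic_int_add)
  show mult: "x * y \<in> integers K" if "x \<in> integers K" "y \<in> integers K" for x y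
    using that by (simp add: integers_def number_field_closed[OF K] algebraic_int_mult)
  show neg: "- x \<in> integers K" if "x \<in> integers K" for x
    using that by (simp add: integers_def number_field_closed[OF K])
  show "x - y \<in> integers K" if "x \<in> integers K" "y \<in> integers K"
    using add[OF that(1) neg[OF that(2)]] by simp
  show "of_int k \<in> integers K" by (simp add: integers_def number_field_of_int[OF K])
  show "0 \<in> integers K" and one: "1 \<in> integers K"
    by (simp_all add: integers_def number_field_closed[OF K])
  show "x ^ n \<in> integers K" if "x \<in> integers K"
    by (induction n) (simp_all add: one mult that)
qed

lemma rationals_common_denominator:
  fixes u :: "'b \<Rightarrow> rat"
  assumes "finite S"
  obtains D :: int and c :: "'b \<Rightarrow> int" where "D \<noteq> 0" "\<And>v. v \<in> S \<Longrightarrow> of_int D * u v = of_int (c v)"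
proof -
  have "\<exists>D::int. D \<noteq> 0 \<and> (\<forall>v\<in>S. of_int D * u v \<in> \<int>)"
    using assms
  proof (induction S)
    case (insert a S)
    then obtain D :: int where D: "D \<noteq> 0" "\<forall>v\<in>S. of_int D * u v \<in> \<int>" by blast
    obtain m k :: int where mk: "u a = of_int m / of_int k" "k > 0"
      by (metis quotient_of_div quotient_of_denom_pos surj_pair)
    have "of_int (D * k) * u v \<in> \<int>" if "v \<in> insert a S" for v
    proof (cases "v = a")
      case True
      then have "of_int (D * k) * u v = of_int (D * m)" using mk by simp
      then show ?thesis by (metis Ints_of_int)
    next
      case False
      then have "of_int D * u v \<in> \<int>" using D that by blast
      then have "of_int k * (of_int D * u v) \<in> \<int>" by (rule Ints_mult[OF Ints_of_int])
      then show ?thesis by (simp add: mult_ac)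
    qed
    with D(1) mk(2) show ?case by (intro exI[of _ "D * k"]) auto
  qed (auto intro: exI[of _ "1::int"])
  then obtain D :: int where D: "D \<noteq> 0" "\<forall>v\<in>S. of_int D * u v \<in> \<int>" by blast
  then have "\<forall>v\<in>S. \<exists>c::int. of_int D * u v = of_int c" by (metis Ints_cases)
  then obtain c :: "'b \<Rightarrow> int" where "\<forall>v\<in>S. of_int D * u v = of_int (c v)" by metis
  then show ?thesis using that D(1) by blast
qed

text \<open>A rational dependence relation can be scaled to have coprime integer coefficients, so
  elements independent modulo \<open>\<ell>\<close> are linearly independent over the rationals.\<close>

lemma finite_integers_mod_prime:
  fixes K :: "'a::field_char_0 set" and l :: int
  assumes K: "number_field K" and l: "normalization_semidom_class.prime l"
  obtains F where "finite F" "F \<subseteq> integers K"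
    "\<And>x. x \<in> integers K \<Longrightarrow> \<exists>r\<in>F. \<exists>z\<in>integers K. x - r = of_int l * z"
proof -
  define L where "L = (\<lambda>z. of_int l * z) ` integers K"
  note cl = integers_closed[OF K]
  obtain B where B: "finite B" "K \<subseteq> rat_vs.span B" using number_field_finite_span[OF K] .
  \<comment> \<open>Independence of the classes of S in \<O> / l \<O> over the field with l
    elements, phrased with integer coefficients so that no quotient has to be formed.\<close>
  define indep where "indep S \<longleftrightarrow> finite S \<and> S \<subseteq> integers K \<and>
     (\<forall>c. (\<Sum>b\<in>S. of_int (c b) * b) \<in> L \<longrightarrow> (\<forall>b\<in>S. l dvd c b))" for S
  have bound: "card S \<le> card B" if S: "indep S" for S
  proof -
    have "\<not> rat_vs.dependent S"
    proof
      assume "rat_vs.dependent S"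
      then obtain u where u: "\<exists>v\<in>S. u v \<noteq> 0" "(\<Sum>v\<in>S. of_rat (u v) * v) = 0"
        using rat_vs.dependent_finite[of S] S unfolding indep_def by auto
      obtain D c where D: "D \<noteq> 0" "\<And>v. v \<in> S \<Longrightarrow> of_int D * u v = of_int (c v)"
        using rationals_common_denominator[of S u] S unfolding indep_def by metis
      define g where "g = Gcd (c ` S)"
      have cv: "of_int (c v) = (of_int D * of_rat (u v) :: 'a)" if "v \<in> S" for v
        using arg_cong[OF D(2)[OF that], of "of_rat :: rat \<Rightarrow> 'a"] by (simp add: of_rat_mult)
      have c0: "\<exists>v\<in>S. c v \<noteq> 0" using u(1) D by force
      then have g0: "g \<noteq> 0" unfolding g_def by auto
      define d where "d v = c v div g" for v
      have cd: "c v = g * d v" if "v \<in> S" for v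
        unfolding d_def g_def using that by (simp add: Gcd_dvd)
      have "(\<Sum>v\<in>S. of_int (c v) * v) = of_int D * (\<Sum>v\<in>S. of_rat (u v) * v)"
        by (simp add: sum_distrib_left cv mult.assoc)
      then have "0 = (\<Sum>v\<in>S. of_int (g * d v) * v)" using u(2) by (simp add: cd)
      also have "\<dots> = of_int g * (\<Sum>v\<in>S. of_int (d v) * v)"
        by (simp add: sum_distrib_left mult.assoc)
      finally have "(\<Sum>v\<in>S. of_int (d v) * v) = 0" using g0 by simp
      moreover have "0 \<in> L" unfolding L_def using cl(6) by force
      ultimately have "\<forall>v\<in>S. l dvd d v" using S unfolding indep_def by metis
      then have "g * l dvd c v" if "v \<in> S" for v
        using that cd[OF that] by (simp add: mult_dvd_mono)
      then have "g * l dvd g" unfolding g_def by (intro Gcd_greatest) blast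
      then have "l dvd 1" using g0 by (metis dvd_mult_cancel_left mult.right_neutral)
      then show False using l not_prime_unit by blast
    qed
    moreover have "S \<subseteq> rat_vs.span B" using S B unfolding indep_def integers_def by blast
    ultimately show ?thesis using rat_vs.independent_span_bound[OF B(1)] by blast
  qed
  have ex: "indep {}" unfolding indep_def by simp
  \<comment> \<open>Cardinalities of independent sets are bounded by \<open>card B\<close>, so a
    largest one exists; it will be shown to span \<O> modulo l.\<close>
  define k where "k = Max (card ` {S. indep S})"
  have fin: "finite (card ` {S. indep S})"
    by (rule finite_subset[of _ "{..card B}"]) (use bound in auto)
  have "k \<in> card ` {S. indep S}" unfolding k_def by (rule Max_in[OF fin]) (use ex in auto)
  then obtain S where S: "indep S" "card S = k" by blast
  have max: "card S' \<le> k" if "indep S'" for S'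
    unfolding k_def by (rule Max_ge[OF fin]) (use that in auto)
  define F where "F = (\<lambda>c. \<Sum>b\<in>S. of_int (c b) * b) ` (S \<rightarrow>\<^sub>E {0..<l})"
  have sumO: "(\<Sum>b\<in>S'. of_int (c b) * b) \<in> integers K" if "S' \<subseteq> integers K" for c S'
    using that by (induction S' rule: infinite_finite_induct) (auto simp: cl)
  have SO: "finite S" "S \<subseteq> integers K" using S(1) unfolding indep_def by auto
  have lpos: "l > 0" using l by (simp add: prime_gt_0_int)
  have red: "\<exists>r\<in>F. (\<Sum>b\<in>S. of_int (c b) * b) - r \<in> L" for c
  proof (rule bexI)
    define c' where "c' = (\<lambda>b\<in>S. c b mod l)"
    show "(\<Sum>b\<in>S. of_int (c' b) * b) \<in> F"
      unfolding F_def by (rule imageI) (use lpos in \<open>auto simp: c'_def\<close>)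
    have "(\<Sum>b\<in>S. of_int (c b) * b) - (\<Sum>b\<in>S. of_int (c' b) * b)
        = (\<Sum>b\<in>S. of_int l * (of_int (c b div l) * b))"
      unfolding sum_subtractf[symmetric]
    proof (rule sum.cong)
      fix b assume "b \<in> S"
      have cb: "(of_int (c b) :: 'a) = of_int l * of_int (c b div l) + of_int (c' b)"
        using \<open>b \<in> S\<close> mult_div_mod_eq[of l "c b"] by (metis c'_def of_int_add of_int_mult restrict_apply')
      show "of_int (c b) * b - of_int (c' b) * b = of_int l * (of_int (c b div l) * b)"
        unfolding cb by (simp only: distrib_right mult.assoc add_diff_cancel_right')
    qed simp
    also have "\<dots> = of_int l * (\<Sum>b\<in>S. of_int (c b div l) * b)" by (simp add: sum_distrib_left)
    finally show "(\<Sum>b\<in>S. of_int (c b) * b) - (\<Sum>b\<in>S. of_int (c' b) * b) \<in> L"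
      unfolding L_def by (rule image_eqI[OF _ sumO[OF SO(2)]])
  qed
  have Ladd: "x + y \<in> L" if "x \<in> L" "y \<in> L" for x y
    using that unfolding L_def by (auto simp: distrib_left[symmetric] intro!: imageI cl)
  have Lmult: "x * y \<in> L" if "x \<in> L" "y \<in> integers K" for x y
    using that unfolding L_def by (auto simp: mult.assoc intro!: imageI cl)
  have main: "\<exists>r\<in>F. x - r \<in> L" if x: "x \<in> integers K" for x
  proof (cases "x \<in> S")
    case True
    have eq: "(\<Sum>b\<in>S. of_int (if b = x then 1 else 0) * b) = x"
      using True SO(1) by (simp add: if_distrib[of of_int] if_distrib[of "\<lambda>t. t * _"] cong: if_cong)
    show ?thesis using red[of "\<lambda>b. if b = x then 1 else 0"] unfolding eq .
  next
    case False
    \<comment> \<open>Maximality gives a relation modulo l that involves x. If l divided the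
      coefficient of x, the relation would already be one among members of S; so that coefficient is
      prime to l, and a Bezout inverse solves for x.\<close>
    then have "\<not> indep (insert x S)" using max[of "insert x S"] S SO by auto
    then obtain c b0 where c: "(\<Sum>b\<in>insert x S. of_int (c b) * b) \<in> L"
      "b0 \<in> insert x S" "\<not> l dvd c b0"
      using SO x unfolding indep_def by auto
    have c': "of_int (c x) * x + (\<Sum>b\<in>S. of_int (c b) * b) \<in> L" using c(1) False SO(1) by simp
    have "\<not> l dvd c x"
    proof
      assume "l dvd c x"
      then obtain d where "c x = l * d" by blast
      then have "of_int l * (of_int (- d) * x) = - (of_int (c x) * x)" by (simp add: mult_ac)
      moreover have "of_int l * (of_int (- d) * x) \<in> L"
        unfolding L_def by (rule imageI) (simp add: cl x del: of_int_minus)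
      ultimately have "- (of_int (c x) * x) \<in> L" by (simp only:)
      with Ladd[OF c'] have "(\<Sum>b\<in>S. of_int (c b) * b) \<in> L" by force
      then have "\<forall>b\<in>S. l dvd c b" using S(1) unfolding indep_def by blast
      with c \<open>l dvd c x\<close> show False by auto
    qed
    then have "coprime (c x) l" using l by (metis coprime_commute prime_imp_coprime)
    then obtain e f where ef: "c x * e + l * f = 1"
      by (metis bezout_int coprime_iff_gcd_eq_1 mult.commute)
    obtain t where t: "t \<in> L" "t = of_int (c x) * x + (\<Sum>b\<in>S. of_int (c b) * b)" using c' by blast
    have te: "t * of_int e \<in> L" using Lmult[OF t(1)] cl(5) .
    have "x = of_int (c x * e + l * f) * x" using ef by simp
    also have "\<dots> = of_int l * (of_int f * x) + t * of_int e - of_int e * (\<Sum>b\<in>S. of_int (c b) * b)"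
      unfolding t(2) by (simp add: algebra_simps)
    also have "of_int e * (\<Sum>b\<in>S. of_int (c b) * b) = - (\<Sum>b\<in>S. of_int (- e * c b) * b)"
      by (simp add: sum_distrib_left mult.assoc sum_negf)
    finally have eq: "x = (of_int l * (of_int f * x) + t * of_int e) + (\<Sum>b\<in>S. of_int (- e * c b) * b)"
      by simp
    obtain r where r: "r \<in> F" "(\<Sum>b\<in>S. of_int (- e * c b) * b) - r \<in> L"
      using red[of "\<lambda>b. - e * c b"] by blast
    have "of_int l * (of_int f * x) + t * of_int e \<in> L"
      by (rule Ladd[OF _ te]) (use x in \<open>auto simp: L_def cl intro!: imageI\<close>)
    from Ladd[OF this r(2)] have "x - r \<in> L" using eq by (simp add: algebra_simps)
    then show ?thesis using r(1) by blast
  qed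
  show ?thesis
  proof (rule that)
    show "finite F" unfolding F_def by (intro finite_imageI finite_PiE SO) simp
    show "F \<subseteq> integers K" unfolding F_def using sumO[OF SO(2)] by blast
    show "\<exists>r\<in>F. \<exists>z\<in>integers K. x - r = of_int l * z" if "x \<in> integers K" for x
      using main[OF that] unfolding L_def by blast
  qed
qed

section \<open>Prime ideals of rings of integers\<close>

text \<open>Stands in for the finiteness of a quotient ring. Applied to a sequence of powers it
  yields two exponents with congruent powers, from which inverses or integral equations are
  extracted.\<close>

lemma pigeonhole_mod:
  fixes f :: "nat \<Rightarrow> 'a::ring"
  assumes "finite F" and rep: "\<And>k. \<exists>r\<in>F. f k - r \<in> I"
    and diff: "\<And>x y. x \<in> I \<Longrightarrow> y \<in> I \<Longrightarrow> x - y \<in> I"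
  obtains i j where "i < j" "f j - f i \<in> I"
proof -
  obtain r where r: "\<And>k. r k \<in> F" "\<And>k. f k - r k \<in> I" using rep by metis
  have "finite (range r)" by (rule finite_subset[OF _ assms(1)]) (use r in auto)
  then have "\<not> inj r" by (metis finite_imageD infinite_UNIV_nat)
  then obtain i j where "i < j" "r i = r j" unfolding inj_def by (metis linorder_neqE_nat)
  then have "f j - f i \<in> I" using diff[OF r(2)[of j] r(2)[of i]] by simp
  with \<open>i < j\<close> show ?thesis by (rule that)
qed

text \<open>Prime ideals are first handled with the ordinary field operations, where calculations
  are easiest; the passage to ring records happens once, in
  \<open>chain_ring_at_prime\<close>.\<close>

locale integer_prime =
  fixes K :: "'a::field_char_0 set" and P :: "'a set"
  assumes K: "number_field K"
    and sub: "P \<subseteq> integers K" and zero: "0 \<in> P"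
    and add: "x \<in> P \<Longrightarrow> y \<in> P \<Longrightarrow> x + y \<in> P"
    and mult: "x \<in> P \<Longrightarrow> y \<in> integers K \<Longrightarrow> x * y \<in> P"
    and proper: "1 \<notin> P"
    and prime: "x \<in> integers K \<Longrightarrow> y \<in> integers K \<Longrightarrow> x * y \<in> P \<Longrightarrow> x \<in> P \<or> y \<in> P"
    and nonzero: "P \<noteq> {0}"
begin

lemmas cl = integers_closed[OF K]

lemma neg: "x \<in> P \<Longrightarrow> - x \<in> P"
  using mult[of x "- 1"] cl(3)[OF cl(7)] by simp

lemma diff: "x \<in> P \<Longrightarrow> y \<in> P \<Longrightarrow> x - y \<in> P"
  using add[OF _ neg, of x y] by simp

lemma power_mem: "x \<in> integers K \<Longrightarrow> x ^ k \<in> P \<Longrightarrow> x \<in> P"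
proof (induction k)
  case (Suc k)
  then show ?case using prime[of x "x ^ k"] cl(8)[of x k] by auto
qed (use proper in simp)

text \<open>In an integer equation for x the constant term is a multiple of x, hence in P. If the
  constant term is zero, a factor x is cancelled first, which is why the induction runs over all
  nonzero polynomials that vanish at x and not only over monic ones.\<close>

lemma ex_int: obtains m :: int where "m \<noteq> 0" "of_int m \<in> P"
proof -
  obtain x where x: "x \<in> P" "x \<noteq> 0" using nonzero zero by blast
  then have xO: "x \<in> integers K" using sub by blast
  then obtain p where p: "poly (map_poly of_int p) x = 0" "poly.coeff p (Polynomial.degree p) = (1::int)"
    unfolding integers_def algebraic_int_altdef_ipoly by blast
  have evalO: "poly (map_poly of_int q) x \<in> integers K" for q :: "int poly"
    by (induction q) (auto simp: map_poly_pCons cl xO)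
  have "p \<noteq> 0" using p(2) by auto
  then have "\<exists>m::int. m \<noteq> 0 \<and> of_int m \<in> P" using p(1)
  proof (induction p)
    case (pCons a q)
    show ?case
    proof (cases "a = 0")
      case True
      with pCons.prems have "poly (map_poly of_int q) x = 0" "q \<noteq> 0"
        using x by (auto simp: map_poly_pCons)
      then show ?thesis using pCons.IH by blast
    next
      case False
      from pCons.prems have "of_int a = - (x * poly (map_poly of_int q) x)"
        by (simp add: map_poly_pCons eq_neg_iff_add_eq_0)
      then have "of_int a \<in> P" using neg[OF mult[OF x(1) evalO[of q]]] by simp
      with False show ?thesis by blast
    qed
  qed simp
  then show ?thesis using that by blast
qed

text \<open>By primality P contains one of the rational primes that divide the integer of
  \<open>ex_int\<close>.\<close>

lemma ex_prime: obtains l :: int where "normalization_semidom_class.prime l" "of_int l \<in> P"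
proof -
  obtain m :: int where m: "m \<noteq> 0" "of_int m \<in> P" by (rule ex_int)
  have "\<exists>l\<in>#prime_factorization m. of_int l \<in> P"
  proof (rule ccontr)
    assume neg_ex: "\<not> ?thesis"
    have "of_int (prod_mset A) \<notin> P" if "set_mset A \<subseteq> set_mset (prime_factorization m)" for A
      using that
    proof (induction A)
      case (add l A)
      then show ?case using prime[of "of_int l" "of_int (prod_mset A)"] cl(5) neg_ex by auto
    qed (use proper in simp)
    from this[OF order_refl] have "of_int (prod_mset (prime_factorization m)) \<notin> P" .
    moreover have "prod_mset (prime_factorization m) = m \<or> prod_mset (prime_factorization m) = - m"
      using prod_mset_prime_factorization_weak[OF m(1)] by (auto simp: abs_eq_iff)
    ultimately show False using m(2) neg[of "of_int m"] by auto
  qed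
  then show ?thesis using that by (auto simp: in_prime_factors_iff)
qed

text \<open>With \<open>\<ell> \<in> P\<close> a rational prime and \<open>\<O>\<close> the integers of \<open>K\<close>, let \<open>J\<close> be the contraction of the
  localisation at \<open>P\<close> of \<open>\<ell> \<O>\<close>.  An element \<open>b \<notin> J\<close> with largest annihilator modulo \<open>J\<close> satisfies
  \<open>b P \<subseteq> J\<close>, and a multiple \<open>b'\<close> of it satisfies \<open>b' P \<subseteq> \<ell> \<O>\<close> and \<open>b' \<notin> \<ell> \<O>\<close>, so \<open>x = b' / \<ell>\<close> satisfies
  \<open>x P \<subseteq> \<O>\<close> and \<open>x \<notin> \<O>\<close>.  If \<open>x P \<subseteq> P\<close>, then by finiteness modulo \<open>\<ell>\<close> two powers of \<open>x\<close> differ by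
  an integer of \<open>K\<close>, which makes \<open>x\<close> integral.  Hence \<open>s = x \<pi> \<notin> P\<close> for some \<open>\<pi> \<in> P\<close>, and
  \<open>s y = \<pi> (x y)\<close>.\<close>

lemma uniformizer:
  obtains F \<pi> s where
    "finite F" "F \<subseteq> integers K" "\<And>x. x \<in> integers K \<Longrightarrow> \<exists>r\<in>F. x - r \<in> P"
    "\<pi> \<in> P" "\<pi> \<noteq> 0" "s \<in> integers K" "s \<notin> P"
    "\<And>y. y \<in> P \<Longrightarrow> \<exists>z\<in>integers K. s * y = \<pi> * z"
proof -
  obtain l :: int where l: "normalization_semidom_class.prime l" "of_int l \<in> P" by (rule ex_prime)
  have l0: "(of_int l :: 'a) \<noteq> 0" using l(1) by auto
  define L where "L = (\<lambda>z. of_int l * z) ` integers K"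
  obtain F where F: "finite F" "F \<subseteq> integers K"
    "\<And>x. x \<in> integers K \<Longrightarrow> \<exists>r\<in>F. \<exists>z\<in>integers K. x - r = of_int l * z"
    by (rule finite_integers_mod_prime[OF K l(1)]) (rule that)
  have repL: "\<exists>r\<in>F. x - r \<in> L" if "x \<in> integers K" for x
    using F(3)[OF that] unfolding L_def by blast
  have LP: "L \<subseteq> P" unfolding L_def using mult[OF l(2)] by blast
  have Ladd: "x + y \<in> L" and Ldiff: "x - y \<in> L" if "x \<in> L" "y \<in> L" for x y
    using that unfolding L_def
    by (auto simp: distrib_left[symmetric] right_diff_distrib[symmetric] intro!: imageI cl)
  have Lmult: "x * y \<in> L" if "x \<in> L" "y \<in> integers K" for x y
    using that unfolding L_def by (auto simp: mult.assoc intro!: imageI cl)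
  define J where "J = {b \<in> integers K. \<exists>e. e \<in> integers K \<and> e \<notin> P \<and> e * b \<in> L}"
  have nonP_mult: "x * y \<notin> P" if "x \<in> integers K" "y \<in> integers K" "x \<notin> P" "y \<notin> P" for x y
    using prime that by blast
  have Jmult: "x * y \<in> J" if xy: "x \<in> J" "y \<in> integers K" for x y
  proof -
    obtain e where e: "e \<in> integers K" "e \<notin> P" "e * x \<in> L" "x \<in> integers K" using xy(1) unfolding J_def by blast
    then have "e * (x * y) \<in> L" using Lmult[OF e(3) that(2)] by (simp add: mult.assoc)
    moreover have "x * y \<in> integers K" using e xy cl by simp
    ultimately show ?thesis unfolding J_def using e by blast
  qed
  have Jadd: "x + y \<in> J" if xy: "x \<in> J" "y \<in> J" for x y
  proof -
    obtain e where e: "e \<in> integers K" "e \<notin> P" "e * x \<in> L" "x \<in> integers K" using xy(1) unfolding J_def by blast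
    obtain f where f: "f \<in> integers K" "f \<notin> P" "f * y \<in> L" "y \<in> integers K" using xy(2) unfolding J_def by blast
    have "e * f * (x + y) = e * x * f + f * y * e" by (simp add: algebra_simps)
    then have "e * f * (x + y) \<in> L" using Ladd[OF Lmult[OF e(3) f(1)] Lmult[OF f(3) e(1)]] by simp
    moreover have "x + y \<in> integers K" "e * f \<in> integers K" "e * f \<notin> P"
      using e f cl nonP_mult by simp_all
    ultimately show ?thesis unfolding J_def by blast
  qed
  have LJ: "L \<subseteq> J"
    unfolding J_def using proper cl(7) sub LP by (auto intro!: exI[of _ 1])
  have J1: "1 \<notin> J" unfolding J_def using LP by auto
  have Jrep: "r * b \<in> J \<longleftrightarrow> x * b \<in> J" if "x - r \<in> L" "b \<in> integers K" for x r b
  proof -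
    have d: "(x - r) * b \<in> J" "(r - x) * b \<in> J"
      using Lmult[OF that] Lmult[OF Ldiff[OF _ that(1), of 0] that(2)] LJ cl(6)
      by (auto simp: L_def image_iff intro: bexI[of _ 0])
    have "x * b = r * b + (x - r) * b" "r * b = x * b + (r - x) * b" by (simp_all add: algebra_simps)
    then show ?thesis using Jadd d by metis
  qed
  \<comment> \<open>Annihilators modulo J are recorded through the representatives in F. By
    \<open>Jrep\<close> this loses nothing, and "largest annihilator" becomes a maximum over
    finitely many cardinalities.\<close>
  define Ann where "Ann b = {r \<in> F. r * b \<in> J}" for b
  define C where "C = (\<lambda>b. card (Ann b)) ` (integers K - J)"
  have "finite C"
    by (rule finite_subset[of _ "{..card F}"]) (auto simp: C_def Ann_def F(1) intro!: card_mono)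
  moreover have "C \<noteq> {}" unfolding C_def using J1 cl(7) by auto
  ultimately have "Max C \<in> C" "\<And>c. c \<in> C \<Longrightarrow> c \<le> Max C" by (auto intro: Max_in)
  then obtain b where b: "b \<in> integers K" "b \<notin> J"
    and bmax: "\<And>b'. b' \<in> integers K \<Longrightarrow> b' \<notin> J \<Longrightarrow> card (Ann b') \<le> card (Ann b)"
    unfolding C_def by (smt (verit) DiffD1 DiffD2 DiffI image_iff)
  \<comment> \<open>Two powers of y agree modulo L, so u y^i lies in L with u = 1 - y^(j - i), which
    is 1 modulo P and hence outside P; thus y^i lies in J. If y b were outside J, the last product
    y^(m - 1) b outside J would be annihilated by everything that annihilates b and also by y,
    against the choice of b.\<close>
  have bP: "y * b \<in> J" if y: "y \<in> P" for y
  proof (rule ccontr)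
    assume yb: "y * b \<notin> J"
    have yO: "y \<in> integers K" using y sub by blast
    obtain i j where ij: "i < j" "y ^ j - y ^ i \<in> L"
      by (rule pigeonhole_mod[OF F(1), of "\<lambda>k. y ^ k" L]) (use repL cl yO Ldiff in auto)
    define u where "u = 1 - y ^ (j - i)"
    have uO: "u \<in> integers K" unfolding u_def using yO by (simp add: cl)
    have "y ^ (j - i) = y * y ^ (j - i - 1)"
      using ij(1) power_eq_if[of y "j - i"] by simp
    then have "y ^ (j - i) \<in> P" using mult[OF y] cl(8)[OF yO] by simp
    then have uP: "u \<notin> P" using add[of u "y ^ (j - i)"] proper unfolding u_def by auto
    have "0 - (y ^ j - y ^ i) \<in> L" by (rule Ldiff[OF _ ij(2)]) (use cl(6) in \<open>force simp: L_def\<close>)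
    moreover have "0 - (y ^ j - y ^ i) = u * y ^ i"
      using ij(1) by (simp add: u_def left_diff_distrib flip: power_add)
    ultimately have "y ^ i \<in> J" unfolding J_def using uO uP cl(8)[OF yO] by auto
    then have yi: "y ^ i * b \<in> J" using Jmult b(1) by blast
    define m where "m = (LEAST i. y ^ i * b \<in> J)"
    have m1: "y ^ m * b \<in> J" unfolding m_def using yi by (rule LeastI)
    have m0: "m \<noteq> 0" using m1 b(2) by (intro notI) simp
    define b' where "b' = y ^ (m - 1) * b"
    have b'O: "b' \<in> integers K" unfolding b'_def using yO b by (simp add: cl)
    have b'J: "b' \<notin> J" unfolding b'_def m_def
      by (rule not_less_Least) (use m0 in \<open>simp add: m_def\<close>)
    have "y * b' = y ^ m * b" using m0 unfolding b'_def by (simp flip: power_Suc mult.assoc)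
    then have yb': "y * b' \<in> J" using m1 by simp
    have "Ann b \<subseteq> Ann b'"
    proof
      fix r assume "r \<in> Ann b"
      then have "r \<in> F" "r * b * y ^ (m - 1) \<in> J"
        unfolding Ann_def using Jmult cl(8)[OF yO] by blast+
      then show "r \<in> Ann b'" unfolding Ann_def b'_def by (simp add: mult_ac)
    qed
    moreover have "finite (Ann b')" unfolding Ann_def using F(1) by simp
    ultimately have eq: "Ann b = Ann b'" using bmax[OF b'O b'J] by (metis card_seteq)
    obtain r where r: "r \<in> F" "y - r \<in> L" using repL[OF yO] by blast
    then have "r \<in> Ann b'" unfolding Ann_def using Jrep[OF r(2) b'O] yb' by blast
    then have "r * b \<in> J" using eq unfolding Ann_def by blast
    then show False using Jrep[OF r(2) b(1)] yb by blast
  qed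
  have "\<forall>r\<in>Ann b. \<exists>e. e \<in> integers K \<and> e \<notin> P \<and> e * (r * b) \<in> L" unfolding Ann_def J_def by blast
  then obtain e where e: "\<And>r. r \<in> Ann b \<Longrightarrow> e r \<in> integers K \<and> e r \<notin> P \<and> e r * (r * b) \<in> L" by metis
  have prodO: "prod e A \<in> integers K \<and> prod e A \<notin> P" if "A \<subseteq> Ann b" for A
    using that by (induction A rule: infinite_finite_induct) (use e nonP_mult cl proper in auto)
  have finA: "finite (Ann b)" unfolding Ann_def using F(1) by simp
  \<comment> \<open>Each r in \<open>Ann b\<close> needs its own denominator \<open>e r\<close>
    outside P to bring r b into L. There are finitely many, so their product works for all of them
    at once.\<close>
  define b' where "b' = prod e (Ann b) * b"
  have b'O: "b' \<in> integers K" unfolding b'_def using prodO b by (simp add: cl)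
  have b'L: "b' \<notin> L" using b prodO[of "Ann b"] unfolding b'_def J_def by blast
  have b'P: "y * b' \<in> L" if y: "y \<in> P" for y
  proof -
    obtain r where r: "r \<in> F" "y - r \<in> L" using repL y sub by blast
    then have rA: "r \<in> Ann b" unfolding Ann_def using Jrep[OF r(2) b(1)] bP[OF y] by blast
    have "prod e (Ann b) = e r * prod e (Ann b - {r})" using rA finA by (simp add: prod.remove)
    then have "r * b' = e r * (r * b) * prod e (Ann b - {r})" unfolding b'_def by (simp add: mult_ac)
    moreover have "e r * (r * b) * prod e (Ann b - {r}) \<in> L"
      using e[OF rA] Lmult prodO[of "Ann b - {r}"] by blast
    ultimately have "r * b' \<in> L" by (simp only:)
    moreover have "(y - r) * b' \<in> L" using Lmult[OF r(2) b'O] .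
    ultimately have "r * b' + (y - r) * b' \<in> L" by (rule Ladd)
    then show ?thesis by (simp add: algebra_simps)
  qed
  define x where "x = b' * inverse (of_int l)"
  have lx: "of_int l * x = b'" unfolding x_def using l0 by simp
  have xK: "x \<in> K" unfolding x_def
    using b'O number_field_closed[OF K] number_field_of_int[OF K] by (auto simp: integers_def)
  have xO: "x \<notin> integers K"
  proof
    assume "x \<in> integers K"
    then show False using b'L lx unfolding L_def by blast
  qed
  have xP: "x * y \<in> integers K" if yP: "y \<in> P" for y
  proof -
    obtain z where z: "z \<in> integers K" "y * b' = of_int l * z" using b'P[OF yP] unfolding L_def by blast
    have "of_int l * (x * y) = b' * y" using lx by (simp flip: mult.assoc)
    then have "of_int l * (x * y) = of_int l * z" using z(2) by (metis mult.commute)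
    then show ?thesis using l0 z(1) by simp
  qed
  have "\<exists>\<pi>\<in>P. x * \<pi> \<notin> P"
  proof (rule ccontr)
    assume "\<not> ?thesis"
    then have xstable: "x * y \<in> P" if "y \<in> P" for y using that by blast
    have pw: "x ^ k * of_int l \<in> P" for k
      by (induction k) (use l xstable in \<open>auto simp: mult.assoc\<close>)
    obtain i j where ij: "i < j" "x ^ j * of_int l - x ^ i * of_int l \<in> L"
      by (rule pigeonhole_mod[OF F(1), of "\<lambda>k. x ^ k * of_int l" L])
        (use repL[OF subsetD[OF sub pw]] Ldiff in auto)
    then obtain c where c: "c \<in> integers K" "x ^ j * of_int l - x ^ i * of_int l = of_int l * c"
      unfolding L_def by blast
    then have "of_int l * (x ^ j - x ^ i) = of_int l * c" by (simp add: algebra_simps)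
    then have xc: "x ^ j - x ^ i = c" using l0 by simp
    \<comment> \<open>x is a root of X^j - X^i - c, a monic polynomial whose constant term is an
      integer of K; such a root is again integral.\<close>
    define p :: "'a poly" where "p = Polynomial.monom 1 j - Polynomial.monom 1 i"
    have deg: "Polynomial.degree p = j" unfolding p_def
      using ij(1)
      by (simp add: diff_conv_add_uminus degree_add_eq_left degree_monom_eq del: add_uminus_conv_diff)
    have "algebraic_int x"
    proof (rule algebraic_int_root)
      show "algebraic_int c" using c by (simp add: integers_def)
      show "poly p x = c" using xc by (simp add: p_def poly_monom)
      show "\<forall>i. poly.coeff p i \<in> \<int>" by (auto simp: p_def)
      show "poly.coeff p (Polynomial.degree p) = 1" unfolding deg using ij(1) by (simp add: p_def)
      show "0 < Polynomial.degree p" using deg ij(1) by simp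
    qed
    then show False using xO xK by (simp add: integers_def)
  qed
  then obtain \<pi> where \<pi>: "\<pi> \<in> P" "x * \<pi> \<notin> P" by blast
  have "\<exists>z\<in>integers K. (x * \<pi>) * y = \<pi> * z" if "y \<in> P" for y
    using xP[OF that] by (intro bexI[of _ "x * y"]) (simp_all add: mult_ac)
  moreover have "\<pi> \<noteq> 0" using \<pi> zero by auto
  moreover have "\<exists>r\<in>F. x - r \<in> P" if "x \<in> integers K" for x using repL[OF that] LP by blast
  ultimately show ?thesis using that[OF F(1,2) _ \<pi>(1) _ xP[OF \<pi>(1)] \<pi>(2)] by blast
qed

text \<open>Two powers of y agree modulo P, and y^i can be cancelled because it is outside P. What
  remains exhibits y^(j - i - 1) as an inverse.\<close>

lemma inverse_mod:
  assumes "y \<in> integers K" "y \<notin> P"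
  obtains t where "t \<in> integers K" "y * t - 1 \<in> P"
proof -
  obtain F \<pi> s where F: "finite F" "\<And>x. x \<in> integers K \<Longrightarrow> \<exists>r\<in>F. x - r \<in> P"
    by (rule uniformizer) blast
  obtain i j where ij: "i < j" "y ^ j - y ^ i \<in> P"
    by (rule pigeonhole_mod[OF F(1), of "\<lambda>k. y ^ k" P]) (use F(2) cl assms diff in auto)
  have "y ^ j - y ^ i = y ^ i * (y * y ^ (j - i - 1) - 1)"
  proof -
    obtain d where "j = i + Suc d" using less_imp_Suc_add[OF ij(1)] by auto
    then show ?thesis by (simp add: monoid_mult_class.power_add right_diff_distrib)
  qed
  then have "y ^ i * (y * y ^ (j - i - 1) - 1) \<in> P" using ij(2) by simp
  moreover have "y ^ i \<notin> P" using power_mem assms by blast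
  moreover have "y ^ i \<in> integers K" "y * y ^ (j - i - 1) - 1 \<in> integers K" using assms by (simp_all add: cl)
  ultimately have "y * y ^ (j - i - 1) - 1 \<in> P" using prime by blast
  then show ?thesis using that[of "y ^ (j - i - 1)"] cl(8)[OF assms(1)] by blast
qed

end

section \<open>Powers of an ideal, and division by the uniformizer\<close>

lemma ideal_pow_0: "ideal_pow R I 0 = carrier R"
  by (simp add: ideal_pow_def ideals_set_def nat_pow_def)

lemma ideal_pow_Suc: "ideal_pow R I (Suc N) = ideal_prod R (ideal_pow R I N) I"
  by (simp add: ideal_pow_def ideals_set_def nat_pow_def)

lemma (in ring) ideal_ideal_pow: "ideal I R \<Longrightarrow> ideal (ideal_pow R I N) R"
  by (induction N) (simp_all add: ideal_pow_0 ideal_pow_Suc ideal_prod_is_ideal oneideal)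

lemma (in ring) ideal_pow_Suc_subset: "ideal I R \<Longrightarrow> ideal_pow R I (Suc N) \<subseteq> ideal_pow R I N"
  using ideal_prod_inter[of "ideal_pow R I N" I] ideal_ideal_pow[of I N] by (auto simp: ideal_pow_Suc)

lemma (in ring) ideal_pow_antimono:
  assumes "ideal I R" "M \<le> N" shows "ideal_pow R I N \<subseteq> ideal_pow R I M"
  using assms(2) by (induction rule: dec_induct) (use ideal_pow_Suc_subset[OF assms(1)] in auto)

lemma (in cring) ideal_pow_1: "ideal I R \<Longrightarrow> ideal_pow R I 1 = I"
proof -
  assume I: "ideal I R"
  have "i = \<one> \<otimes> i" if "i \<in> I" for i using ideal.Icarr[OF I that] by simp
  then have "I \<subseteq> carrier R \<cdot> I" using ideal_prod.prod[OF one_closed, of _ I R] by force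
  then show ?thesis
    using ideal_prod_inter[OF oneideal I] by (auto simp: ideal_pow_0 ideal_pow_Suc)
qed

lemma ideal_pow_mult: "x \<in> ideal_pow R I N \<Longrightarrow> y \<in> I \<Longrightarrow> x \<otimes>\<^bsub>R\<^esub> y \<in> ideal_pow R I (Suc N)"
  by (simp add: ideal_pow_Suc ideal_prod.prod)

lemma (in cring) nat_pow_mem_ideal_pow: "x \<in> I \<Longrightarrow> x [^] N \<in> ideal_pow R I N"
  by (induction N) (simp_all add: ideal_pow_0 ideal_pow_mult)

lemma (in ideal) minus_mem: "x \<in> I \<Longrightarrow> y \<in> I \<Longrightarrow> x \<ominus> y \<in> I"
  unfolding a_minus_def by simp

text \<open>A prime ideal \<open>P\<close> of a domain whose localisation is principal: \<open>s\<close> is invertible at \<open>P\<close>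
  and \<open>s P \<subseteq> \<pi> R\<close>.\<close>

locale locally_principal = domain R + P: ideal P R for R (structure) and P +
  fixes F \<pi> s
  assumes F: "finite F" "F \<subseteq> carrier R" "x \<in> carrier R \<Longrightarrow> \<exists>r\<in>F. x \<ominus> r \<in> P"
    and proper: "\<one> \<notin> P"
    and prime: "x \<in> carrier R \<Longrightarrow> y \<in> carrier R \<Longrightarrow> x \<otimes> y \<in> P \<Longrightarrow> x \<in> P \<or> y \<in> P"
    and inv_mod: "y \<in> carrier R \<Longrightarrow> y \<notin> P \<Longrightarrow> \<exists>t\<in>carrier R. y \<otimes> t \<ominus> \<one> \<in> P"
    and pi: "\<pi> \<in> P" "\<pi> \<noteq> \<zero>"
    and s: "s \<in> carrier R" "s \<notin> P"
    and s_P: "y \<in> P \<Longrightarrow> \<exists>z\<in>carrier R. s \<otimes> y = \<pi> \<otimes> z"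
begin

abbreviation Pw where "Pw N \<equiv> ideal_pow R P N"

lemma Pw_ideal: "ideal (Pw N) R" by (rule ideal_ideal_pow[OF P.ideal_axioms])

lemmas Pw_carr = ideal.Icarr[OF Pw_ideal]
lemmas Pw_add = additive_subgroup.a_closed[OF ideal.axioms(1)[OF Pw_ideal]]
lemmas Pw_minus = ideal.minus_mem[OF Pw_ideal]
lemmas Pw_l = ideal.I_l_closed[OF Pw_ideal]
lemmas Pw_r = ideal.I_r_closed[OF Pw_ideal]
lemmas Pw_zero = additive_subgroup.zero_closed[OF ideal.axioms(1)[OF Pw_ideal]]
lemmas Pw_mono = ideal_pow_antimono[OF P.ideal_axioms, THEN subsetD]
lemmas Pw_1 = ideal_pow_1[OF P.ideal_axioms]

lemma pi_carr: "\<pi> \<in> carrier R" using pi(1) by (rule P.Icarr)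

lemma pi_pow_mem: "\<pi> [^] N \<in> Pw N" by (rule nat_pow_mem_ideal_pow[OF pi(1)])

lemma pi_pow_nonzero: "\<pi> [^] (N::nat) \<noteq> \<zero>"
  by (induction N) (simp_all add: pi pi_carr integral_iff)

lemma s_pow_notin: "s [^] (N::nat) \<notin> P"
proof (induction N)
  case (Suc N)
  then show ?case using prime[of "s [^] N" s] s by auto
qed (use proper in simp)

text \<open>If t inverts y modulo P^N and t0 inverts it modulo P, then (1 - y t)(1 - y t0) lies in
  P^(N+1) and has the form 1 - y t' with t' = t + t0 - t y t0.\<close>

lemma inv_mod_Pw:
  assumes y: "y \<in> carrier R" "y \<notin> P"
  shows "\<exists>t\<in>carrier R. y \<otimes> t \<ominus> \<one> \<in> Pw N"
proof (induction N)
  case 0 then show ?case using y by (auto simp: ideal_pow_0)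
next
  case (Suc N)
  then obtain t where t: "t \<in> carrier R" "y \<otimes> t \<ominus> \<one> \<in> Pw N" by blast
  obtain t0 where t0: "t0 \<in> carrier R" "y \<otimes> t0 \<ominus> \<one> \<in> P" using inv_mod[OF y] by blast
  have "(y \<otimes> t \<ominus> \<one>) \<otimes> (y \<otimes> t0 \<ominus> \<one>) \<in> Pw (Suc N)"
    using t(2) t0(2) by (rule ideal_pow_mult)
  then have "\<zero> \<ominus> ((y \<otimes> t \<ominus> \<one>) \<otimes> (y \<otimes> t0 \<ominus> \<one>)) \<in> Pw (Suc N)"
    by (rule Pw_minus[OF Pw_zero])
  moreover have "\<zero> \<ominus> ((y \<otimes> t \<ominus> \<one>) \<otimes> (y \<otimes> t0 \<ominus> \<one>)) = y \<otimes> (t \<oplus> t0 \<ominus> t \<otimes> y \<otimes> t0) \<ominus> \<one>"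
    by (use y t(1) t0(1) in algebra)
  ultimately show ?case using y t t0 by (intro bexI[of _ "t \<oplus> t0 \<ominus> t \<otimes> y \<otimes> t0"]) auto
qed

text \<open>The N-th power of s P \<subseteq> \<pi> R, checked on the products that generate the
  ideal and on their sums.\<close>

lemma Pw_divide:
  "y \<in> Pw N \<Longrightarrow> \<exists>z\<in>carrier R. s [^] N \<otimes> y = \<pi> [^] N \<otimes> z"
proof (induction N arbitrary: y)
  case 0 then show ?case by (auto simp: ideal_pow_0)
next
  case (Suc N)
  note pi_carr [simp] s(1) [simp]
  from Suc.prems show ?case unfolding ideal_pow_Suc
  proof (induction y rule: ideal_prod.induct)
    case (prod i j)
    obtain z where z: "z \<in> carrier R" "s [^] N \<otimes> i = \<pi> [^] N \<otimes> z" using Suc.IH prod by blast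
    obtain w where w: "w \<in> carrier R" "s \<otimes> j = \<pi> \<otimes> w" using s_P prod by blast
    have ij: "i \<in> carrier R" "j \<in> carrier R" using prod Pw_carr P.Icarr by auto
    have "s [^] Suc N \<otimes> (i \<otimes> j) = (s [^] N \<otimes> i) \<otimes> (s \<otimes> j)" using ij by (simp add: m_ac)
    also have "\<dots> = \<pi> [^] Suc N \<otimes> (z \<otimes> w)" unfolding z w using z w by (simp add: m_ac)
    finally show ?case using z w by blast
  next
    case (sum a b)
    then obtain z w where zw: "z \<in> carrier R" "s [^] Suc N \<otimes> a = \<pi> [^] Suc N \<otimes> z"
      "w \<in> carrier R" "s [^] Suc N \<otimes> b = \<pi> [^] Suc N \<otimes> w" by blast
    have ab: "a \<in> carrier R" "b \<in> carrier R"
      using sum ideal_prod_in_carrier[OF Pw_ideal P.ideal_axioms] by auto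
    have "s [^] Suc N \<otimes> (a \<oplus> b) = \<pi> [^] Suc N \<otimes> (z \<oplus> w)"
      using ab zw by (simp add: r_distr del: nat_pow_Suc)
    then show ?case using zw by blast
  qed
qed

text \<open>The factor s^N in \<open>Pw_divide\<close> is invertible only modulo powers of P.
  Division by \<pi>^N is therefore exact only up to an error, but the error can be pushed into any
  P^L.\<close>

lemma Pw_decomp:
  assumes "y \<in> Pw N"
  shows "\<exists>z\<in>carrier R. y \<ominus> \<pi> [^] N \<otimes> z \<in> Pw L"
proof -
  obtain z where z: "z \<in> carrier R" "s [^] N \<otimes> y = \<pi> [^] N \<otimes> z" using Pw_divide[OF assms] by blast
  define S where "S = s [^] N"
  define Q where "Q = \<pi> [^] N"
  have S: "S \<in> carrier R" "S \<notin> P" and Q: "Q \<in> carrier R"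
    using s s_pow_notin pi_carr by (auto simp: S_def Q_def)
  obtain t where t: "t \<in> carrier R" "S \<otimes> t \<ominus> \<one> \<in> Pw L" using inv_mod_Pw[OF S] by blast
  have y: "y \<in> carrier R" using assms by (rule Pw_carr)
  have zS: "S \<otimes> y = Q \<otimes> z" using z by (simp add: S_def Q_def)
  have "y \<ominus> Q \<otimes> (z \<otimes> t) = y \<ominus> (Q \<otimes> z) \<otimes> t" 
    by (use y z(1) t(1) Q in algebra)
  also have "\<dots> = \<zero> \<ominus> (S \<otimes> t \<ominus> \<one>) \<otimes> y" unfolding zS[symmetric] 
    by (use y S(1) t(1) in algebra)
  also have "\<dots> \<in> Pw L" using Pw_minus[OF Pw_zero Pw_r[OF t(2) y]] .
  finally show ?thesis using z t unfolding Q_def by blast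
qed

text \<open>Says that \<pi> has valuation exactly one. After multiplication by a power S of s the
  element is an honest multiple of \<pi>^(N + L), so \<pi>^N cancels in the domain; S is then
  removed by inverting it modulo P^L.\<close>

lemma Pw_cancel:
  assumes z: "z \<in> carrier R" "\<pi> [^] N \<otimes> z \<in> Pw (N + L)"
  shows "z \<in> Pw L"
proof -
  obtain w where w: "w \<in> carrier R" "s [^] (N + L) \<otimes> (\<pi> [^] N \<otimes> z) = \<pi> [^] (N + L) \<otimes> w"
    using Pw_divide[OF z(2)] by blast
  define S where "S = s [^] (N + L)"
  define Q where "Q = \<pi> [^] N"
  define T where "T = \<pi> [^] L"
  have S: "S \<in> carrier R" "S \<notin> P" and Q: "Q \<in> carrier R" "Q \<noteq> \<zero>" and T: "T \<in> carrier R" "T \<in> Pw L"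
    using s s_pow_notin pi_carr pi_pow_nonzero pi_pow_mem by (auto simp: S_def Q_def T_def)
  have "S \<otimes> (Q \<otimes> z) = (Q \<otimes> T) \<otimes> w"
    using w pi_carr by (simp add: S_def Q_def T_def nat_pow_mult)
  then have "Q \<otimes> (S \<otimes> z) = Q \<otimes> (T \<otimes> w)" using S Q T z w by (simp add: m_ac)
  then have Sz: "S \<otimes> z = T \<otimes> w" using S Q T z w by (simp add: m_lcancel)
  obtain t where t: "t \<in> carrier R" "S \<otimes> t \<ominus> \<one> \<in> Pw L" using inv_mod_Pw[OF S] by blast
  have zc: "z \<in> carrier R" using z by blast
  have "S \<otimes> z \<in> Pw L" unfolding Sz using T(2) w(1) by (rule Pw_r)
  then have "t \<otimes> (S \<otimes> z) \<ominus> (S \<otimes> t \<ominus> \<one>) \<otimes> z \<in> Pw L"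
    using Pw_minus[OF Pw_l[OF _ t(1)] Pw_r[OF t(2) zc]] by blast
  moreover have "t \<otimes> (S \<otimes> z) \<ominus> (S \<otimes> t \<ominus> \<one>) \<otimes> z = z" 
    by (use S(1) t(1) zc in algebra)
  ultimately show ?thesis by simp
qed

lemma pi_pow_mult_mem: "z \<in> Pw L \<Longrightarrow> \<pi> [^] N \<otimes> z \<in> Pw (N + L)"
proof (induction N)
  case 0 then show ?case using Pw_carr by auto
next
  case (Suc N)
  then have "z \<in> carrier R" using Pw_carr by blast
  then have "\<pi> [^] Suc N \<otimes> z = (\<pi> [^] N \<otimes> z) \<otimes> \<pi>" using pi_carr by (simp add: m_ac)
  then show ?case using ideal_pow_mult[OF Suc.IH[OF Suc.prems] pi(1)] by simp
qed

end

section \<open>The completion at a prime\<close>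

lemma (in ring) quot_simps:
  assumes "ideal I R"
  shows "\<And>x. x \<in> carrier R \<Longrightarrow> I +> x \<in> carrier (R Quot I)"
    "\<And>c. c \<in> carrier (R Quot I) \<Longrightarrow> \<exists>x\<in>carrier R. c = I +> x"
    "\<And>x y. x \<in> carrier R \<Longrightarrow> y \<in> carrier R \<Longrightarrow> (I +> x) \<otimes>\<^bsub>R Quot I\<^esub> (I +> y) = I +> x \<otimes> y"
    "\<And>x y. x \<in> carrier R \<Longrightarrow> y \<in> carrier R \<Longrightarrow> (I +> x) \<oplus>\<^bsub>R Quot I\<^esub> (I +> y) = I +> x \<oplus> y"
    "\<one>\<^bsub>R Quot I\<^esub> = I +> \<one>" "\<zero>\<^bsub>R Quot I\<^esub> = I +> \<zero>"
proof -
  interpret I: ideal I R by fact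
  show "\<And>x. x \<in> carrier R \<Longrightarrow> I +> x \<in> carrier (R Quot I)"
    "\<And>c. c \<in> carrier (R Quot I) \<Longrightarrow> \<exists>x\<in>carrier R. c = I +> x"
    by (auto simp: FactRing_def A_RCOSETS_def')
  show "\<And>x y. x \<in> carrier R \<Longrightarrow> y \<in> carrier R \<Longrightarrow> (I +> x) \<otimes>\<^bsub>R Quot I\<^esub> (I +> y) = I +> x \<otimes> y"
    by (simp add: FactRing_def I.rcoset_mult_add)
  show "\<And>x y. x \<in> carrier R \<Longrightarrow> y \<in> carrier R \<Longrightarrow> (I +> x) \<oplus>\<^bsub>R Quot I\<^esub> (I +> y) = I +> x \<oplus> y"
    by (simp add: FactRing_def I.a_rcos_sum)
  show "\<one>\<^bsub>R Quot I\<^esub> = I +> \<one>" "\<zero>\<^bsub>R Quot I\<^esub> = I +> \<zero>"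
    by (simp_all add: FactRing_def I.a_subset)
qed

text \<open>Evaluates the transition maps of the inverse system on cosets.\<close>

lemma (in ring) coset_plus_larger_ideal:
  assumes "ideal I R" "ideal J R" "I \<subseteq> J" "x \<in> carrier R"
  shows "(I +> x) <+> J = J +> x"
proof -
  interpret I: ideal I R by fact
  interpret J: ideal J R by fact
  show ?thesis
  proof (intro equalityI subsetI)
    fix y assume "y \<in> (I +> x) <+>\<^bsub>R\<^esub> J"
    then obtain i j where y: "i \<in> I" "j \<in> J" "y = (i \<oplus> x) \<oplus> j"
      by (auto simp: set_add_def' a_r_coset_def')
    then have "y = (i \<oplus> j) \<oplus> x" using assms(4) I.a_Hcarr J.a_Hcarr by (simp add: a_ac)
    then show "y \<in> J +> x" using y assms(3) by (auto simp: a_r_coset_def')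
  next
    fix y assume "y \<in> J +> x"
    then obtain j where y: "j \<in> J" "y = j \<oplus> x" by (auto simp: a_r_coset_def')
    then have "y = (\<zero> \<oplus> x) \<oplus> j" using assms(4) J.a_Hcarr by (simp add: a_ac)
    then show "y \<in> (I +> x) <+>\<^bsub>R\<^esub> J" 
      using y I.zero_closed unfolding set_add_def' a_r_coset_def' by blast
  qed
qed

context locally_principal
begin

text \<open>Sequences of representatives for elements of the inverse limit. Arithmetic in the
  completion then is termwise arithmetic in R, and the ring axioms are inherited.\<close>

definition coh :: "(nat \<Rightarrow> 'a) \<Rightarrow> bool" where
  "coh r \<longleftrightarrow> (\<forall>N. r N \<in> carrier R \<and> r (Suc N) \<ominus> r N \<in> Pw N)"

definition lim :: "(nat \<Rightarrow> 'a) \<Rightarrow> nat \<Rightarrow> 'a set" where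
  "lim r N = Pw N +> r N"

abbreviation C where "C \<equiv> completion R P"

lemma coset_eq: "x \<in> carrier R \<Longrightarrow> y \<in> carrier R \<Longrightarrow> Pw N +> x = Pw N +> y \<longleftrightarrow> x \<ominus> y \<in> Pw N"
  using quotient_eq_iff_same_a_r_cos[OF Pw_ideal] by simp

lemma coh_carr: "coh r \<Longrightarrow> r N \<in> carrier R"
  by (simp add: coh_def)

lemma coh_diff: assumes "coh r" "i \<le> j" shows "r j \<ominus> r i \<in> Pw i"
  using assms(2)
proof (induction rule: dec_induct)
  case base then show ?case using coh_carr[OF assms(1)] Pw_zero by (simp add: a_minus_def r_neg)
next
  case (step k)
  have "r (Suc k) \<ominus> r k \<in> Pw i"
    using assms(1) Pw_mono[OF step(1)] unfolding coh_def by blast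
  from Pw_add[OF this step.IH] have *: "(r (Suc k) \<ominus> r k) \<oplus> (r k \<ominus> r i) \<in> Pw i" .
  have "a \<oplus> b \<in> Pw i" if "a \<in> Pw i" "b \<in> Pw i" for a b using Pw_add that .
  have "(x \<ominus> y) \<oplus> (y \<ominus> z) = x \<ominus> z" if "x \<in> carrier R" "y \<in> carrier R" "z \<in> carrier R" for x y z
    by (use that in algebra)
  then show ?case using * coh_carr[OF assms(1)] by simp
qed

lemma carrier_completion: "carrier C = lim ` Collect coh"
proof (intro equalityI subsetI)
  fix f assume "f \<in> carrier C"
  then have f: "f N \<in> carrier (R Quot Pw N)" "f (Suc N) <+>\<^bsub>R\<^esub> Pw N = f N" for N
    by (auto simp: completion_def)
  then have "\<forall>N. \<exists>x\<in>carrier R. f N = Pw N +> x" using quot_simps(2)[OF Pw_ideal] by blast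
  then obtain r where r: "\<And>N. r N \<in> carrier R" "\<And>N. f N = Pw N +> r N" by metis
  have "r (Suc N) \<ominus> r N \<in> Pw N" for N
  proof -
    have "Pw N +> r (Suc N) = (Pw (Suc N) +> r (Suc N)) <+>\<^bsub>R\<^esub> Pw N"
      using coset_plus_larger_ideal[OF Pw_ideal Pw_ideal ideal_pow_Suc_subset[OF P.ideal_axioms] r(1)] ..
    also have "\<dots> = Pw N +> r N" using f(2)[of N] r(2) by simp
    finally show ?thesis using coset_eq r(1) by blast
  qed
  then have "coh r" using r(1) by (simp add: coh_def)
  moreover have "f = lim r" using r(2) by (auto simp: lim_def)
  ultimately show "f \<in> lim ` Collect coh" by blast
next
  fix f assume "f \<in> lim ` Collect coh"
  then obtain r where r: "coh r" "f = lim r" by blast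
  have "f (Suc N) <+>\<^bsub>R\<^esub> Pw N = f N" for N
  proof -
    have "(Pw (Suc N) +> r (Suc N)) <+>\<^bsub>R\<^esub> Pw N = Pw N +> r (Suc N)"
      using coset_plus_larger_ideal[OF Pw_ideal Pw_ideal ideal_pow_Suc_subset[OF P.ideal_axioms] coh_carr[OF r(1)]] .
    also have "\<dots> = Pw N +> r N" using coset_eq r(1) unfolding coh_def by blast
    finally show ?thesis unfolding r(2) lim_def .
  qed
  moreover have "f N \<in> carrier (R Quot Pw N)" for N
    unfolding r(2) lim_def using quot_simps(1)[OF Pw_ideal coh_carr[OF r(1)]] .
  ultimately show "f \<in> carrier C" by (simp add: completion_def)
qed

lemma lim_carrier: "coh r \<Longrightarrow> lim r \<in> carrier C"
  by (simp add: carrier_completion)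

lemma lim_obtain: assumes "f \<in> carrier C" obtains r where "coh r" "f = lim r"
  using assms by (auto simp: carrier_completion)

lemma lim_mult: "coh r \<Longrightarrow> coh t \<Longrightarrow> lim r \<otimes>\<^bsub>C\<^esub> lim t = lim (\<lambda>N. r N \<otimes> t N)"
  using quot_simps(3)[OF Pw_ideal coh_carr coh_carr] by (simp add: completion_def lim_def fun_eq_iff)

lemma lim_add: "coh r \<Longrightarrow> coh t \<Longrightarrow> lim r \<oplus>\<^bsub>C\<^esub> lim t = lim (\<lambda>N. r N \<oplus> t N)"
  using quot_simps(4)[OF Pw_ideal coh_carr coh_carr] by (simp add: completion_def lim_def fun_eq_iff)

lemma lim_one: "\<one>\<^bsub>C\<^esub> = lim (\<lambda>_. \<one>)" and lim_zero: "\<zero>\<^bsub>C\<^esub> = lim (\<lambda>_. \<zero>)"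
  using quot_simps(5,6)[OF Pw_ideal] by (simp_all add: completion_def lim_def fun_eq_iff)

lemma coh_const: "x \<in> carrier R \<Longrightarrow> coh (\<lambda>_. x)"
  using Pw_zero by (simp add: coh_def a_minus_def r_neg)

lemma coh_add: assumes "coh r" "coh t" shows "coh (\<lambda>N. r N \<oplus> t N)"
proof -
  have id: "(x \<oplus> y) \<ominus> (u \<oplus> v) = (x \<ominus> u) \<oplus> (y \<ominus> v)"
    if "x \<in> carrier R" "y \<in> carrier R" "u \<in> carrier R" "v \<in> carrier R" for x y u v
    by (use that in algebra)
  have "(r (Suc N) \<oplus> t (Suc N)) \<ominus> (r N \<oplus> t N) \<in> Pw N" for N
    unfolding id[OF coh_carr[OF assms(1)] coh_carr[OF assms(2)] coh_carr[OF assms(1)] coh_carr[OF assms(2)]]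
    using assms by (intro Pw_add) (simp_all add: coh_def)
  then show ?thesis using coh_carr assms by (simp add: coh_def)
qed

lemma coh_mult: assumes "coh r" "coh t" shows "coh (\<lambda>N. r N \<otimes> t N)"
proof -
  have id: "(x \<otimes> y) \<ominus> (u \<otimes> v) = (x \<ominus> u) \<otimes> y \<oplus> u \<otimes> (y \<ominus> v)"
    if "x \<in> carrier R" "y \<in> carrier R" "u \<in> carrier R" "v \<in> carrier R" for x y u v
    by (use that in algebra)
  have "(r (Suc N) \<otimes> t (Suc N)) \<ominus> (r N \<otimes> t N) \<in> Pw N" for N
    unfolding id[OF coh_carr[OF assms(1)] coh_carr[OF assms(2)] coh_carr[OF assms(1)] coh_carr[OF assms(2)]]
    using assms by (intro Pw_add[OF Pw_r Pw_l]) (simp_all add: coh_def)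
  then show ?thesis using coh_carr assms by (simp add: coh_def)
qed

lemma coh_neg: assumes "coh r" shows "coh (\<lambda>N. \<ominus> r N)"
proof -
  have id: "\<ominus> x \<ominus> \<ominus> y = \<ominus> (x \<ominus> y)"
    if "x \<in> carrier R" "y \<in> carrier R" for x y
    by (use that in algebra)
  have "\<ominus> x \<in> Pw N" if "x \<in> Pw N" for x N
    using additive_subgroup.a_inv_closed[OF ideal.axioms(1)[OF Pw_ideal] that] .
  then show ?thesis using assms by (simp add: coh_def id)
qed

lemma lim_eq: "coh r \<Longrightarrow> coh t \<Longrightarrow> lim r = lim t \<longleftrightarrow> (\<forall>N. r N \<ominus> t N \<in> Pw N)"
  using coset_eq[OF coh_carr coh_carr] by (simp add: lim_def fun_eq_iff)

lemma cring_completion: "cring C"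
proof (rule cringI)
  show "abelian_group C"
  proof (rule abelian_groupI)
    fix x y assume "x \<in> carrier C" "y \<in> carrier C"
    then show "x \<oplus>\<^bsub>C\<^esub> y \<in> carrier C"
      by (auto simp: lim_add coh_add elim!: lim_obtain intro!: lim_carrier)
  next
    show "\<zero>\<^bsub>C\<^esub> \<in> carrier C" by (simp add: lim_zero lim_carrier coh_const)
  next
    fix x y z assume "x \<in> carrier C" "y \<in> carrier C" "z \<in> carrier C"
    then show "x \<oplus>\<^bsub>C\<^esub> y \<oplus>\<^bsub>C\<^esub> z = x \<oplus>\<^bsub>C\<^esub> (y \<oplus>\<^bsub>C\<^esub> z)"
      by (auto simp: lim_add coh_add a_assoc coh_carr elim!: lim_obtain)
  next
    fix x y assume "x \<in> carrier C" "y \<in> carrier C"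
    then show "x \<oplus>\<^bsub>C\<^esub> y = y \<oplus>\<^bsub>C\<^esub> x"
      by (auto simp: lim_add coh_add a_comm coh_carr elim!: lim_obtain)
  next
    fix x assume "x \<in> carrier C"
    then show "\<zero>\<^bsub>C\<^esub> \<oplus>\<^bsub>C\<^esub> x = x"
      by (auto simp: lim_add lim_zero coh_const coh_carr elim!: lim_obtain)
  next
    fix x assume "x \<in> carrier C"
    then obtain r where r: "coh r" "x = lim r" by (rule lim_obtain)
    have "lim (\<lambda>N. \<ominus> r N) \<oplus>\<^bsub>C\<^esub> x = \<zero>\<^bsub>C\<^esub>"
      unfolding r(2) by (simp add: lim_add coh_neg r lim_zero coh_carr l_neg)
    then show "\<exists>y\<in>carrier C. y \<oplus>\<^bsub>C\<^esub> x = \<zero>\<^bsub>C\<^esub>" using lim_carrier[OF coh_neg[OF r(1)]] by blast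
  qed
  show "comm_monoid C"
  proof (rule comm_monoidI)
    fix x y assume "x \<in> carrier C" "y \<in> carrier C"
    then show "x \<otimes>\<^bsub>C\<^esub> y \<in> carrier C"
      by (auto simp: lim_mult coh_mult elim!: lim_obtain intro!: lim_carrier)
  next
    show "\<one>\<^bsub>C\<^esub> \<in> carrier C" by (simp add: lim_one lim_carrier coh_const)
  next
    fix x y z assume "x \<in> carrier C" "y \<in> carrier C" "z \<in> carrier C"
    then show "x \<otimes>\<^bsub>C\<^esub> y \<otimes>\<^bsub>C\<^esub> z = x \<otimes>\<^bsub>C\<^esub> (y \<otimes>\<^bsub>C\<^esub> z)"
      by (auto simp: lim_mult coh_mult m_assoc coh_carr elim!: lim_obtain)
  next
    fix x y assume "x \<in> carrier C" "y \<in> carrier C"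
    then show "x \<otimes>\<^bsub>C\<^esub> y = y \<otimes>\<^bsub>C\<^esub> x"
      by (auto simp: lim_mult coh_mult m_comm coh_carr elim!: lim_obtain)
  next
    fix x assume "x \<in> carrier C"
    then show "\<one>\<^bsub>C\<^esub> \<otimes>\<^bsub>C\<^esub> x = x"
      by (auto simp: lim_mult lim_one coh_const coh_carr elim!: lim_obtain)
  qed
  fix x y z assume "x \<in> carrier C" "y \<in> carrier C" "z \<in> carrier C"
  then show "(x \<oplus>\<^bsub>C\<^esub> y) \<otimes>\<^bsub>C\<^esub> z = x \<otimes>\<^bsub>C\<^esub> z \<oplus>\<^bsub>C\<^esub> y \<otimes>\<^bsub>C\<^esub> z"
    by (auto simp: lim_mult lim_add coh_mult coh_add l_distr coh_carr elim!: lim_obtain)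
qed

text \<open>The kernel of the projection from the completion to R / P^N;
  \<open>max_ideal_pow\<close> identifies it with the N-th power of the maximal ideal.\<close>

definition fil :: "nat \<Rightarrow> (nat \<Rightarrow> 'a set) set" where
  "fil N = lim ` {r. coh r \<and> r N \<in> Pw N}"

lemma mem_fil:
  assumes "coh r" shows "lim r \<in> fil N \<longleftrightarrow> r N \<in> Pw N"
proof
  assume "lim r \<in> fil N"
  then obtain t where t: "coh t" "t N \<in> Pw N" "lim r = lim t" by (auto simp: fil_def)
  then have "r N \<ominus> t N \<in> Pw N" using lim_eq assms by blast
  from Pw_add[OF this t(2)] have *: "(r N \<ominus> t N) \<oplus> t N \<in> Pw N" .
  have "(x \<ominus> y) \<oplus> y = x" if "x \<in> carrier R" "y \<in> carrier R" for x y
    using that by (simp add: a_minus_def a_assoc l_neg)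
  then show "r N \<in> Pw N" using * coh_carr assms t(1) by simp
qed (use assms in \<open>auto simp: fil_def\<close>)

lemma ideal_fil: "ideal (fil N) C"
proof -
  interpret C: cring C by (rule cring_completion)
  have neg: "\<ominus>\<^bsub>C\<^esub> lim r = lim (\<lambda>N. \<ominus> r N)" if "coh r" for r
    by (rule C.minus_equality) (use that in \<open>simp_all add: lim_add coh_neg lim_zero coh_carr l_neg lim_carrier\<close>)
  have Pneg: "\<ominus> x \<in> Pw N" if "x \<in> Pw N" for x
    using additive_subgroup.a_inv_closed[OF ideal.axioms(1)[OF Pw_ideal] that] .
  show ?thesis
  proof (rule idealI)
    show "ring C" by (rule C.ring_axioms)
    show "subgroup (fil N) (add_monoid C)"
    proof (rule C.add.subgroupI)
      show "fil N \<subseteq> carrier C" by (auto simp: fil_def lim_carrier)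
      show "fil N \<noteq> {}" using coh_const[OF zero_closed] Pw_zero by (auto simp: fil_def)
      fix a assume "a \<in> fil N"
      then obtain r where r: "coh r" "r N \<in> Pw N" "a = lim r" by (auto simp: fil_def)
      show "\<ominus>\<^bsub>C\<^esub> a \<in> fil N"
        using neg[OF r(1)] mem_fil[OF coh_neg[OF r(1)], of N] Pneg r(2,3) by simp
      fix b assume "b \<in> fil N"
      then obtain t where t: "coh t" "t N \<in> Pw N" "b = lim t" by (auto simp: fil_def)
      show "a \<oplus>\<^bsub>C\<^esub> b \<in> fil N"
        using mem_fil[OF coh_add[OF r(1) t(1)], of N] Pw_add r t by (simp add: lim_add)
    qed
    fix a x assume "a \<in> fil N" "x \<in> carrier C"
    then obtain r t where r: "coh r" "r N \<in> Pw N" "a = lim r" "coh t" "x = lim t"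
      by (auto simp: fil_def elim: lim_obtain)
    show "x \<otimes>\<^bsub>C\<^esub> a \<in> fil N"
      using mem_fil[OF coh_mult[OF r(4) r(1)], of N] Pw_l r coh_carr by (simp add: lim_mult)
    show "a \<otimes>\<^bsub>C\<^esub> x \<in> fil N"
      using mem_fil[OF coh_mult[OF r(1) r(4)], of N] Pw_r r coh_carr by (simp add: lim_mult)
  qed
qed

section \<open>Units, the maximal ideal and its powers in the completion\<close>

lemma unit_completion:
  assumes f: "f \<in> carrier C" "f \<notin> fil 1"
  shows "f \<in> Units C"
proof -
  interpret C: cring C by (rule cring_completion)
  obtain r where r: "coh r" "f = lim r" using f(1) by (rule lim_obtain)
  have r1: "r 1 \<notin> P" using mem_fil[OF r(1), of 1] f(2) r(2) Pw_1 by simp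
  have rN: "r N \<notin> P" if N: "N \<ge> 1" for N
  proof
    assume "r N \<in> P"
    moreover have "r N \<ominus> r 1 \<in> P" using coh_diff[OF r(1) N] Pw_1 by simp
    ultimately have *: "r N \<ominus> (r N \<ominus> r 1) \<in> P" by (rule P.minus_mem)
    have "x \<ominus> (x \<ominus> y) = y" if "x \<in> carrier R" "y \<in> carrier R" for x y
      using that by algebra
    then have "r 1 \<in> P" using * coh_carr[OF r(1)] by simp
    then show False using r1 by blast
  qed
  have "\<exists>t\<in>carrier R. r N \<otimes> t \<ominus> \<one> \<in> Pw N" for N
  proof (cases "N = 0")
    case True then show ?thesis using coh_carr[OF r(1)] by (auto simp: ideal_pow_0)
  next
    case False then show ?thesis using inv_mod_Pw[OF coh_carr[OF r(1)] rN] by simp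
  qed
  then obtain t where t: "\<And>N. t N \<in> carrier R" "\<And>N. r N \<otimes> t N \<ominus> \<one> \<in> Pw N" by metis
  \<comment> \<open>The inverses \<open>t N\<close> are chosen independently, yet they cohere: an
    inverse modulo P^N is unique modulo P^N, and \<open>t (Suc N)\<close> is another inverse of
    \<open>r N\<close> there.\<close>
  have "coh t" unfolding coh_def
  proof (intro allI conjI t(1))
    fix N
    have id: "b \<ominus> a = a \<otimes> (v \<otimes> b \<ominus> \<one>) \<ominus> b \<otimes> (u \<otimes> a \<ominus> \<one>) \<ominus> (a \<otimes> b) \<otimes> (v \<ominus> u)"
      if "u \<in> carrier R" "v \<in> carrier R" "a \<in> carrier R" "b \<in> carrier R" for u v a b
      by (use that in algebra)
    have m: "r (Suc N) \<otimes> t (Suc N) \<ominus> \<one> \<in> Pw N"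
      using t(2)[of "Suc N"] Pw_mono[of N "Suc N"] by auto
    have d: "r (Suc N) \<ominus> r N \<in> Pw N" using r(1) by (simp add: coh_def)
    show "t (Suc N) \<ominus> t N \<in> Pw N"
      unfolding id[OF coh_carr[OF r(1), of N] coh_carr[OF r(1), of "Suc N"] t(1)[of N] t(1)[of "Suc N"]]
      by (rule Pw_minus[OF Pw_minus[OF Pw_l[OF m t(1)] Pw_l[OF t(2) t(1)]]
            Pw_l[OF d m_closed[OF t(1) t(1)]]])
  qed
  have "lim r \<otimes>\<^bsub>C\<^esub> lim t = \<one>\<^bsub>C\<^esub>"
    using t(2) lim_eq[OF coh_mult[OF r(1) \<open>coh t\<close>] coh_const[OF one_closed]]
    by (simp add: lim_mult[OF r(1) \<open>coh t\<close>] lim_one)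
  moreover have "lim t \<otimes>\<^bsub>C\<^esub> lim r = lim r \<otimes>\<^bsub>C\<^esub> lim t"
    by (rule C.m_comm[OF lim_carrier[OF \<open>coh t\<close>] lim_carrier[OF r(1)]])
  ultimately show ?thesis unfolding r(2) Units_def
    using lim_carrier[OF r(1)] lim_carrier[OF \<open>coh t\<close>] by auto
qed

lemma fil_1_proper: "\<one>\<^bsub>C\<^esub> \<notin> fil 1"
  unfolding lim_one using mem_fil[OF coh_const[OF one_closed], of 1] proper Pw_1 by simp

text \<open>Outside \<open>fil 1\<close> every element is a unit, so every proper ideal is contained
  in \<open>fil 1\<close>. This yields maximality and also the uniqueness that the definite
  description in \<open>the_max_ideal\<close> requires.\<close>

lemma max_ideal_completion: "the_max_ideal C = fil 1"
proof -
  interpret C: cring C by (rule cring_completion)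
  have big: "J \<subseteq> fil 1" if J: "ideal J C" "J \<noteq> carrier C" for J
  proof
    fix u assume u: "u \<in> J"
    interpret J: ideal J C by (rule J(1))
    show "u \<in> fil 1"
    proof (rule ccontr)
      assume "u \<notin> fil 1"
      then have U: "u \<in> Units C" using unit_completion J.Icarr[OF u] by blast
      have "inv\<^bsub>C\<^esub> u \<otimes>\<^bsub>C\<^esub> u \<in> J" using J.I_l_closed[OF u C.Units_inv_closed[OF U]] .
      then have "\<one>\<^bsub>C\<^esub> \<in> J" using C.Units_l_inv[OF U] by simp
      then show False using J.one_imp_carrier J(2) by blast
    qed
  qed
  have ne: "carrier C \<noteq> fil 1" using fil_1_proper C.one_closed by blast
  have max: "maximalideal (fil 1) C"
  proof (rule maximalidealI[OF ideal_fil ne])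
    fix J assume "ideal J C" "fil 1 \<subseteq> J" "J \<subseteq> carrier C"
    then show "J = fil 1 \<or> J = carrier C" using big[of J] by blast
  qed
  show ?thesis unfolding the_max_ideal_def
  proof (rule the_equality[where P = "\<lambda>M. maximalideal M C", OF max])
    fix M assume M: "maximalideal M C"
    interpret M: maximalideal M C by (rule M)
    have "M \<subseteq> fil 1" using big[OF M.ideal_axioms] M.I_notcarr by blast
    moreover have "fil 1 \<subseteq> carrier C" using ideal.axioms(1)[OF ideal_fil] additive_subgroup.a_subset by blast
    ultimately show "M = fil 1" using M.I_maximal[OF ideal_fil] ne by blast
  qed
qed

lemma lim_const_pow:
  "x \<in> carrier R \<Longrightarrow> lim (\<lambda>_. x) [^]\<^bsub>C\<^esub> (N::nat) = lim (\<lambda>_. x [^] N)"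
  by (induction N) (simp_all add: lim_one lim_mult coh_const)

text \<open>One inclusion compares valuations of products. For the other, an element of
  \<open>fil N\<close> has to be divided by \<pi>^N inside the completion: \<open>Pw_decomp\<close>
  provides approximate quotients at each level, and \<open>Pw_cancel\<close> shows that they form a
  coherent sequence.\<close>

lemma max_ideal_pow: "ideal_pow C (fil 1) N = fil N"
proof -
  interpret C: cring C by (rule cring_completion)
  have sub: "ideal_pow C (fil 1) N \<subseteq> fil N"
  proof (induction N)
    case 0
    show ?case using coh_carr by (auto simp: ideal_pow_0 fil_def carrier_completion)
  next
    case (Suc N)
    show ?case
    proof
      fix f assume "f \<in> ideal_pow C (fil 1) (Suc N)"
      then show "f \<in> fil (Suc N)" unfolding ideal_pow_Suc
      proof (induction f rule: ideal_prod.induct)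
        case (prod i j)
        then obtain r where r: "coh r" "i = lim r" "r N \<in> Pw N" using Suc by (auto simp: fil_def)
        obtain t where t: "coh t" "j = lim t" "t 1 \<in> P" using prod Pw_1 by (auto simp: fil_def)
        have shift: "x \<in> Pw M" if "y \<in> Pw M" "x \<ominus> y \<in> Pw M" "x \<in> carrier R" for x y M
        proof -
          have "y \<in> carrier R" using that(1) by (rule Pw_carr)
          then have "(x \<ominus> y) \<oplus> y = x" using that(3) by (simp add: a_minus_def a_assoc l_neg)
          then show ?thesis using Pw_add[OF that(2,1)] by simp
        qed
        have "r (Suc N) \<in> Pw N" using shift[OF r(3) coh_diff[OF r(1)]] coh_carr[OF r(1)] by simp
        moreover have "t (Suc N) \<in> Pw 1"
          using shift[of "t 1" 1 "t (Suc N)"] coh_diff[OF t(1), of 1 "Suc N"] coh_carr[OF t(1)] t(3) Pw_1 by simp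
        ultimately have "r (Suc N) \<otimes> t (Suc N) \<in> Pw (Suc N)" using ideal_pow_mult Pw_1 by metis
        then show ?case using mem_fil[OF coh_mult[OF r(1) t(1)], of "Suc N"] lim_mult r t by simp
      next
        case (sum a b)
        then show ?case using additive_subgroup.a_closed[OF ideal.axioms(1)[OF ideal_fil]] by blast
      qed
    qed
  qed
  have "fil N \<subseteq> ideal_pow C (fil 1) N"
  proof
    fix f assume "f \<in> fil N"
    then obtain r where r: "coh r" "f = lim r" "r N \<in> Pw N" by (auto simp: fil_def)
    have rk: "r (N + k) \<in> Pw N" for k
    proof -
      have "(r (N + k) \<ominus> r N) \<oplus> r N \<in> Pw N" using Pw_add[OF coh_diff[OF r(1)] r(3)] by simp
      then show ?thesis using coh_carr[OF r(1)] by (simp add: a_minus_def a_assoc l_neg)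
    qed
    \<comment> \<open>Division by \<pi>^N costs N levels of precision, so the quotient modulo P^k is
      read off from level \<open>N + k\<close>.\<close>
    have "\<forall>k. \<exists>z\<in>carrier R. r (N + k) \<ominus> \<pi> [^] N \<otimes> z \<in> Pw (N + k)" using Pw_decomp[OF rk] by blast
    then obtain g where g: "\<And>k. g k \<in> carrier R" "\<And>k. r (N + k) \<ominus> \<pi> [^] N \<otimes> g k \<in> Pw (N + k)" by metis
    have Q: "\<pi> [^] N \<in> carrier R" using pi_carr by simp
    have "g (Suc k) \<ominus> g k \<in> Pw k" for k
    proof (rule Pw_cancel[where N = N])
      show "g (Suc k) \<ominus> g k \<in> carrier R" using g by simp
      have id: "q \<otimes> (a \<ominus> b) = (x \<ominus> y) \<oplus> (y \<ominus> q \<otimes> b) \<ominus> (x \<ominus> q \<otimes> a)"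
        if "q \<in> carrier R" "a \<in> carrier R" "b \<in> carrier R" "x \<in> carrier R" "y \<in> carrier R" for q a b x y
        by (use that in algebra)
      have e: "r (N + Suc k) \<ominus> \<pi> [^] N \<otimes> g (Suc k) \<in> Pw (N + k)"
        using g(2)[of "Suc k"] Pw_mono[of "N + k" "N + Suc k"] by auto
      have d: "r (N + Suc k) \<ominus> r (N + k) \<in> Pw (N + k)" by (rule coh_diff[OF r(1)]) simp
      show "\<pi> [^] N \<otimes> (g (Suc k) \<ominus> g k) \<in> Pw (N + k)"
        unfolding id[OF Q g(1) g(1) coh_carr[OF r(1), of "N + Suc k"] coh_carr[OF r(1), of "N + k"]]
        by (rule Pw_minus[OF Pw_add[OF d g(2)] e])
    qed
    then have "coh g" using g(1) by (simp add: coh_def)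
    have "f = lim (\<lambda>_. \<pi> [^] N) \<otimes>\<^bsub>C\<^esub> lim g"
      unfolding r(2) lim_mult[OF coh_const[OF Q] \<open>coh g\<close>] lim_eq[OF r(1) coh_mult[OF coh_const[OF Q] \<open>coh g\<close>]]
    proof
      fix k
      have id: "x \<ominus> z = (y \<ominus> z) \<ominus> (y \<ominus> x)" if "x \<in> carrier R" "y \<in> carrier R" "z \<in> carrier R" for x y z
        by (use that in algebra)
      have zc: "\<pi> [^] N \<otimes> g k \<in> carrier R" using Q g by simp
      show "r k \<ominus> \<pi> [^] N \<otimes> g k \<in> Pw k"
        unfolding id[OF coh_carr[OF r(1)] coh_carr[OF r(1)] zc, of k "N + k"]
        by (rule Pw_minus[OF _ coh_diff[OF r(1)]])
          (use Pw_mono[of k "N + k"] g(2)[of k] in auto)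
    qed
    moreover have "lim (\<lambda>_. \<pi>) \<in> fil 1" using mem_fil[OF coh_const[OF pi_carr], of 1] pi Pw_1 by simp
    then have "lim (\<lambda>_. \<pi> [^] N) \<in> ideal_pow C (fil 1) N"
      unfolding lim_const_pow[OF pi_carr, symmetric] by (rule C.nat_pow_mem_ideal_pow)
    ultimately show "f \<in> ideal_pow C (fil 1) N"
      using ideal.I_r_closed[OF C.ideal_ideal_pow[OF ideal_fil]] lim_carrier[OF \<open>coh g\<close>] by simp
  qed
  with sub show ?thesis by blast
qed

text \<open>Elements of the quotient are sets of sequences of cosets; all later use goes through a
  surjection from R with kernel P^N. It is onto because a limit is congruent modulo
  \<open>fil N\<close> to the constant sequence of its N-th term.\<close>

lemma completion_quotient:
  defines "A N \<equiv> C Quot ideal_pow C (the_max_ideal C) N"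
  obtains \<psi> where "cring (A N)" "\<psi> \<in> Ring.ring_hom R (A N)" "\<psi> ` carrier R = carrier (A N)"
    "\<And>x. x \<in> carrier R \<Longrightarrow> \<psi> x = \<zero>\<^bsub>A N\<^esub> \<longleftrightarrow> x \<in> Pw N"
proof -
  interpret C: cring C by (rule cring_completion)
  interpret I: ideal "fil N" C by (rule ideal_fil)
  have A: "A N = C Quot fil N" unfolding A_def max_ideal_completion max_ideal_pow ..
  define \<psi> where "\<psi> x = fil N +>\<^bsub>C\<^esub> lim (\<lambda>_. x)" for x
  note cc = lim_carrier[OF coh_const]
  have 1: "cring (A N)" unfolding A by (rule I.quotient_is_cring[OF C.is_cring])
  have 2: "\<psi> \<in> Ring.ring_hom R (A N)" unfolding A \<psi>_def
    by (rule ring_hom_memI)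
      (simp_all add: C.quot_simps[OF ideal_fil] cc lim_mult lim_add coh_const lim_one)
  have minus: "f \<ominus>\<^bsub>C\<^esub> lim t = lim (\<lambda>N. r N \<ominus> t N)" if "f = lim r" "coh r" "coh t" for f r t
  proof -
    have c: "coh (\<lambda>N. r N \<ominus> t N)" unfolding a_minus_def using that by (intro coh_add coh_neg)
    have "lim (\<lambda>N. r N \<ominus> t N) \<oplus>\<^bsub>C\<^esub> lim t = f"
      using that c coh_carr by (simp add: lim_add a_minus_def a_assoc l_neg)
    then have "f \<ominus>\<^bsub>C\<^esub> lim t = (lim (\<lambda>N. r N \<ominus> t N) \<oplus>\<^bsub>C\<^esub> lim t) \<ominus>\<^bsub>C\<^esub> lim t" by simp
    also have "\<dots> = lim (\<lambda>N. r N \<ominus> t N)"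
      using lim_carrier[OF c] lim_carrier[OF that(3)] by (simp add: C.minus_eq C.a_assoc C.r_neg)
    finally show ?thesis .
  qed
  have "\<exists>x\<in>carrier R. \<psi> x = c" if c: "c \<in> carrier (A N)" for c
  proof -
    obtain f where f: "f \<in> carrier C" "c = fil N +>\<^bsub>C\<^esub> f"
      using C.quot_simps(2)[OF ideal_fil] c unfolding A by blast
    obtain r where r: "coh r" "f = lim r" using f(1) by (rule lim_obtain)
    note rN = coh_carr[OF r(1), of N]
    have "coh (\<lambda>k. r k \<ominus> r N)" unfolding a_minus_def using r(1) coh_const[OF rN] by (intro coh_add coh_neg)
    then have "f \<ominus>\<^bsub>C\<^esub> lim (\<lambda>_. r N) \<in> fil N"
      unfolding minus[OF r(2,1) coh_const[OF rN]] using mem_fil rN Pw_zero by (simp add: r_neg a_minus_def)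
    then have "\<psi> (r N) = c" unfolding \<psi>_def f(2)
      using C.quotient_eq_iff_same_a_r_cos[OF ideal_fil f(1) cc[OF rN]] by simp
    then show ?thesis using rN by blast
  qed
  then have 3: "\<psi> ` carrier R = carrier (A N)" using ring_hom_closed[OF 2] by blast
  have 4: "\<psi> x = \<zero>\<^bsub>A N\<^esub> \<longleftrightarrow> x \<in> Pw N" if x: "x \<in> carrier R" for x
  proof -
    have "\<psi> x = \<zero>\<^bsub>A N\<^esub> \<longleftrightarrow> lim (\<lambda>_. x) \<ominus>\<^bsub>C\<^esub> lim (\<lambda>_. \<zero>) \<in> fil N"
      unfolding A \<psi>_def C.quot_simps(6)[OF ideal_fil] lim_zero
      using C.quotient_eq_iff_same_a_r_cos[OF ideal_fil cc[OF x] cc[OF zero_closed]] by simp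
    also have "\<dots> \<longleftrightarrow> lim (\<lambda>_. x) \<in> fil N" using cc[OF x] by (simp add: lim_zero[symmetric] C.minus_eq)
    also have "\<dots> \<longleftrightarrow> x \<in> Pw N" using mem_fil[OF coh_const[OF x]] by simp
    finally show ?thesis .
  qed
  show ?thesis by (rule that[OF 1 2 3 4])
qed

end

section \<open>Finite chain rings\<close>

lemma card_by_fibres:
  assumes "finite S" "\<And>y. y \<in> f ` S \<Longrightarrow> card {x \<in> S. f x = y} = c"
  shows "card S = card (f ` S) * c"
proof -
  have "card S = (\<Sum>y\<in>f ` S. card {x \<in> S. f x = y})"
    using sum.image_gen[OF assms(1), of "\<lambda>_. 1::nat" f] by simp
  also have "\<dots> = card (f ` S) * c" using assms(2) by simp
  finally show ?thesis .
qed

lemma (in cring) add_minus_cancel_left: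
  assumes "x \<in> carrier R" "y \<in> carrier R"
  shows "(x \<oplus> y) \<ominus> x = y"
  by (use assms in algebra)

lemma (in cring) add_minus_swap:
  assumes "x \<in> carrier R" "y \<in> carrier R" "z \<in> carrier R"
  shows "(x \<oplus> y) \<ominus> z = y \<oplus> (x \<ominus> z)"
  by (use assms in algebra)

text \<open>A finite chain ring of length \<open>N\<close> with uniformizer \<open>\<pi>\<close> and residue field of order \<open>q\<close>.\<close>

locale chain_ring = cring A for A (structure) +
  fixes \<pi> and q N :: nat
  assumes fin: "finite (carrier A)"
    and pi_carr: "\<pi> \<in> carrier A"
    and q: "q \<ge> 2"
    and card_pow: "k \<le> N \<Longrightarrow> card ((\<lambda>x. \<pi> [^] k \<otimes> x) ` carrier A) = q ^ (N - k)"
    and decomp: "x \<in> carrier A \<Longrightarrow> \<exists>k\<le>N. \<exists>u\<in>Units A. x = \<pi> [^] k \<otimes> u"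

section \<open>Quotients of the completion as chain rings\<close>

context locally_principal
begin

definition q :: nat where "q = card (carrier (R Quot P))"

text \<open>These representatives of the residue field serve as digits: in
  \<open>chain_ring_quotient\<close> an element of \<pi>^k A is a digit times \<pi>^k plus an
  element of \<pi>^(k+1) A.\<close>

lemma transversal:
  obtains T where "T \<subseteq> carrier R" "finite T" "card T = q"
    "\<And>y. y \<in> carrier R \<Longrightarrow> \<exists>r\<in>T. y \<ominus> r \<in> P"
    "\<And>r r'. r \<in> T \<Longrightarrow> r' \<in> T \<Longrightarrow> r \<ominus> r' \<in> P \<Longrightarrow> r = r'"
proof -
  note qs = quot_simps[OF P.ideal_axioms]
  note qe = quotient_eq_iff_same_a_r_cos[OF P.ideal_axioms]
  have "carrier (R Quot P) \<subseteq> (\<lambda>r. P +> r) ` F"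
  proof
    fix c assume "c \<in> carrier (R Quot P)"
    then obtain x where x: "x \<in> carrier R" "c = P +> x" using qs(2) by blast
    then obtain r where "r \<in> F" "x \<ominus> r \<in> P" using F(3) by blast
    then show "c \<in> (\<lambda>r. P +> r) ` F" using qe[of x r] x F(2) by blast
  qed
  then have fin: "finite (carrier (R Quot P))" using F(1) finite_surj by blast
  obtain g where g: "\<And>c. c \<in> carrier (R Quot P) \<Longrightarrow> g c \<in> carrier R \<and> c = P +> g c"
    using qs(2) by metis
  have inj: "inj_on g (carrier (R Quot P))" using g by (metis inj_onI)
  show ?thesis
  proof (rule that[of "g ` carrier (R Quot P)"])
    show "g ` carrier (R Quot P) \<subseteq> carrier R" using g by blast
    show "finite (g ` carrier (R Quot P))" using fin by simp
    show "card (g ` carrier (R Quot P)) = q" unfolding q_def using card_image[OF inj] .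
    show "\<exists>r\<in>g ` carrier (R Quot P). y \<ominus> r \<in> P" if y: "y \<in> carrier R" for y
      using g[OF qs(1)[OF y]] qe[OF y] qs(1)[OF y] by auto
    fix r r' assume "r \<in> g ` carrier (R Quot P)" "r' \<in> g ` carrier (R Quot P)" "r \<ominus> r' \<in> P"
    then obtain c c' where c: "c \<in> carrier (R Quot P)" "r = g c" "c' \<in> carrier (R Quot P)" "r' = g c'" by blast
    then have "P +> r = P +> r'" using qe[of r r'] g \<open>r \<ominus> r' \<in> P\<close> by blast
    then have "c = c'" using g c by metis
    then show "r = r'" using c by simp
  qed
qed

lemma q_ge_2: "q \<ge> 2"
proof -
  obtain T where T: "T \<subseteq> carrier R" "finite T" "card T = q" "\<And>y. y \<in> carrier R \<Longrightarrow> \<exists>r\<in>T. y \<ominus> r \<in> P"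
    using transversal by metis
  obtain r0 where r0: "r0 \<in> T" "\<zero> \<ominus> r0 \<in> P" using T(4) by blast
  obtain r1 where r1: "r1 \<in> T" "\<one> \<ominus> r1 \<in> P" using T(4) by blast
  have "r0 \<noteq> r1"
  proof
    assume e: "r0 = r1"
    have c: "r0 \<in> carrier R" using r0 T(1) by blast
    have "(\<one> \<ominus> r0) \<ominus> (\<zero> \<ominus> r0) \<in> P" using P.minus_mem r0 r1 e by blast
    moreover have "(\<one> \<ominus> r0) \<ominus> (\<zero> \<ominus> r0) = \<one>" by (use c in algebra)
    ultimately show False using proper by simp
  qed
  then have "card {r0, r1} = 2" by simp
  moreover have "card {r0, r1} \<le> card T" using T(2) r0(1) r1(1) by (intro card_mono) auto
  ultimately show ?thesis using T(3) by simp
qed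

text \<open>Divisibility in A is pulled back to R: by \<open>memI\<close>, for k \<le> N, the image
  of y is a multiple of \<pi>^k exactly when y lies in P^k. Both the orders of the ideals and the
  decomposition into a power of \<pi> and a unit then follow from the division lemmas in R.\<close>

lemma chain_ring_quotient:
  assumes A: "cring A" and hom: "\<psi> \<in> Ring.ring_hom R A" and surj: "\<psi> ` carrier R = carrier A"
    and ker: "\<And>x. x \<in> carrier R \<Longrightarrow> \<psi> x = \<zero>\<^bsub>A\<^esub> \<longleftrightarrow> x \<in> Pw N"
  shows "chain_ring A (\<psi> \<pi>) q N"
proof -
  interpret A: cring A by (rule A)
  interpret h: ring_hom_cring R A \<psi>
    by (intro ring_hom_cring.intro ring_hom_cring_axioms.intro is_cring A hom)
  have pow: "\<psi> (\<pi> [^] k) = \<psi> \<pi> [^]\<^bsub>A\<^esub> k" for k :: nat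
    by (induction k) (use pi_carr in simp_all)
  have minus: "\<psi> (x \<ominus> y) = \<psi> x \<ominus>\<^bsub>A\<^esub> \<psi> y" if "x \<in> carrier R" "y \<in> carrier R" for x y
    using that by (simp add: a_minus_def)
  have kerI: "\<psi> x = \<zero>\<^bsub>A\<^esub>" if "x \<in> Pw N" for x
    using ker[OF Pw_carr[OF that]] that by blast
  define I where "I k = (\<lambda>x. \<psi> \<pi> [^]\<^bsub>A\<^esub> k \<otimes>\<^bsub>A\<^esub> x) ` carrier A" for k :: nat
  have memI: "\<psi> y \<in> I k \<longleftrightarrow> y \<in> Pw k" if k: "k \<le> N" and y: "y \<in> carrier R" for y k
  proof
    assume "\<psi> y \<in> I k"
    then obtain z where z: "z \<in> carrier R" "\<psi> y = \<psi> (\<pi> [^] k \<otimes> z)"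
      unfolding I_def surj[symmetric] using pi_carr by (auto simp: pow)
    have pz: "\<pi> [^] k \<otimes> z \<in> carrier R" using z pi_carr by simp
    then have "\<psi> (y \<ominus> \<pi> [^] k \<otimes> z) = \<zero>\<^bsub>A\<^esub>" using z y by (simp add: minus)
    then have "y \<ominus> \<pi> [^] k \<otimes> z \<in> Pw k" using ker pz y Pw_mono[OF k] by blast
    moreover have "\<pi> [^] k \<otimes> z \<in> Pw k" using Pw_r[OF pi_pow_mem z(1)] .
    ultimately have "(y \<ominus> \<pi> [^] k \<otimes> z) \<oplus> \<pi> [^] k \<otimes> z \<in> Pw k" by (rule Pw_add)
    then show "y \<in> Pw k" using y pz by (simp add: a_minus_def a_assoc l_neg)
  next
    assume "y \<in> Pw k"
    then obtain z where z: "z \<in> carrier R" "y \<ominus> \<pi> [^] k \<otimes> z \<in> Pw N" using Pw_decomp by blast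
    have pz: "\<pi> [^] k \<otimes> z \<in> carrier R" using z pi_carr by simp
    have "\<psi> y \<ominus>\<^bsub>A\<^esub> \<psi> (\<pi> [^] k \<otimes> z) = \<zero>\<^bsub>A\<^esub>" using ker[of "y \<ominus> \<pi> [^] k \<otimes> z"] z y pz minus by auto
    then have "\<psi> y = \<psi> (\<pi> [^] k \<otimes> z)" using y pz by simp
    then have "\<psi> y = \<psi> \<pi> [^]\<^bsub>A\<^esub> k \<otimes>\<^bsub>A\<^esub> \<psi> z" using z pi_carr by (simp add: pow)
    then show "\<psi> y \<in> I k" unfolding I_def using z by blast
  qed
  obtain T where T: "T \<subseteq> carrier R" "finite T" "card T = q"
    "\<And>y. y \<in> carrier R \<Longrightarrow> \<exists>r\<in>T. y \<ominus> r \<in> P"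
    "\<And>r r'. r \<in> T \<Longrightarrow> r' \<in> T \<Longrightarrow> r \<ominus> r' \<in> P \<Longrightarrow> r = r'"
    using transversal by metis
  have I_sub: "I k \<subseteq> carrier A" for k unfolding I_def using pi_carr by auto
  have psipi: "\<psi> \<pi> [^]\<^bsub>A\<^esub> k \<in> carrier A" for k :: nat using pi_carr by simp
  have pre: "\<exists>x'\<in>carrier R. x = \<psi> x'" if x: "x \<in> carrier A" for x
    using x unfolding surj[symmetric] by blast
  have I_diff: "y \<in> I k" if a: "x \<in> I k" "x = z \<oplus>\<^bsub>A\<^esub> y" "z \<in> I k" "y \<in> carrier A" "k \<le> N" for x y z k
  proof -
    obtain x' y' z' where r: "x = \<psi> x'" "y = \<psi> y'" "z = \<psi> z'" "x' \<in> carrier R" "y' \<in> carrier R" "z' \<in> carrier R"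
      using pre[OF subsetD[OF I_sub a(1)]] pre[OF a(4)] pre[OF subsetD[OF I_sub a(3)]] by blast
    have "x' \<in> Pw k" "z' \<in> Pw k" using memI[OF a(5)] r a by auto
    then have "x' \<ominus> z' \<in> Pw k" by (rule Pw_minus)
    then have "\<psi> (x' \<ominus> z') \<in> I k" using memI[OF a(5) minus_closed[OF r(4) r(6)]] by blast
    moreover have "\<psi> (x' \<ominus> z') = y"
      using a(2) r by (simp add: minus A.add_minus_cancel_left)
    ultimately show ?thesis by simp
  qed
  \<comment> \<open>Splitting off the leading digit: each level contributes one factor q. The orders
    follow by induction upwards from \<open>I N\<close>, which is zero.\<close>
  have bij: "bij_betw (\<lambda>(r, x). \<psi> (\<pi> [^] k \<otimes> r) \<oplus>\<^bsub>A\<^esub> x) (T \<times> I (Suc k)) (I k)" if k: "k < N" for k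
  proof -
    have pr: "\<pi> [^] k \<otimes> r \<in> carrier R" if "r \<in> carrier R" for r using that pi_carr by simp
    have inj: "inj_on (\<lambda>(r, x). \<psi> (\<pi> [^] k \<otimes> r) \<oplus>\<^bsub>A\<^esub> x) (T \<times> I (Suc k))"
    proof (rule inj_onI, clarify)
      fix r x r' x' assume a: "r \<in> T" "x \<in> I (Suc k)" "r' \<in> T" "x' \<in> I (Suc k)"
        "\<psi> (\<pi> [^] k \<otimes> r) \<oplus>\<^bsub>A\<^esub> x = \<psi> (\<pi> [^] k \<otimes> r') \<oplus>\<^bsub>A\<^esub> x'"
      have c: "r \<in> carrier R" "r' \<in> carrier R" "x \<in> carrier A" "x' \<in> carrier A" using a T(1) I_sub by auto
      define d where "d = \<psi> (\<pi> [^] k \<otimes> r) \<ominus>\<^bsub>A\<^esub> \<psi> (\<pi> [^] k \<otimes> r')"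
      have dc: "d \<in> carrier A" unfolding d_def using c pr by simp
      have "x' = x \<oplus>\<^bsub>A\<^esub> d"
      proof -
        have "x' = (v \<oplus>\<^bsub>A\<^esub> x') \<ominus>\<^bsub>A\<^esub> v" if "v \<in> carrier A" for v
          using that c by (simp add: A.add_minus_cancel_left)
        from this[of "\<psi> (\<pi> [^] k \<otimes> r')"] have "x' = (\<psi> (\<pi> [^] k \<otimes> r) \<oplus>\<^bsub>A\<^esub> x) \<ominus>\<^bsub>A\<^esub> \<psi> (\<pi> [^] k \<otimes> r')"
          using c pr a(5) by simp
        then show ?thesis unfolding d_def using c pr by (simp add: A.add_minus_swap)
      qed
      then have "d \<in> I (Suc k)" using I_diff[OF a(4) _ a(2) dc] k by simp
      moreover have "d = \<psi> (\<pi> [^] k \<otimes> (r \<ominus> r'))"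
        unfolding d_def using c pi_carr by (simp add: minus[symmetric] a_minus_def r_distr r_minus)
      ultimately have "\<pi> [^] k \<otimes> (r \<ominus> r') \<in> Pw (k + 1)" using memI[of "Suc k"] k c pr by simp
      then have "r \<ominus> r' \<in> P" using Pw_cancel[of "r \<ominus> r'" k 1] c Pw_1 by simp
      then have rr: "r = r'" using T(5) a by blast
      then have "x = x'" using a(5) c pr by simp
      with rr show "r = r' \<and> x = x'" by simp
    qed
    have img: "(\<lambda>(r, x). \<psi> (\<pi> [^] k \<otimes> r) \<oplus>\<^bsub>A\<^esub> x) ` (T \<times> I (Suc k)) = I k"
    proof (intro equalityI subsetI)
      fix y assume "y \<in> (\<lambda>(r, x). \<psi> (\<pi> [^] k \<otimes> r) \<oplus>\<^bsub>A\<^esub> x) ` (T \<times> I (Suc k))"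
      then obtain r x where rx: "r \<in> carrier R" "x \<in> I (Suc k)" "y = \<psi> (\<pi> [^] k \<otimes> r) \<oplus>\<^bsub>A\<^esub> x" using T(1) by auto
      then obtain x' where x': "x = \<psi> x'" "x' \<in> carrier R" using pre I_sub by blast
      have "x' \<in> Pw k" using memI[of "Suc k" x'] x' rx k Pw_mono[of k "Suc k"] by auto
      moreover have "\<pi> [^] k \<otimes> r \<in> Pw k" using Pw_r[OF pi_pow_mem rx(1)] .
      ultimately have "\<pi> [^] k \<otimes> r \<oplus> x' \<in> Pw k" using Pw_add by blast
      then have "\<psi> (\<pi> [^] k \<otimes> r \<oplus> x') \<in> I k"
        using memI[of k "\<pi> [^] k \<otimes> r \<oplus> x'", THEN iffD2] k pr[OF rx(1)] x'(2) by simp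
      then show "y \<in> I k" using rx x' pr by simp
    next
      fix y assume "y \<in> I k"
      then obtain z where z: "z \<in> carrier R" "y = \<psi> (\<pi> [^] k \<otimes> z)"
        unfolding I_def surj[symmetric] using pi_carr by (auto simp: pow)
      obtain r where r: "r \<in> T" "z \<ominus> r \<in> P" using T(4) z by blast
      have rc: "r \<in> carrier R" using r T by blast
      have m: "\<pi> [^] k \<otimes> (z \<ominus> r) \<in> Pw (Suc k)" using pi_pow_mult_mem[of "z \<ominus> r" 1 k] r(2) Pw_1 by simp
      then have "\<psi> (\<pi> [^] k \<otimes> (z \<ominus> r)) \<in> I (Suc k)"
        using memI[OF Suc_leI[OF k] pr[OF minus_closed[OF z(1) rc]]] by blast
      moreover have "\<pi> [^] k \<otimes> z = \<pi> [^] k \<otimes> r \<oplus> \<pi> [^] k \<otimes> (z \<ominus> r)"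
      proof -
        have p: "\<pi> [^] k \<in> carrier R" using pi_carr by simp
        have "p \<otimes> z = p \<otimes> r \<oplus> p \<otimes> (z \<ominus> r)" if p: "p \<in> carrier R" for p
          by (use p rc z(1) in algebra)
        from this[OF p] show ?thesis .
      qed
      then have "y = \<psi> (\<pi> [^] k \<otimes> r) \<oplus>\<^bsub>A\<^esub> \<psi> (\<pi> [^] k \<otimes> (z \<ominus> r))"
        using z(2) h.hom_add[OF pr[OF rc] pr] z(1) rc by simp
      ultimately show "y \<in> (\<lambda>(r, x). \<psi> (\<pi> [^] k \<otimes> r) \<oplus>\<^bsub>A\<^esub> x) ` (T \<times> I (Suc k))"
        using r(1) by (intro image_eqI[of _ _ "(r, \<psi> (\<pi> [^] k \<otimes> (z \<ominus> r)))"]) auto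
    qed
    show ?thesis using inj img by (simp add: bij_betw_def)
  qed
  have IN: "I N = {\<zero>\<^bsub>A\<^esub>}"
  proof -
    have z: "\<psi> \<pi> [^]\<^bsub>A\<^esub> N = \<zero>\<^bsub>A\<^esub>" using kerI[OF pi_pow_mem] unfolding pow .
    have "I N = (\<lambda>_. \<zero>\<^bsub>A\<^esub>) ` carrier A" unfolding I_def z by (rule image_cong) simp_all
    then show ?thesis using A.zero_closed by (simp only: image_constant)
  qed
  have "finite (I (N - j)) \<and> card (I (N - j)) = q ^ j" if "j \<le> N" for j
    using that
  proof (induction j)
    case (Suc j)
    have k: "N - Suc j < N" "Suc (N - Suc j) = N - j" using Suc.prems by auto
    note b = bij[OF k(1), unfolded k(2)]
    have IH: "finite (I (N - j))" "card (I (N - j)) = q ^ j" using Suc by auto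
    show ?case using bij_betw_finite[OF b] bij_betw_same_card[OF b] IH T(2,3) by (simp add: card_cartesian_product)
  qed (simp add: IN)
  then have card: "finite (I k) \<and> card (I k) = q ^ (N - k)" if "k \<le> N" for k
    using that by (metis diff_diff_cancel diff_le_self)
  have I0: "I 0 = carrier A" unfolding I_def by simp
  have dec: "\<exists>k\<le>N. \<exists>u\<in>Units A. x = \<psi> \<pi> [^]\<^bsub>A\<^esub> k \<otimes>\<^bsub>A\<^esub> u" if x: "x \<in> carrier A" for x
  proof (cases "x = \<zero>\<^bsub>A\<^esub>")
    case True
    \<comment> \<open>Zero counts as \<pi>^N times a unit, so the decomposition has no exceptional
      element.\<close>
    have "\<psi> \<pi> [^]\<^bsub>A\<^esub> N \<otimes>\<^bsub>A\<^esub> \<one>\<^bsub>A\<^esub> \<in> I N" unfolding I_def by blast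
    then have "x = \<psi> \<pi> [^]\<^bsub>A\<^esub> N \<otimes>\<^bsub>A\<^esub> \<one>\<^bsub>A\<^esub>" using IN True by simp
    then show ?thesis using A.Units_one_closed by blast
  next
    case False
    obtain y where y: "y \<in> carrier R" "x = \<psi> y" using x surj by blast
    have yN: "y \<notin> Pw N" using ker y False by blast
    \<comment> \<open>As m is least with y outside P^m, its predecessor k is the valuation of y. The
      approximate quotient z of y by \<pi>^k is then outside P and becomes a unit of A.\<close>
    define m where "m = (LEAST m. y \<notin> Pw m)"
    have m1: "y \<notin> Pw m" unfolding m_def using yN by (rule LeastI)
    have "m \<le> N" unfolding m_def using yN by (rule Least_le)
    have "m \<noteq> 0" using m1 y by (intro notI) (simp add: ideal_pow_0)
    then obtain k where k: "m = Suc k" by (cases m) auto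
    have yk: "y \<in> Pw k" using not_less_Least[of k "\<lambda>m. y \<notin> Pw m"] k unfolding m_def by auto
    obtain z where z: "z \<in> carrier R" "y \<ominus> \<pi> [^] k \<otimes> z \<in> Pw N" using Pw_decomp[OF yk] by blast
    have pz: "\<pi> [^] k \<otimes> z \<in> carrier R" using z pi_carr by simp
    have "z \<notin> P"
    proof
      assume "z \<in> P"
      then have "\<pi> [^] k \<otimes> z \<in> Pw m" using pi_pow_mult_mem[of z 1 k] Pw_1 k by simp
      moreover have "y \<ominus> \<pi> [^] k \<otimes> z \<in> Pw m" using z(2) Pw_mono[OF \<open>m \<le> N\<close>] by blast
      ultimately have "(y \<ominus> \<pi> [^] k \<otimes> z) \<oplus> \<pi> [^] k \<otimes> z \<in> Pw m" using Pw_add by blast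
      then show False using m1 y pz by (simp add: a_minus_def a_assoc l_neg)
    qed
    then obtain t where t: "t \<in> carrier R" "z \<otimes> t \<ominus> \<one> \<in> Pw N" using inv_mod_Pw z by blast
    have "\<psi> (z \<otimes> t \<ominus> \<one>) = \<zero>\<^bsub>A\<^esub>" by (rule kerI[OF t(2)])
    then have zt: "\<psi> z \<otimes>\<^bsub>A\<^esub> \<psi> t = \<one>\<^bsub>A\<^esub>" using t z by (simp add: minus)
    then have "\<psi> t \<otimes>\<^bsub>A\<^esub> \<psi> z = \<one>\<^bsub>A\<^esub>" using t z by (simp add: A.m_comm)
    then have "\<psi> z \<in> Units A" unfolding Units_def using zt t z by auto
    moreover have "\<psi> (y \<ominus> \<pi> [^] k \<otimes> z) = \<zero>\<^bsub>A\<^esub>" by (rule kerI[OF z(2)])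
    then have "x = \<psi> \<pi> [^]\<^bsub>A\<^esub> k \<otimes>\<^bsub>A\<^esub> \<psi> z" using y pz z pi_carr by (simp add: minus pow)
    ultimately show ?thesis using k \<open>m \<le> N\<close> by (intro exI[of _ k]) auto
  qed
  show ?thesis
  proof (intro chain_ring.intro chain_ring_axioms.intro A)
    show "finite (carrier A)" using card[of 0] I0 by simp
    show "\<psi> \<pi> \<in> carrier A" using pi_carr by simp
    show "2 \<le> q" by (rule q_ge_2)
    show "card ((\<lambda>x. \<psi> \<pi> [^]\<^bsub>A\<^esub> k \<otimes>\<^bsub>A\<^esub> x) ` carrier A) = q ^ (N - k)" if "k \<le> N" for k
      using card[OF that] unfolding I_def by simp
  qed (rule dec)
qed

theorem chain_ring_completion_quotient:
  "\<exists>\<omega>. chain_ring (C Quot ideal_pow C (the_max_ideal C) N) \<omega> q N"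
proof -
  obtain \<psi> where c: "cring (C Quot ideal_pow C (the_max_ideal C) N)"
    "\<psi> \<in> Ring.ring_hom R (C Quot ideal_pow C (the_max_ideal C) N)"
    "\<psi> ` carrier R = carrier (C Quot ideal_pow C (the_max_ideal C) N)"
    "\<And>x. x \<in> carrier R \<Longrightarrow> \<psi> x = \<zero>\<^bsub>C Quot ideal_pow C (the_max_ideal C) N\<^esub> \<longleftrightarrow> x \<in> Pw N"
    using completion_quotient[of N thesis] by blast
  show ?thesis using chain_ring_quotient[OF c] by blast
qed

end

section \<open>Conjugacy classes in groups of class two\<close>

text \<open>A class with m elements contributes m^(-s), which is spread over its members as m^(-(1 +
  s)) each. This is the origin of the exponent 1 + s in everything that follows.\<close>

lemma (in group) zeta_cc_eq_sum:
  assumes fin: "finite (carrier G)"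
  shows "zeta_cc G s = (\<Sum>x\<in>carrier G. of_nat (card ((\<lambda>h. h \<otimes> x \<otimes> inv h) ` carrier G)) powr (- (1 + s)))"
proof -
  define \<phi> where "\<phi> = (\<lambda>g. \<lambda>h\<in>carrier G. g \<otimes> h \<otimes> inv g)"
  interpret act: group_action G "carrier G" \<phi>
    unfolding \<phi>_def by (rule action_by_conjugation)
  define CC where "CC = orbits G (carrier G) \<phi>"
  have CC: "conj_classes G = CC" unfolding conj_classes_def CC_def \<phi>_def ..
  have sub: "c \<subseteq> carrier G" if "c \<in> CC" for c
    using that act.orbits_coverture unfolding CC_def by blast
  have finC: "finite c" if "c \<in> CC" for c using finite_subset[OF sub[OF that] fin] .
  have finCC: "finite CC" unfolding CC_def orbits_def using fin by simp
  have orb: "orbit G \<phi> x = (\<lambda>h. h \<otimes> x \<otimes> inv h) ` carrier G" if "x \<in> carrier G" for x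
    using that unfolding orbit_def \<phi>_def by auto
  have orbC: "orbit G \<phi> x = c" if "c \<in> CC" "x \<in> c" for c x
  proof -
    have x: "x \<in> carrier G" using sub that by blast
    have "orbit G \<phi> x \<in> CC" unfolding CC_def orbits_def using x by blast
    moreover have "x \<in> orbit G \<phi> x" using act.orbit_refl[OF x] .
    ultimately show ?thesis using act.disjoint_union[of c "orbit G \<phi> x"] that unfolding CC_def by blast
  qed
  have ne: "c \<noteq> {}" if "c \<in> CC" for c
    using that act.orbit_refl unfolding CC_def orbits_def by blast
  have pos: "card c \<ge> 1" if "c \<in> CC" for c
    using finC[OF that] ne[OF that] by (simp add: Suc_leI card_gt_0_iff)
  define M where "M = card (carrier G)"
  have le: "card c \<le> M" if "c \<in> CC" for c
    unfolding M_def using card_mono[OF fin sub[OF that]] .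
  define f where "f m = (of_nat m :: complex) powr (- s)" for m :: nat
  have "zeta_cc G s = (\<Sum>\<^sub>\<infinity>m\<in>{1..M}. of_nat (card {C \<in> CC. card C = m}) * f m)"
    unfolding zeta_cc_def class_count_def CC f_def
  proof (rule infsum_cong_neutral)
    fix m assume "m \<in> {1..} - {1..M}"
    then have "{C \<in> CC. card C = m} = {}" using le by force
    then show "of_nat (card {C \<in> CC. card C = m}) * (of_nat m :: complex) powr (- s) = 0"
      by (simp only: card.empty of_nat_0 mult_zero_left)
  qed auto
  also have "\<dots> = (\<Sum>m\<in>{1..M}. \<Sum>C\<in>{C \<in> CC. card C = m}. f (card C))" by simp
  also have "\<dots> = (\<Sum>C\<in>CC. f (card C))"
    by (rule sum.group[OF finCC]) (use pos le in auto)
  also have "\<dots> = (\<Sum>C\<in>CC. \<Sum>x\<in>C. of_nat (card (orbit G \<phi> x)) powr (- (1 + s)))"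
  proof (rule sum.cong[OF refl])
    fix c assume c: "c \<in> CC"
    have "(\<Sum>x\<in>c. of_nat (card (orbit G \<phi> x)) powr (- (1 + s)))
        = (\<Sum>x\<in>c. of_nat (card c) powr (- (1 + s)))"
      using orbC[OF c] by (intro sum.cong) auto
    also have "\<dots> = of_nat (card c) * of_nat (card c) powr (- (1 + s))" by simp
    also have "\<dots> = f (card c)"
    proof -
      have "(of_nat (card c) :: complex) \<noteq> 0" using pos[OF c] by simp
      then have "of_nat (card c) powr (- s - 1) = of_nat (card c) powr (- s) / (of_nat (card c) :: complex)"
        using powr_diff[of "of_nat (card c)" "- s" 1] by simp
      moreover have "- (1 + s) = - s - 1" by simp
      ultimately have "of_nat (card c) powr (- (1 + s)) = of_nat (card c) powr (- s) / (of_nat (card c) :: complex)"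
        by (simp only:)
      then show ?thesis unfolding f_def using pos[OF c] by simp
    qed
    finally show "f (card c) = (\<Sum>x\<in>c. of_nat (card (orbit G \<phi> x)) powr (- (1 + s)))" by simp
  qed
  also have "\<dots> = (\<Sum>x\<in>carrier G. of_nat (card (orbit G \<phi> x)) powr (- (1 + s)))"
    unfolding CC_def by (rule act.disjoint_sum[OF fin])
  also have "\<dots> = (\<Sum>x\<in>carrier G. of_nat (card ((\<lambda>h. h \<otimes> x \<otimes> inv h) ` carrier G)) powr (- (1 + s)))"
    using orb by (intro sum.cong) auto
  finally show ?thesis .
qed

text \<open>Sums out the coordinates on which the summand does not depend; in the group these are
  the central ones.\<close>

lemma sum_PiE_restrict:
  fixes f :: "('i \<Rightarrow> 'b) \<Rightarrow> 'c::comm_semiring_1"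
  assumes "finite B" "Xs \<subseteq> B" "finite S"
  shows "(\<Sum>g\<in>B \<rightarrow>\<^sub>E S. f (restrict g Xs)) = of_nat (card S ^ card (B - Xs)) * (\<Sum>x\<in>Xs \<rightarrow>\<^sub>E S. f x)"
proof -
  have finX: "finite Xs" using assms finite_subset by blast
  have "(\<Sum>g\<in>B \<rightarrow>\<^sub>E S. f (restrict g Xs))
      = (\<Sum>x\<in>Xs \<rightarrow>\<^sub>E S. \<Sum>g\<in>{g \<in> B \<rightarrow>\<^sub>E S. restrict g Xs = x}. f (restrict g Xs))"
    by (rule sum.group[symmetric]) (use assms finX in \<open>auto intro!: finite_PiE\<close>)
  also have "\<dots> = (\<Sum>x\<in>Xs \<rightarrow>\<^sub>E S. of_nat (card S ^ card (B - Xs)) * f x)"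
  proof (rule sum.cong[OF refl])
    fix x assume x: "x \<in> Xs \<rightarrow>\<^sub>E S"
    have eq: "{g \<in> B \<rightarrow>\<^sub>E S. restrict g Xs = x} = PiE B (\<lambda>i. if i \<in> Xs then {x i} else S)"
    proof (intro equalityI subsetI)
      fix g assume "g \<in> PiE B (\<lambda>i. if i \<in> Xs then {x i} else S)"
      then have g: "\<And>i. i \<in> B \<Longrightarrow> g i \<in> (if i \<in> Xs then {x i} else S)" "g \<in> extensional B"
        by (auto simp: PiE_def Pi_def)
      have "g i \<in> S" if "i \<in> B" for i using g(1)[OF that] x by (auto split: if_splits)
      moreover have "restrict g Xs = x"
      proof
        fix i show "restrict g Xs i = x i"
          using g(1)[of i] assms(2) x by (cases "i \<in> Xs") (auto simp: PiE_def extensional_def)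
      qed
      ultimately show "g \<in> {g \<in> B \<rightarrow>\<^sub>E S. restrict g Xs = x}" using g(2) by (auto simp: PiE_def)
    next
      fix g assume "g \<in> {g \<in> B \<rightarrow>\<^sub>E S. restrict g Xs = x}"
      then show "g \<in> PiE B (\<lambda>i. if i \<in> Xs then {x i} else S)"
        by (auto simp: PiE_def Pi_def)
    qed
    have "card {g \<in> B \<rightarrow>\<^sub>E S. restrict g Xs = x} = (\<Prod>i\<in>B. card (if i \<in> Xs then {x i} else S))"
      unfolding eq using card_PiE[OF assms(1)] .
    also have "\<dots> = (\<Prod>i\<in>B - Xs. card S) * (\<Prod>i\<in>Xs. 1)"
      by (subst prod.subset_diff[OF assms(2,1)]) (auto intro!: arg_cong2[of _ _ _ _ "(*)"] prod.cong)
    finally have card: "card {g \<in> B \<rightarrow>\<^sub>E S. restrict g Xs = x} = card S ^ card (B - Xs)" by simp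
    have "(\<Sum>g\<in>{g \<in> B \<rightarrow>\<^sub>E S. restrict g Xs = x}. f (restrict g Xs))
       = (\<Sum>g\<in>{g \<in> B \<rightarrow>\<^sub>E S. restrict g Xs = x}. f x)" by (rule sum.cong) auto
    then show "(\<Sum>g\<in>{g \<in> B \<rightarrow>\<^sub>E S. restrict g Xs = x}. f (restrict g Xs)) = of_nat (card S ^ card (B - Xs)) * f x"
      using card by simp
  qed
  finally show ?thesis by (simp add: sum_distrib_left)
qed

section \<open>The group of points of a lattice of class two and its conjugacy classes\<close>

locale class2_points = cring A for A (structure) +
  fixes \<Lambda> :: lie_lattice
  assumes finA: "finite (carrier A)" and finB: "finite (basis \<Lambda>)"
    and rel: "(u, v, w) \<in> relations \<Lambda> \<Longrightarrow> w \<in> range (\<lambda>(i, j). Gy i j)"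
begin

definition Xs where "Xs = basis \<Lambda> \<inter> range Gx"
definition Ys where "Ys = basis \<Lambda> - Xs"

lemma X_sub: "Xs \<subseteq> basis \<Lambda>" and finX: "finite Xs" and finY: "finite Ys"
  using finB by (auto simp: Xs_def Ys_def)

lemma beta_coeff_nonzero: "beta_coeff \<Lambda> u v w \<noteq> 0 \<Longrightarrow> u \<in> range Gx \<and> v \<in> range Gx"
  by (cases u; cases v) auto

lemma beta_coeff_X: "w \<in> Xs \<Longrightarrow> beta_coeff \<Lambda> u v w = 0"
proof -
  assume "w \<in> Xs"
  then have "(u, v, w) \<notin> relations \<Lambda>" for u v using rel[of u v w] by (auto simp: Xs_def)
  then show ?thesis by (cases u; cases v) (simp_all add: bracket_coeff_def)
qed

lemma finsum_split:
  assumes "\<And>u. u \<in> B \<Longrightarrow> k u = f u \<oplus> g u" "f \<in> B \<rightarrow> carrier A" "g \<in> B \<rightarrow> carrier A"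
  shows "finsum A k B = finsum A f B \<oplus> finsum A g B"
proof -
  have "finsum A k B = finsum A (\<lambda>u. f u \<oplus> g u) B"
    by (rule add.finprod_cong') (use assms in auto)
  then show ?thesis using add.finprod_multf[OF assms(2,3)] by simp
qed

text \<open>Only the values on \<open>Xs\<close> are constrained because \<open>beta\<close> depends
  on nothing else. Its laws thereby apply to group elements as well as to their restrictions to
  \<open>Xs\<close>, which are \<open>undefined\<close> elsewhere.\<close>

definition V where "V = Xs \<rightarrow> carrier A"

lemma V_memD: "g \<in> V \<Longrightarrow> u \<in> Xs \<Longrightarrow> g u \<in> carrier A" by (auto simp: V_def)

text \<open>Stated for arbitrary x so as to cover the values of members of \<open>V\<close> outside
  \<open>Xs\<close>, which may lie outside the carrier.\<close>

lemma zero_smult: "[(0::int)] \<cdot>\<^bsub>A\<^esub> x = \<zero>" by (simp add: add_pow_def)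

lemma int_smult_add: "x \<in> carrier A \<Longrightarrow> y \<in> carrier A \<Longrightarrow> [(k::int)] \<cdot>\<^bsub>A\<^esub> (x \<oplus> y) = [k] \<cdot>\<^bsub>A\<^esub> x \<oplus> [k] \<cdot>\<^bsub>A\<^esub> y"
  by (rule add.int_pow_distrib)

lemma term_cases:
  assumes "u \<in> basis \<Lambda>" "v \<in> basis \<Lambda>"
  obtains "beta_coeff \<Lambda> u v w = 0" | "u \<in> Xs" "v \<in> Xs"
  using beta_coeff_nonzero assms unfolding Xs_def by blast

lemma term_closed:
  assumes "g \<in> V" "h \<in> V" "u \<in> basis \<Lambda>" "v \<in> basis \<Lambda>"
  shows "[beta_coeff \<Lambda> u v w] \<cdot>\<^bsub>A\<^esub> (g u \<otimes> h v) \<in> carrier A"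
  by (rule term_cases[OF assms(3,4), of w])
    (use assms V_memD in \<open>auto simp: zero_smult\<close>)

lemma inner_closed:
  assumes "g \<in> V" "h \<in> V" "u \<in> basis \<Lambda>"
  shows "(\<Oplus>v\<in>basis \<Lambda>. [beta_coeff \<Lambda> u v w] \<cdot>\<^bsub>A\<^esub> (g u \<otimes> h v)) \<in> carrier A"
  by (rule finsum_closed) (use term_closed[OF assms] in auto)

lemma beta_closed: "g \<in> V \<Longrightarrow> h \<in> V \<Longrightarrow> beta \<Lambda> A g h w \<in> carrier A"
  unfolding beta_def by (rule finsum_closed) (use inner_closed in auto)

lemma beta_cong2:
  assumes "\<And>u v. u \<in> basis \<Lambda> \<Longrightarrow> v \<in> basis \<Lambda> \<Longrightarrow>
      [beta_coeff \<Lambda> u v w] \<cdot>\<^bsub>A\<^esub> (g u \<otimes> h v) = [beta_coeff \<Lambda> u v w] \<cdot>\<^bsub>A\<^esub> (g' u \<otimes> h' v)"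
    and "g' \<in> V" "h' \<in> V"
  shows "beta \<Lambda> A g h w = beta \<Lambda> A g' h' w"
  unfolding beta_def
proof (rule add.finprod_cong')
  show "(\<lambda>u. \<Oplus>v\<in>basis \<Lambda>. [beta_coeff \<Lambda> u v w] \<cdot>\<^bsub>A\<^esub> (g' u \<otimes> h' v)) \<in> basis \<Lambda> \<rightarrow> carrier A"
    using inner_closed assms by auto
  fix u assume u: "u \<in> basis \<Lambda>"
  show "(\<Oplus>v\<in>basis \<Lambda>. [beta_coeff \<Lambda> u v w] \<cdot>\<^bsub>A\<^esub> (g u \<otimes> h v)) = (\<Oplus>v\<in>basis \<Lambda>. [beta_coeff \<Lambda> u v w] \<cdot>\<^bsub>A\<^esub> (g' u \<otimes> h' v))"
    by (rule add.finprod_cong') (use assms term_closed u in auto)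
qed simp

lemma beta_cong:
  assumes "\<And>u. u \<in> Xs \<Longrightarrow> g u = g' u" "\<And>u. u \<in> Xs \<Longrightarrow> h u = h' u" "g' \<in> V" "h' \<in> V"
  shows "beta \<Lambda> A g h w = beta \<Lambda> A g' h' w"
proof (rule beta_cong2[OF _ assms(3,4)])
  fix u v assume uv: "u \<in> basis \<Lambda>" "v \<in> basis \<Lambda>"
  show "[beta_coeff \<Lambda> u v w] \<cdot>\<^bsub>A\<^esub> (g u \<otimes> h v) = [beta_coeff \<Lambda> u v w] \<cdot>\<^bsub>A\<^esub> (g' u \<otimes> h' v)"
    by (rule term_cases[OF uv, of w]) (simp_all add: zero_smult assms)
qed

lemma beta_X: assumes "w \<in> Xs" shows "beta \<Lambda> A g h w = \<zero>"
proof -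
  have inner: "(\<Oplus>v\<in>basis \<Lambda>. [beta_coeff \<Lambda> u v w] \<cdot>\<^bsub>A\<^esub> (g u \<otimes> h v)) = \<zero>" for u
    by (simp add: beta_coeff_X[OF assms] zero_smult)
  show ?thesis unfolding beta_def inner by simp
qed

lemma beta_add:
  assumes V: "g \<in> V" "g' \<in> V" "h \<in> V" and k: "\<And>u. u \<in> Xs \<Longrightarrow> k u = g u \<oplus> g' u"
  shows "beta \<Lambda> A k h w = beta \<Lambda> A g h w \<oplus> beta \<Lambda> A g' h w"
    and "beta \<Lambda> A h k w = beta \<Lambda> A h g w \<oplus> beta \<Lambda> A h g' w"
proof -
  have "k u \<in> carrier A" if "u \<in> Xs" for u
    using k[OF that] V_memD[OF V(1) that] V_memD[OF V(2) that] by simp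
  then have kV: "k \<in> V" by (simp add: V_def)
  have t1: "[beta_coeff \<Lambda> u v w] \<cdot>\<^bsub>A\<^esub> (k u \<otimes> h v)
      = [beta_coeff \<Lambda> u v w] \<cdot>\<^bsub>A\<^esub> (g u \<otimes> h v) \<oplus> [beta_coeff \<Lambda> u v w] \<cdot>\<^bsub>A\<^esub> (g' u \<otimes> h v)"
    if "u \<in> basis \<Lambda>" "v \<in> basis \<Lambda>" for u v
    by (rule term_cases[OF that, of w])
      (use V_memD V in \<open>auto simp: zero_smult k l_distr int_smult_add\<close>)
  have i1: "(\<Oplus>v\<in>basis \<Lambda>. [beta_coeff \<Lambda> u v w] \<cdot>\<^bsub>A\<^esub> (k u \<otimes> h v))
      = (\<Oplus>v\<in>basis \<Lambda>. [beta_coeff \<Lambda> u v w] \<cdot>\<^bsub>A\<^esub> (g u \<otimes> h v)) \<oplus> (\<Oplus>v\<in>basis \<Lambda>. [beta_coeff \<Lambda> u v w] \<cdot>\<^bsub>A\<^esub> (g' u \<otimes> h v))"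
    if u: "u \<in> basis \<Lambda>" for u
    by (rule finsum_split) (use term_closed V u in \<open>auto simp: t1\<close>)
  show "beta \<Lambda> A k h w = beta \<Lambda> A g h w \<oplus> beta \<Lambda> A g' h w"
    unfolding beta_def
    by (rule finsum_split) (use inner_closed V in \<open>auto simp: i1\<close>)
  have t2: "[beta_coeff \<Lambda> u v w] \<cdot>\<^bsub>A\<^esub> (h u \<otimes> k v)
      = [beta_coeff \<Lambda> u v w] \<cdot>\<^bsub>A\<^esub> (h u \<otimes> g v) \<oplus> [beta_coeff \<Lambda> u v w] \<cdot>\<^bsub>A\<^esub> (h u \<otimes> g' v)"
    if "u \<in> basis \<Lambda>" "v \<in> basis \<Lambda>" for u v
    by (rule term_cases[OF that, of w])
      (use V_memD V in \<open>auto simp: zero_smult k r_distr int_smult_add\<close>)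
  have i2: "(\<Oplus>v\<in>basis \<Lambda>. [beta_coeff \<Lambda> u v w] \<cdot>\<^bsub>A\<^esub> (h u \<otimes> k v))
      = (\<Oplus>v\<in>basis \<Lambda>. [beta_coeff \<Lambda> u v w] \<cdot>\<^bsub>A\<^esub> (h u \<otimes> g v)) \<oplus> (\<Oplus>v\<in>basis \<Lambda>. [beta_coeff \<Lambda> u v w] \<cdot>\<^bsub>A\<^esub> (h u \<otimes> g' v))"
    if u: "u \<in> basis \<Lambda>" for u
    by (rule finsum_split) (use term_closed V u in \<open>auto simp: t2\<close>)
  show "beta \<Lambda> A h k w = beta \<Lambda> A h g w \<oplus> beta \<Lambda> A h g' w"
    unfolding beta_def
    by (rule finsum_split) (use inner_closed V in \<open>auto simp: i2\<close>)
qed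

abbreviation G where "G \<equiv> group_points \<Lambda> A"

lemma carrier_G: "carrier G = basis \<Lambda> \<rightarrow>\<^sub>E carrier A" by (simp add: group_points_def)

lemma G_V: "g \<in> carrier G \<Longrightarrow> g \<in> V" using X_sub by (auto simp: carrier_G V_def PiE_def Pi_def)

lemma G_mem: "g \<in> carrier G \<Longrightarrow> w \<in> basis \<Lambda> \<Longrightarrow> g w \<in> carrier A" by (auto simp: carrier_G)

lemma mult_G: "w \<in> basis \<Lambda> \<Longrightarrow> (g \<otimes>\<^bsub>G\<^esub> h) w = g w \<oplus> h w \<oplus> beta \<Lambda> A g h w"
  by (simp add: group_points_def)

lemma mult_G_X: "g \<in> carrier G \<Longrightarrow> h \<in> carrier G \<Longrightarrow> w \<in> Xs \<Longrightarrow> (g \<otimes>\<^bsub>G\<^esub> h) w = g w \<oplus> h w"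
  using X_sub G_mem by (auto simp: mult_G beta_X subset_iff)

lemma mult_G_closed: "g \<in> carrier G \<Longrightarrow> h \<in> carrier G \<Longrightarrow> g \<otimes>\<^bsub>G\<^esub> h \<in> carrier G"
  using beta_closed[OF G_V G_V] G_mem by (auto simp: group_points_def)

lemma G_eqI: "g \<in> carrier G \<Longrightarrow> h \<in> carrier G \<Longrightarrow> (\<And>w. w \<in> basis \<Lambda> \<Longrightarrow> g w = h w) \<Longrightarrow> g = h"
  unfolding carrier_G by (rule PiE_ext)

lemma minus_V: "g \<in> V \<Longrightarrow> (\<lambda>u. \<ominus> g u) \<in> V" by (auto simp: V_def)

lemma beta_minus:
  assumes "g \<in> V" "h \<in> V"
  shows "beta \<Lambda> A (\<lambda>u. \<ominus> g u) h w = \<ominus> beta \<Lambda> A g h w"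
proof -
  have z: "(\<lambda>_. \<zero>) \<in> V" by (simp add: V_def)
  have "beta \<Lambda> A (\<lambda>_. \<zero>) h w = beta \<Lambda> A (\<lambda>_. \<zero>) h w \<oplus> beta \<Lambda> A (\<lambda>_. \<zero>) h w"
    by (rule beta_add(1)[OF z z assms(2)]) simp
  then have z0: "beta \<Lambda> A (\<lambda>_. \<zero>) h w = \<zero>" using beta_closed[OF z assms(2), of w] by simp
  have "beta \<Lambda> A (\<lambda>_. \<zero>) h w = beta \<Lambda> A (\<lambda>u. \<ominus> g u) h w \<oplus> beta \<Lambda> A g h w"
    by (rule beta_add(1)[OF minus_V[OF assms(1)] assms]) (use V_memD[OF assms(1)] in \<open>simp add: l_neg\<close>)
  then show ?thesis using z0 beta_closed[OF assms, of w] beta_closed[OF minus_V[OF assms(1)] assms(2), of w]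
    using minus_equality by metis
qed

text \<open>Associativity holds because \<open>beta\<close> is biadditive, sees only the coordinates
  in \<open>Xs\<close> and takes values outside them: both bracketings of x, y, z add the three
  terms for the pairs (x, y), (x, z), (y, z).\<close>

lemma group_G: "group G"
proof (rule groupI)
  show "\<one>\<^bsub>G\<^esub> \<in> carrier G" by (auto simp: group_points_def)
  fix x assume x: "x \<in> carrier G"
  have z: "(\<lambda>_. \<zero>) \<in> V" by (simp add: V_def)
  have dbl: "beta \<Lambda> A (\<lambda>_. \<zero>) x w = beta \<Lambda> A (\<lambda>_. \<zero>) x w \<oplus> beta \<Lambda> A (\<lambda>_. \<zero>) x w" for w
    by (rule beta_add(1)[OF z z G_V[OF x]]) simp
  have "beta \<Lambda> A (\<lambda>_. \<zero>) x w = \<zero>" for w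
    using dbl[of w] beta_closed[OF z G_V[OF x], of w] by simp
  moreover have "beta \<Lambda> A \<one>\<^bsub>G\<^esub> x w = beta \<Lambda> A (\<lambda>_. \<zero>) x w" for w
    by (rule beta_cong) (use z G_V[OF x] X_sub in \<open>auto simp: group_points_def\<close>)
  ultimately have z0: "beta \<Lambda> A \<one>\<^bsub>G\<^esub> x w = \<zero>" for w by simp
  have one: "w \<in> basis \<Lambda> \<Longrightarrow> \<one>\<^bsub>G\<^esub> w = \<zero>" for w by (simp add: group_points_def)
  show l_one: "\<one>\<^bsub>G\<^esub> \<otimes>\<^bsub>G\<^esub> x = x"
    by (rule G_eqI[OF mult_G_closed[OF \<open>\<one>\<^bsub>G\<^esub> \<in> carrier G\<close> x] x]) (use G_mem[OF x] in \<open>simp add: mult_G z0 one\<close>)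
  \<comment> \<open>The negative of x is not yet an inverse: multiplying it with x leaves the term
    -\<beta>(x, x), which the correction cancels.\<close>
  define y where "y = (\<lambda>w\<in>basis \<Lambda>. \<ominus> x w \<oplus> beta \<Lambda> A x x w)"
  have y: "y \<in> carrier G" unfolding y_def carrier_G using G_mem[OF x] beta_closed[OF G_V[OF x] G_V[OF x]] by auto
  have yX: "y u = \<ominus> x u" if "u \<in> Xs" for u
    using that X_sub G_mem[OF x] by (auto simp: y_def beta_X)
  have byx: "beta \<Lambda> A y x w = \<ominus> beta \<Lambda> A x x w" for w
    using beta_cong[of y "\<lambda>u. \<ominus> x u" x x] yX minus_V[OF G_V[OF x]] G_V[OF x] beta_minus[OF G_V[OF x] G_V[OF x]] by auto
  have "y \<otimes>\<^bsub>G\<^esub> x = \<one>\<^bsub>G\<^esub>"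
  proof (rule G_eqI[OF mult_G_closed[OF y x] \<open>\<one>\<^bsub>G\<^esub> \<in> carrier G\<close>])
    fix w assume w: "w \<in> basis \<Lambda>"
    define a where "a = x w"
    define b where "b = beta \<Lambda> A x x w"
    have ab: "a \<in> carrier A" "b \<in> carrier A"
      unfolding a_def b_def using G_mem[OF x w] beta_closed[OF G_V[OF x] G_V[OF x]] by auto
    have "\<ominus> a \<oplus> b \<oplus> a \<oplus> \<ominus> b = \<zero>" using ab by algebra
    moreover have "y w = \<ominus> a \<oplus> b" using w by (simp add: y_def a_def b_def)
    ultimately show "(y \<otimes>\<^bsub>G\<^esub> x) w = \<one>\<^bsub>G\<^esub> w"
      using w one[OF w] by (simp add: mult_G byx a_def b_def)
  qed
  then show "\<exists>y\<in>carrier G. y \<otimes>\<^bsub>G\<^esub> x = \<one>\<^bsub>G\<^esub>" using y by blast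
next
  fix x y assume "x \<in> carrier G" "y \<in> carrier G"
  then show "x \<otimes>\<^bsub>G\<^esub> y \<in> carrier G" by (rule mult_G_closed)
next
  fix x y z assume c: "x \<in> carrier G" "y \<in> carrier G" "z \<in> carrier G"
  show "x \<otimes>\<^bsub>G\<^esub> y \<otimes>\<^bsub>G\<^esub> z = x \<otimes>\<^bsub>G\<^esub> (y \<otimes>\<^bsub>G\<^esub> z)"
  proof (rule G_eqI)
    show "x \<otimes>\<^bsub>G\<^esub> y \<otimes>\<^bsub>G\<^esub> z \<in> carrier G" "x \<otimes>\<^bsub>G\<^esub> (y \<otimes>\<^bsub>G\<^esub> z) \<in> carrier G"
      using c by (auto intro!: mult_G_closed)
    fix w assume w: "w \<in> basis \<Lambda>"
    define a where "a = x w"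
    define b where "b = y w"
    define d where "d = z w"
    define e where "e = beta \<Lambda> A x y w"
    define f where "f = beta \<Lambda> A x z w"
    define g where "g = beta \<Lambda> A y z w"
    have m: "a \<in> carrier A" "b \<in> carrier A" "d \<in> carrier A" "e \<in> carrier A" "f \<in> carrier A" "g \<in> carrier A"
      unfolding a_def b_def d_def e_def f_def g_def using G_mem w c beta_closed[OF G_V G_V] by auto
    have 1: "beta \<Lambda> A (x \<otimes>\<^bsub>G\<^esub> y) z w = f \<oplus> g"
      unfolding f_def g_def by (rule beta_add(1)[OF G_V G_V G_V]) (use c mult_G_X in auto)
    have 2: "beta \<Lambda> A x (y \<otimes>\<^bsub>G\<^esub> z) w = e \<oplus> f"
      unfolding f_def e_def by (rule beta_add(2)[OF G_V G_V G_V]) (use c mult_G_X in auto)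
    have "a \<oplus> b \<oplus> e \<oplus> d \<oplus> (f \<oplus> g) = a \<oplus> (b \<oplus> d \<oplus> g) \<oplus> (e \<oplus> f)"
      by (use m in algebra)
    then show "(x \<otimes>\<^bsub>G\<^esub> y \<otimes>\<^bsub>G\<^esub> z) w = (x \<otimes>\<^bsub>G\<^esub> (y \<otimes>\<^bsub>G\<^esub> z)) w"
      using w by (simp add: mult_G 1 2 a_def b_def d_def e_def f_def g_def)
  qed
qed

text \<open>The coordinates of the Lie bracket. As \<open>beta\<close> keeps the bracket of two
  basis elements only in one order, its antisymmetrization restores it in both.\<close>

definition lie where "lie g h w = beta \<Lambda> A g h w \<ominus> beta \<Lambda> A h g w"

text \<open>Checked in the form y h = h x, where no inverse has to be computed: conjugation by h
  adds the bracket of h and x.\<close>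

lemma conj_G:
  assumes x: "x \<in> carrier G" and h: "h \<in> carrier G"
  shows "h \<otimes>\<^bsub>G\<^esub> x \<otimes>\<^bsub>G\<^esub> inv\<^bsub>G\<^esub> h = (\<lambda>w\<in>basis \<Lambda>. x w \<oplus> lie h x w)"
proof -
  interpret G: group G by (rule group_G)
  define y where "y = (\<lambda>w\<in>basis \<Lambda>. x w \<oplus> lie h x w)"
  note b = beta_closed[OF G_V[OF x] G_V[OF h]] beta_closed[OF G_V[OF h] G_V[OF x]]
  have y: "y \<in> carrier G" unfolding y_def carrier_G lie_def using G_mem[OF x] b by auto
  have yX: "y u = x u" if "u \<in> Xs" for u
    using that X_sub G_mem[OF x] by (auto simp: y_def lie_def beta_X a_minus_def)
  have byh: "beta \<Lambda> A y h w = beta \<Lambda> A x h w" for w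
    by (rule beta_cong) (use yX G_V x h in auto)
  have "y \<otimes>\<^bsub>G\<^esub> h = h \<otimes>\<^bsub>G\<^esub> x"
  proof (rule G_eqI[OF mult_G_closed[OF y h] mult_G_closed[OF h x]])
    fix w assume w: "w \<in> basis \<Lambda>"
    define a where "a = x w"
    define c where "c = h w"
    define d where "d = beta \<Lambda> A h x w"
    define e where "e = beta \<Lambda> A x h w"
    have m: "a \<in> carrier A" "c \<in> carrier A" "d \<in> carrier A" "e \<in> carrier A"
      unfolding a_def c_def d_def e_def using G_mem w x h b by auto
    have "a \<oplus> (d \<ominus> e) \<oplus> c \<oplus> e = c \<oplus> a \<oplus> d"
      by (use m in algebra)
    then show "(y \<otimes>\<^bsub>G\<^esub> h) w = (h \<otimes>\<^bsub>G\<^esub> x) w"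
      using w by (simp add: mult_G byh) (simp add: y_def lie_def a_def c_def d_def e_def)
  qed
  then have "h \<otimes>\<^bsub>G\<^esub> x \<otimes>\<^bsub>G\<^esub> inv\<^bsub>G\<^esub> h = y \<otimes>\<^bsub>G\<^esub> h \<otimes>\<^bsub>G\<^esub> inv\<^bsub>G\<^esub> h" by simp
  also have "\<dots> = y" using y h by (simp add: G.m_assoc G.r_inv)
  finally show ?thesis unfolding y_def .
qed

text \<open>The \<open>Xs\<close>-coordinates of the centralizer of x. Only the coordinates in
  \<open>Ys\<close> impose conditions, since a bracket vanishes on \<open>Xs\<close>.\<close>

definition Ker where "Ker x = {z \<in> Xs \<rightarrow>\<^sub>E carrier A. \<forall>w\<in>Ys. lie z x w = \<zero>}"

lemma lie_X: "w \<in> Xs \<Longrightarrow> lie g h w = \<zero>" by (simp add: lie_def beta_X a_minus_def)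

lemma lie_closed: "g \<in> V \<Longrightarrow> h \<in> V \<Longrightarrow> lie g h w \<in> carrier A"
  unfolding lie_def using beta_closed by simp

lemma lie_add:
  assumes V: "g \<in> V" "g' \<in> V" "h \<in> V" and k: "\<And>u. u \<in> Xs \<Longrightarrow> k u = g u \<oplus> g' u"
  shows "lie k h w = lie g h w \<oplus> lie g' h w"
proof -
  define a where "a = beta \<Lambda> A g h w"
  define b where "b = beta \<Lambda> A g' h w"
  define c where "c = beta \<Lambda> A h g w"
  define d where "d = beta \<Lambda> A h g' w"
  have m: "a \<in> carrier A" "b \<in> carrier A" "c \<in> carrier A" "d \<in> carrier A"
    unfolding a_def b_def c_def d_def using beta_closed V by auto
  have "(a \<oplus> b) \<ominus> (c \<oplus> d) = (a \<ominus> c) \<oplus> (b \<ominus> d)"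
    by (use m in algebra)
  moreover have "beta \<Lambda> A k h w = a \<oplus> b" unfolding a_def b_def by (rule beta_add(1)[OF V k])
  moreover have "beta \<Lambda> A h k w = c \<oplus> d" unfolding c_def d_def by (rule beta_add(2)[OF V k])
  ultimately show ?thesis unfolding lie_def by (simp only: a_def b_def c_def d_def)
qed

lemma lie_cong:
  assumes "\<And>u. u \<in> Xs \<Longrightarrow> g u = g' u" "\<And>u. u \<in> Xs \<Longrightarrow> h u = h' u" "g' \<in> V" "h' \<in> V"
  shows "lie g h w = lie g' h' w"
  unfolding lie_def using beta_cong[OF assms] beta_cong[OF assms(2,1,4,3)] by simp

lemma XE_V: "z \<in> Xs \<rightarrow>\<^sub>E carrier A \<Longrightarrow> z \<in> V" by (auto simp: V_def)

lemma restrict_V: "g \<in> V \<Longrightarrow> restrict g Xs \<in> Xs \<rightarrow>\<^sub>E carrier A" by (auto simp: V_def)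

text \<open>An additive form of the orbit-stabilizer theorem: the class of x is the image of z
  \<mapsto> x + [z, x], and the fibres of this map are translates of the kernel of the bracket with
  x.\<close>

lemma card_class:
  assumes x: "x \<in> carrier G"
  shows "card (carrier A) ^ card Xs
    = card ((\<lambda>h. h \<otimes>\<^bsub>G\<^esub> x \<otimes>\<^bsub>G\<^esub> inv\<^bsub>G\<^esub> h) ` carrier G) * card (Ker (restrict x Xs))"
proof -
  let ?S = "Xs \<rightarrow>\<^sub>E carrier A"
  define f where "f z = (\<lambda>w\<in>basis \<Lambda>. x w \<oplus> lie z x w)" for z
  have xV: "x \<in> V" using G_V x .
  have f_restrict: "f g = f (restrict g Xs)" if "g \<in> V" for g
    unfolding f_def using lie_cong[of g "restrict g Xs" x x] XE_V[OF restrict_V[OF that]] xV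
    by (auto intro!: restrict_ext)
  have "(\<lambda>h. h \<otimes>\<^bsub>G\<^esub> x \<otimes>\<^bsub>G\<^esub> inv\<^bsub>G\<^esub> h) ` carrier G = f ` carrier G"
    using conj_G[OF x] unfolding f_def by auto
  also have "\<dots> = f ` ?S"
  proof (intro equalityI subsetI)
    fix y assume "y \<in> f ` carrier G"
    then show "y \<in> f ` ?S" using f_restrict G_V restrict_V by blast
  next
    fix y assume "y \<in> f ` ?S"
    then obtain z where z: "z \<in> ?S" "y = f z" by blast
    \<comment> \<open>Extension by zero central coordinates; conjugation does not depend on how they
      are chosen.\<close>
    define g where "g = (\<lambda>w\<in>basis \<Lambda>. if w \<in> Xs then z w else \<zero>)"
    have g: "g \<in> carrier G" unfolding g_def carrier_G using z by auto
    have "restrict g Xs = z" using z X_sub unfolding g_def by (auto simp: fun_eq_iff PiE_def extensional_def)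
    then have "y = f g" using f_restrict[OF G_V[OF g]] z by simp
    then show "y \<in> f ` carrier G" using g by blast
  qed
  finally have img: "(\<lambda>h. h \<otimes>\<^bsub>G\<^esub> x \<otimes>\<^bsub>G\<^esub> inv\<^bsub>G\<^esub> h) ` carrier G = f ` ?S" .
  have fin: "finite ?S" using finX finA by (intro finite_PiE) auto
  have KerX: "lie z (restrict x Xs) w = lie z x w" if "z \<in> V" for z w
    by (rule lie_cong) (use that xV in auto)
  have "card {z \<in> ?S. f z = y} = card (Ker (restrict x Xs))" if y: "y \<in> f ` ?S" for y
  proof -
    obtain z0 where z0: "z0 \<in> ?S" "y = f z0" using y by blast
    have z0V: "z0 \<in> V" using XE_V z0 by blast
    have eq: "f z = y \<longleftrightarrow> (\<forall>w\<in>Ys. lie z x w = lie z0 x w)" if "z \<in> V" for z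
    proof -
      have c: "lie z x w \<in> carrier A" "lie z0 x w \<in> carrier A" for w using lie_closed that z0V xV by auto
      have "f z = y \<longleftrightarrow> (\<forall>w\<in>basis \<Lambda>. x w \<oplus> lie z x w = x w \<oplus> lie z0 x w)"
        unfolding z0(2) f_def by (auto simp: fun_eq_iff restrict_def)
      also have "\<dots> \<longleftrightarrow> (\<forall>w\<in>basis \<Lambda>. lie z x w = lie z0 x w)" using G_mem[OF x] c by auto
      also have "\<dots> \<longleftrightarrow> (\<forall>w\<in>Ys. lie z x w = lie z0 x w)" using lie_X unfolding Ys_def by auto
      finally show ?thesis .
    qed
    have "bij_betw (\<lambda>z. \<lambda>u\<in>Xs. z u \<ominus> z0 u) {z \<in> ?S. f z = y} (Ker (restrict x Xs))"
    proof (rule bij_betw_byWitness[where f' = "\<lambda>z. \<lambda>u\<in>Xs. z u \<oplus> z0 u"])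
      have c: "a \<ominus> b \<oplus> b = a" "a \<oplus> b \<ominus> b = a" if "a \<in> carrier A" "b \<in> carrier A" for a b
        using that by (simp_all add: a_minus_def a_assoc l_neg r_neg)
      have ext: "(\<lambda>u\<in>Xs. g u) = g" if "g \<in> ?S" for g using that by (auto simp: fun_eq_iff PiE_def extensional_def)
      have mem: "g u \<in> carrier A" if "g \<in> ?S" "u \<in> Xs" for g u using that by auto
      show "\<forall>a\<in>{z \<in> ?S. f z = y}. (\<lambda>u\<in>Xs. (\<lambda>u\<in>Xs. a u \<ominus> z0 u) u \<oplus> z0 u) = a"
      proof
        fix a assume "a \<in> {z \<in> ?S. f z = y}"
        then have a: "a \<in> ?S" by simp
        have "(\<lambda>u\<in>Xs. (\<lambda>u\<in>Xs. a u \<ominus> z0 u) u \<oplus> z0 u) = (\<lambda>u\<in>Xs. a u)"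
          by (rule restrict_ext) (simp add: c(1)[OF mem[OF a] mem[OF z0(1)]])
        then show "(\<lambda>u\<in>Xs. (\<lambda>u\<in>Xs. a u \<ominus> z0 u) u \<oplus> z0 u) = a" using ext[OF a] by simp
      qed
      show "\<forall>a\<in>Ker (restrict x Xs). (\<lambda>u\<in>Xs. (\<lambda>u\<in>Xs. a u \<oplus> z0 u) u \<ominus> z0 u) = a"
      proof
        fix a assume "a \<in> Ker (restrict x Xs)"
        then have a: "a \<in> ?S" by (simp add: Ker_def)
        have "(\<lambda>u\<in>Xs. (\<lambda>u\<in>Xs. a u \<oplus> z0 u) u \<ominus> z0 u) = (\<lambda>u\<in>Xs. a u)"
          by (rule restrict_ext) (simp add: c(2)[OF mem[OF a] mem[OF z0(1)]])
        then show "(\<lambda>u\<in>Xs. (\<lambda>u\<in>Xs. a u \<oplus> z0 u) u \<ominus> z0 u) = a" using ext[OF a] by simp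
      qed
      show "(\<lambda>z. \<lambda>u\<in>Xs. z u \<ominus> z0 u) ` {z \<in> ?S. f z = y} \<subseteq> Ker (restrict x Xs)"
      proof (rule image_subsetI)
        fix z assume z: "z \<in> {z \<in> ?S. f z = y}"
        then have zS: "z \<in> ?S" by simp
        have dS: "(\<lambda>u\<in>Xs. z u \<ominus> z0 u) \<in> ?S" using mem[OF zS] mem[OF z0(1)] by auto
        have "lie (\<lambda>u\<in>Xs. z u \<ominus> z0 u) x w = \<zero>" if w: "w \<in> Ys" for w
        proof -
          have "lie z x w = lie (\<lambda>u\<in>Xs. z u \<ominus> z0 u) x w \<oplus> lie z0 x w"
            by (rule lie_add[OF XE_V[OF dS] z0V xV]) (simp add: c(1)[OF mem[OF zS] mem[OF z0(1)]])
          moreover have "lie z x w = lie z0 x w" using eq[OF XE_V[OF zS]] z w by blast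
          ultimately show ?thesis
            using lie_closed[OF XE_V[OF dS] xV, of w] lie_closed[OF z0V xV, of w] by simp
        qed
        then show "(\<lambda>u\<in>Xs. z u \<ominus> z0 u) \<in> Ker (restrict x Xs)"
          unfolding Ker_def using dS KerX[OF XE_V[OF dS]] by simp
      qed
      show "(\<lambda>z. \<lambda>u\<in>Xs. z u \<oplus> z0 u) ` Ker (restrict x Xs) \<subseteq> {z \<in> ?S. f z = y}"
      proof (rule image_subsetI)
        fix z assume z: "z \<in> Ker (restrict x Xs)"
        then have zS: "z \<in> ?S" by (simp add: Ker_def)
        have dS: "(\<lambda>u\<in>Xs. z u \<oplus> z0 u) \<in> ?S" using mem[OF zS] mem[OF z0(1)] by auto
        have "lie (\<lambda>u\<in>Xs. z u \<oplus> z0 u) x w = lie z0 x w" if w: "w \<in> Ys" for w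
        proof -
          have "lie (\<lambda>u\<in>Xs. z u \<oplus> z0 u) x w = lie z x w \<oplus> lie z0 x w"
            by (rule lie_add[OF XE_V[OF zS] z0V xV]) simp
          moreover have "lie z x w = \<zero>" using KerX[OF XE_V[OF zS]] z w by (simp add: Ker_def)
          ultimately show ?thesis using lie_closed[OF z0V xV, of w] by simp
        qed
        then show "(\<lambda>u\<in>Xs. z u \<oplus> z0 u) \<in> {z \<in> ?S. f z = y}" using dS eq[OF XE_V[OF dS]] by simp
      qed
    qed
    then show ?thesis by (rule bij_betw_same_card)
  qed
  then have "card ?S = card (f ` ?S) * card (Ker (restrict x Xs))"
    by (rule card_by_fibres[OF fin])
  moreover have "card ?S = card (carrier A) ^ card Xs" by (simp add: card_PiE finX)
  ultimately show ?thesis unfolding img by simp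
qed

text \<open>The class size is written as a real quotient, so no divisibility has to be carried
  along. The factor in front counts the central coordinates, which influence no class size.\<close>

theorem zeta_cc_class2:
  "zeta_cc G s = of_nat (card (carrier A) ^ card Ys) *
     (\<Sum>x\<in>Xs \<rightarrow>\<^sub>E carrier A. of_real (real (card (carrier A) ^ card Xs) / real (card (Ker x))) powr (- (1 + s)))"
proof -
  interpret G: group G by (rule group_G)
  have finG: "finite (carrier G)" unfolding carrier_G using finB finA by (intro finite_PiE) auto
  have "zeta_cc G s = (\<Sum>x\<in>carrier G. of_nat (card ((\<lambda>h. h \<otimes>\<^bsub>G\<^esub> x \<otimes>\<^bsub>G\<^esub> inv\<^bsub>G\<^esub> h) ` carrier G)) powr (- (1 + s)))"
    by (rule G.zeta_cc_eq_sum[OF finG])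
  also have "\<dots> = (\<Sum>x\<in>carrier G. of_real (real (card (carrier A) ^ card Xs) / real (card (Ker (restrict x Xs)))) powr (- (1 + s)))"
  proof (rule sum.cong[OF refl])
    fix x assume x: "x \<in> carrier G"
    define c where "c = card ((\<lambda>h. h \<otimes>\<^bsub>G\<^esub> x \<otimes>\<^bsub>G\<^esub> inv\<^bsub>G\<^esub> h) ` carrier G)"
    have "card (carrier A) ^ card Xs = c * card (Ker (restrict x Xs))" unfolding c_def by (rule card_class[OF x])
    moreover have "card (carrier A) \<noteq> 0" using finA zero_closed by (auto simp: card_eq_0_iff)
    then have "card (carrier A) ^ card Xs \<noteq> 0" by simp
    ultimately have "real (card (carrier A) ^ card Xs) / real (card (Ker (restrict x Xs))) = real c" by auto
    then show "of_nat (card ((\<lambda>h. h \<otimes>\<^bsub>G\<^esub> x \<otimes>\<^bsub>G\<^esub> inv\<^bsub>G\<^esub> h) ` carrier G)) powr (- (1 + s)) =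
      of_real (real (card (carrier A) ^ card Xs) / real (card (Ker (restrict x Xs)))) powr (- (1 + s))"
      unfolding c_def[symmetric] by simp
  qed
  also have "\<dots> = of_nat (card (carrier A) ^ card Ys) *
     (\<Sum>x\<in>Xs \<rightarrow>\<^sub>E carrier A. of_real (real (card (carrier A) ^ card Xs) / real (card (Ker x))) powr (- (1 + s)))"
    unfolding carrier_G Ys_def by (rule sum_PiE_restrict[OF finB X_sub finA])
  finally show ?thesis .
qed

end

section \<open>Vectors over a finite chain ring\<close>

context chain_ring
begin

definition I :: "nat \<Rightarrow> 'a set" where "I k = (\<lambda>x. \<pi> [^] k \<otimes> x) ` carrier A"

lemma pow_carr: "\<pi> [^] (k::nat) \<in> carrier A" using pi_carr by simp

lemma card_I: "k \<le> N \<Longrightarrow> card (I k) = q ^ (N - k)" unfolding I_def by (rule card_pow)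

lemma I_sub: "I k \<subseteq> carrier A" unfolding I_def using pow_carr by auto

lemma fin_I: "finite (I k)" using finite_subset[OF I_sub fin] .

lemma I_0: "I 0 = carrier A" unfolding I_def by simp

lemma card_carrier: "card (carrier A) = q ^ N" using card_I[of 0] I_0 by simp

lemma I_mult: "x \<in> I k \<Longrightarrow> y \<in> carrier A \<Longrightarrow> x \<otimes> y \<in> I k"
  unfolding I_def using pow_carr by (auto simp: m_assoc intro!: imageI)

lemma I_memI: "x \<in> carrier A \<Longrightarrow> \<pi> [^] k \<otimes> x \<in> I k" unfolding I_def by blast

lemma I_memE: assumes "x \<in> I k" obtains y where "y \<in> carrier A" "x = \<pi> [^] k \<otimes> y"
  using assms unfolding I_def by blast

lemma I_zero: "\<zero> \<in> I k" using I_memI[OF zero_closed, of k] pow_carr by simp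

lemma I_add: assumes "x \<in> I k" "y \<in> I k" shows "x \<oplus> y \<in> I k"
proof -
  obtain x' y' where c: "x' \<in> carrier A" "x = \<pi> [^] k \<otimes> x'" "y' \<in> carrier A" "y = \<pi> [^] k \<otimes> y'"
    using assms by (meson I_memE)
  then have "x \<oplus> y = \<pi> [^] k \<otimes> (x' \<oplus> y')" using pow_carr by (simp add: r_distr)
  then show ?thesis using I_memI c by simp
qed

lemma I_minus: assumes "x \<in> I k" "y \<in> I k" shows "x \<ominus> y \<in> I k"
proof -
  obtain x' y' where c: "x' \<in> carrier A" "x = \<pi> [^] k \<otimes> x'" "y' \<in> carrier A" "y = \<pi> [^] k \<otimes> y'"
    using assms by (meson I_memE)
  then have "x \<ominus> y = \<pi> [^] k \<otimes> (x' \<ominus> y')" using pow_carr by (simp add: a_minus_def r_distr r_minus)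
  then show ?thesis using I_memI c by simp
qed

lemma I_mono: assumes "j \<le> k" shows "I k \<subseteq> I j"
proof
  fix x assume "x \<in> I k"
  then obtain y where y: "y \<in> carrier A" "x = \<pi> [^] k \<otimes> y" by (rule I_memE)
  have "\<pi> [^] k = \<pi> [^] j \<otimes> \<pi> [^] (k - j)" using nat_pow_mult[OF pi_carr, of j "k - j"] assms by simp
  then have "x = \<pi> [^] j \<otimes> (\<pi> [^] (k - j) \<otimes> y)" using y pow_carr by (simp add: m_assoc)
  then show "x \<in> I j" using I_memI pow_carr y by simp
qed

lemma I_N: "I N = {\<zero>}"
  using card_I[of N] I_zero[of N] by (auto simp: card_1_singleton_iff)

definition Ann :: "nat \<Rightarrow> 'a set" where "Ann k = {x \<in> carrier A. \<pi> [^] k \<otimes> x = \<zero>}"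

lemma card_shifted_Ann:
  assumes s: "s \<in> carrier A"
  shows "card {y \<in> carrier A. \<pi> [^] k \<otimes> (y \<ominus> s) = \<zero>} = card (Ann k)"
proof (rule bij_betw_same_card)
  show "bij_betw (\<lambda>y. y \<ominus> s) {y \<in> carrier A. \<pi> [^] k \<otimes> (y \<ominus> s) = \<zero>} (Ann k)"
  proof (rule bij_betw_byWitness[where f' = "\<lambda>y. y \<oplus> s"])
    have 1: "y \<ominus> s \<oplus> s = y" "y \<oplus> s \<ominus> s = y" if "y \<in> carrier A" for y
      using that s by (simp_all add: a_minus_def a_assoc l_neg r_neg)
    show "\<forall>a\<in>{y \<in> carrier A. \<pi> [^] k \<otimes> (y \<ominus> s) = \<zero>}. a \<ominus> s \<oplus> s = a" using 1 by blast
    show "\<forall>a'\<in>Ann k. a' \<oplus> s \<ominus> s = a'" using 1 by (simp add: Ann_def)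
    show "(\<lambda>y. y \<ominus> s) ` {y \<in> carrier A. \<pi> [^] k \<otimes> (y \<ominus> s) = \<zero>} \<subseteq> Ann k" using s by (auto simp: Ann_def)
    show "(\<lambda>y. y \<oplus> s) ` Ann k \<subseteq> {y \<in> carrier A. \<pi> [^] k \<otimes> (y \<ominus> s) = \<zero>}"
      using s 1 by (auto simp: Ann_def)
  qed
qed

lemma card_Ann: assumes "k \<le> N" shows "card (Ann k) = q ^ k"
proof -
  have "card (carrier A) = card ((\<lambda>x. \<pi> [^] k \<otimes> x) ` carrier A) * card (Ann k)"
  proof (rule card_by_fibres[OF fin])
    fix y assume "y \<in> (\<lambda>x. \<pi> [^] k \<otimes> x) ` carrier A"
    then obtain s where s: "s \<in> carrier A" "y = \<pi> [^] k \<otimes> s" by blast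
    have "{x \<in> carrier A. \<pi> [^] k \<otimes> x = y} = {x \<in> carrier A. \<pi> [^] k \<otimes> (x \<ominus> s) = \<zero>}"
      using s pow_carr[of k] r_right_minus_eq[of "\<pi> [^] k \<otimes> x" "\<pi> [^] k \<otimes> s" for x]
      by (auto simp: a_minus_def r_distr r_minus)
    then show "card {x \<in> carrier A. \<pi> [^] k \<otimes> x = y} = card (Ann k)" using card_shifted_Ann[OF s(1)] by simp
  qed
  then have "q ^ (N - k) * q ^ k = q ^ (N - k) * card (Ann k)"
    using card_pow[OF assms] assms by (simp add: card_carrier flip: power_add)
  then show ?thesis using q by auto
qed

lemma card_shifted: "k \<le> N \<Longrightarrow> s \<in> carrier A \<Longrightarrow> card {y \<in> carrier A. \<pi> [^] k \<otimes> (y \<ominus> s) = \<zero>} = q ^ k"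
  using card_shifted_Ann card_Ann by simp

text \<open>\<open>decomp\<close> supplies some exponent j. A larger j than k would put x into
  \<open>I (Suc k)\<close>; a smaller one would put \<open>I j\<close> inside \<open>I k\<close>,
  which is impossible because the orders q^(N - j) strictly decrease with j.\<close>

lemma I_unit:
  assumes "k < N" "x \<in> I k" "x \<notin> I (Suc k)"
  shows "\<exists>u\<in>Units A. x = \<pi> [^] k \<otimes> u"
proof -
  have xc: "x \<in> carrier A" using assms(2) I_sub by blast
  obtain j u where ju: "j \<le> N" "u \<in> Units A" "x = \<pi> [^] j \<otimes> u" using decomp[OF xc] by blast
  have uc: "u \<in> carrier A" using ju by (simp add: Units_closed)
  have "j \<le> k"
  proof (rule ccontr)
    assume "\<not> j \<le> k"
    then have "I j \<subseteq> I (Suc k)" by (intro I_mono) simp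
    then show False using I_memI[OF uc, of j] ju assms(3) by blast
  qed
  moreover have "k \<le> j"
  proof (rule ccontr)
    assume "\<not> k \<le> j"
    then have jk: "j < k" by simp
    have "I j \<subseteq> I k"
    proof
      fix y assume "y \<in> I j"
      then obtain z where z: "z \<in> carrier A" "y = \<pi> [^] j \<otimes> z" by (rule I_memE)
      have "y = x \<otimes> (inv u \<otimes> z)"
      proof -
        have "x \<otimes> (inv u \<otimes> z) = \<pi> [^] j \<otimes> (u \<otimes> inv u) \<otimes> z"
          unfolding ju(3) using uc z Units_inv_closed[OF ju(2)] pow_carr by (simp add: m_assoc)
        then show ?thesis using Units_r_inv[OF ju(2)] z pow_carr by simp
      qed
      then show "y \<in> I k" using I_mult[OF assms(2)] Units_inv_closed[OF ju(2)] z by simp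
    qed
    then have "q ^ (N - j) \<le> q ^ (N - k)"
      using card_mono[OF fin_I] card_I[of j] card_I[of k] assms(1) ju(1) by (metis less_imp_le_nat)
    moreover have "q ^ (N - k) < q ^ (N - j)" using q jk assms(1) by (intro power_strict_increasing) auto
    ultimately show False by simp
  qed
  ultimately show ?thesis using ju by auto
qed

text \<open>The vectors whose entries have minimal valuation exactly k. The case distinction gives
  the zero vector the valuation N.\<close>

definition D :: "'i set \<Rightarrow> nat \<Rightarrow> ('i \<Rightarrow> 'a) set" where
  "D J k = (J \<rightarrow>\<^sub>E I k) - (if k < N then J \<rightarrow>\<^sub>E I (Suc k) else {})"

text \<open>Counts the vectors of n entries over a chain ring of length l that have at least one
  unit entry; dividing by \<pi>^k identifies vectors of valuation k with such vectors for l = N - k.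
  For l = 0 only the zero vector is left.\<close>

definition wt :: "nat \<Rightarrow> nat \<Rightarrow> complex" where
  "wt n l = (if l = 0 then 1 else of_nat q ^ (n * l) - of_nat q ^ (n * (l - 1)))"

lemma card_D: assumes "finite J" "k \<le> N" shows "of_nat (card (D J k)) = wt (card J) (N - k)"
proof (cases "k < N")
  case True
  have "J \<rightarrow>\<^sub>E I (Suc k) \<subseteq> J \<rightarrow>\<^sub>E I k" by (intro PiE_mono I_mono) simp
  moreover have "finite (J \<rightarrow>\<^sub>E I (Suc k))" by (intro finite_PiE assms fin_I)
  ultimately have "card (D J k) = card (J \<rightarrow>\<^sub>E I k) - card (J \<rightarrow>\<^sub>E I (Suc k))"
    and le: "card (J \<rightarrow>\<^sub>E I (Suc k)) \<le> card (J \<rightarrow>\<^sub>E I k)"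
    using True assms(1) fin_I by (auto simp: D_def card_Diff_subset intro!: card_mono finite_PiE)
  then have "of_nat (card (D J k)) = (of_nat (card (J \<rightarrow>\<^sub>E I k)) - of_nat (card (J \<rightarrow>\<^sub>E I (Suc k))) :: complex)"
    by (simp add: of_nat_diff)
  then show ?thesis using True assms card_I[of k] card_I[of "Suc k"]
    by (simp add: wt_def card_PiE power_mult[symmetric] mult.commute)
next
  case False
  then show ?thesis using assms card_I[of N] by (simp add: D_def wt_def card_PiE)
qed

lemma D_sub: "D J k \<subseteq> J \<rightarrow>\<^sub>E carrier A"
  unfolding D_def using I_sub by (auto intro: PiE_mono[THEN subsetD, rotated])

text \<open>The lower bound \<kappa> is 0 for a full sum. For \<H> the second vector runs only over
  multiples of \<pi>^l or \<pi>^(l+1), where l is the valuation of the first.\<close>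

lemma sum_D:
  assumes J: "finite J" and "\<kappa> \<le> N"
  shows "(\<Sum>v\<in>J \<rightarrow>\<^sub>E I \<kappa>. g v) = (\<Sum>k=\<kappa>..N. \<Sum>v\<in>D J k. (g v :: complex))"
  using assms(2)
proof (induction \<kappa> rule: inc_induct)
  case base
  show ?case by (simp add: D_def)
next
  case (step k)
  have sub: "J \<rightarrow>\<^sub>E I (Suc k) \<subseteq> J \<rightarrow>\<^sub>E I k" by (intro PiE_mono I_mono) simp
  have "(\<Sum>v\<in>J \<rightarrow>\<^sub>E I k. g v) = (\<Sum>v\<in>(J \<rightarrow>\<^sub>E I k) - (J \<rightarrow>\<^sub>E I (Suc k)). g v) + (\<Sum>v\<in>J \<rightarrow>\<^sub>E I (Suc k). g v)"
    by (rule sum.subset_diff[OF sub]) (intro finite_PiE J fin_I)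
  also have "(J \<rightarrow>\<^sub>E I k) - (J \<rightarrow>\<^sub>E I (Suc k)) = D J k" using step by (simp add: D_def)
  also have "(\<Sum>v\<in>D J k. g v) + (\<Sum>v\<in>J \<rightarrow>\<^sub>E I (Suc k). g v) = (\<Sum>k=k..N. \<Sum>v\<in>D J k. g v)"
    using step by (simp add: sum.atLeast_Suc_atMost)
  finally show ?case .
qed

lemma sum_D_const:
  assumes J: "finite J" and "\<kappa> \<le> N" and g: "\<And>k v. \<kappa> \<le> k \<Longrightarrow> k \<le> N \<Longrightarrow> v \<in> D J k \<Longrightarrow> g v = c k"
  shows "(\<Sum>v\<in>J \<rightarrow>\<^sub>E I \<kappa>. g v) = (\<Sum>k=\<kappa>..N. wt (card J) (N - k) * (c k :: complex))"
  unfolding sum_D[OF J assms(2)]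
proof (rule sum.cong[OF refl])
  fix k assume k: "k \<in> {\<kappa>..N}"
  have "(\<Sum>v\<in>D J k. g v) = (\<Sum>v\<in>D J k. c k)" by (rule sum.cong[OF refl]) (use g k in auto)
  then show "(\<Sum>v\<in>D J k. g v) = wt (card J) (N - k) * c k" using card_D[OF J] k by simp
qed

lemma D_obtain:
  assumes "v \<in> D J k" "k \<le> N" "J \<noteq> {}"
  obtains p v' where "p \<in> J" "v' p \<in> Units A" "\<And>j. j \<in> J \<Longrightarrow> v' j \<in> carrier A" "\<And>j. j \<in> J \<Longrightarrow> v j = \<pi> [^] k \<otimes> v' j"
proof -
  have vI: "\<And>j. j \<in> J \<Longrightarrow> v j \<in> I k" using assms(1) by (auto simp: D_def)
  have "\<exists>p\<in>J. \<exists>u\<in>Units A. v p = \<pi> [^] k \<otimes> u"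
  proof (cases "k < N")
    case True
    then have "\<exists>p\<in>J. v p \<notin> I (Suc k)" using assms(1) by (auto simp: D_def PiE_def Pi_def)
    then show ?thesis using I_unit[OF True] vI by blast
  next
    case False
    \<comment> \<open>For k = N the vector is zero, and \<pi>^N times 1 still presents an entry as a
      power of \<pi> times a unit.\<close>
    then have kN: "k = N" using assms by simp
    obtain p where p: "p \<in> J" using assms(3) by blast
    have "v p = \<zero>" using vI[OF p] I_N kN by simp
    moreover have "\<pi> [^] k \<otimes> \<one> = \<zero>" using I_memI[OF one_closed, of N] I_N kN by simp
    ultimately show ?thesis using p Units_one_closed by metis
  qed
  then obtain p u where p: "p \<in> J" "u \<in> Units A" "v p = \<pi> [^] k \<otimes> u" by blast
  have "\<forall>j\<in>J. \<exists>y\<in>carrier A. v j = \<pi> [^] k \<otimes> y" using vI I_memE by metis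
  then obtain w where w: "\<And>j. j \<in> J \<Longrightarrow> w j \<in> carrier A \<and> v j = \<pi> [^] k \<otimes> w j" by metis
  show ?thesis
    by (rule that[of p "w(p := u)"]) (use p w Units_closed[OF p(2)] in auto)
qed

text \<open>All centralizers below are solution sets of congruences of this shape.\<close>

lemma card_congruences:
  assumes J: "finite J" "p \<in> J" and k: "k \<le> N" and a: "\<And>i. i \<in> J \<Longrightarrow> a i \<in> carrier A" "a p = \<one>"
  shows "card {c \<in> J \<rightarrow>\<^sub>E carrier A. \<forall>i\<in>J. \<pi> [^] k \<otimes> (c i \<ominus> a i \<otimes> c p) = \<zero>} = q ^ N * q ^ (k * (card J - 1))"
proof -
  let ?S = "{c \<in> J \<rightarrow>\<^sub>E carrier A. \<forall>i\<in>J. \<pi> [^] k \<otimes> (c i \<ominus> a i \<otimes> c p) = \<zero>}"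
  have img: "(\<lambda>c. c p) ` ?S = carrier A"
  proof (intro equalityI subsetI)
    fix t assume t: "t \<in> carrier A"
    have z: "\<pi> [^] k \<otimes> (x \<ominus> x) = \<zero>" if "x \<in> carrier A" for x using that pow_carr by (simp add: a_minus_def r_neg)
    have "(\<lambda>i\<in>J. a i \<otimes> t) \<in> ?S" using a t J z[OF m_closed[OF a(1) t]] by (auto simp: a(2))
    moreover have "(\<lambda>i\<in>J. a i \<otimes> t) p = t" using a t J by simp
    ultimately show "t \<in> (\<lambda>c. c p) ` ?S" by (metis (no_types, lifting) image_eqI)
  qed (use J in auto)
  have "card ?S = card ((\<lambda>c. c p) ` ?S) * q ^ (k * (card J - 1))"
  proof (rule card_by_fibres)
    show "finite ?S" using finite_PiE[OF J(1), of "\<lambda>_. carrier A"] fin by simp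
    fix t assume "t \<in> (\<lambda>c. c p) ` ?S"
    then have t: "t \<in> carrier A" unfolding img .
    \<comment> \<open>Once the entry at p is fixed the conditions decouple: each other entry ranges
      over a coset of \<open>Ann k\<close>, which has q^k elements.\<close>
    have "{c \<in> ?S. c p = t} = PiE J (\<lambda>i. if i = p then {t} else {y \<in> carrier A. \<pi> [^] k \<otimes> (y \<ominus> a i \<otimes> t) = \<zero>})"
    proof (intro equalityI subsetI)
      fix c assume "c \<in> {c \<in> ?S. c p = t}"
      then show "c \<in> PiE J (\<lambda>i. if i = p then {t} else {y \<in> carrier A. \<pi> [^] k \<otimes> (y \<ominus> a i \<otimes> t) = \<zero>})"
        by (auto simp: PiE_def Pi_def)
    next
      fix c assume c: "c \<in> PiE J (\<lambda>i. if i = p then {t} else {y \<in> carrier A. \<pi> [^] k \<otimes> (y \<ominus> a i \<otimes> t) = \<zero>})"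
      have cp: "c p = t" using PiE_mem[OF c J(2)] by simp
      have ci: "c i \<in> carrier A \<and> \<pi> [^] k \<otimes> (c i \<ominus> a i \<otimes> c p) = \<zero>" if i: "i \<in> J" for i
      proof (cases "i = p")
        case True
        then show ?thesis using cp t a(2) pow_carr by (simp add: a_minus_def r_neg)
      next
        case False
        then show ?thesis using PiE_mem[OF c i] cp by simp
      qed
      then show "c \<in> {c \<in> ?S. c p = t}" using cp c by (auto simp: PiE_def)
    qed
    then have "card {c \<in> ?S. c p = t} = (\<Prod>i\<in>J. if i = p then 1 else q ^ k)"
      using J card_shifted[OF k m_closed[OF a(1) t]] by (auto simp: card_PiE intro!: prod.cong)
    also have "\<dots> = (\<Prod>i\<in>J - {p}. q ^ k)" using J by (simp add: prod.remove)
    also have "\<dots> = q ^ (k * (card J - 1))" using J by (simp add: power_mult)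
    finally show "card {c \<in> ?S. c p = t} = q ^ (k * (card J - 1))" .
  qed
  then show ?thesis unfolding img card_carrier .
qed

lemma card_congruences2:
  assumes J: "finite J" and k: "k \<le> N" and s: "\<And>i. i \<in> J \<Longrightarrow> s i \<in> carrier A"
  shows "card {d \<in> J \<rightarrow>\<^sub>E carrier A. \<forall>i\<in>J. \<pi> [^] k \<otimes> (d i \<ominus> s i) = \<zero>} = q ^ (k * card J)"
proof -
  have "{d \<in> J \<rightarrow>\<^sub>E carrier A. \<forall>i\<in>J. \<pi> [^] k \<otimes> (d i \<ominus> s i) = \<zero>}
      = PiE J (\<lambda>i. {y \<in> carrier A. \<pi> [^] k \<otimes> (y \<ominus> s i) = \<zero>})"
    by (auto simp: PiE_def Pi_def)
  then show ?thesis using card_shifted[OF k s] J by (simp add: card_PiE power_mult)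
qed

text \<open>For fixed c the conditions on d are affine with a number of solutions that is
  independent of c, so the counts multiply: q^N for the entry \<open>c p\<close>, q^k for every
  other entry of c and q^l for every entry of d.\<close>

lemma card_congruences_pair:
  assumes J: "finite J" "p \<in> J" and k: "k \<le> N" "l \<le> N"
    and a: "\<And>i. i \<in> J \<Longrightarrow> a i \<in> carrier A" "a p = \<one>" and b: "\<And>i. i \<in> J \<Longrightarrow> b i \<in> carrier A"
  shows "card {(c, d). c \<in> J \<rightarrow>\<^sub>E carrier A \<and> d \<in> J \<rightarrow>\<^sub>E carrier A \<and>
      (\<forall>i\<in>J. \<pi> [^] k \<otimes> (c i \<ominus> a i \<otimes> c p) = \<zero>) \<and> (\<forall>j\<in>J. \<pi> [^] l \<otimes> (d j \<ominus> b j \<otimes> c p) = \<zero>)}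
    = q ^ (N + k * (card J - 1) + l * card J)"
proof -
  let ?C = "{c \<in> J \<rightarrow>\<^sub>E carrier A. \<forall>i\<in>J. \<pi> [^] k \<otimes> (c i \<ominus> a i \<otimes> c p) = \<zero>}"
  let ?D = "\<lambda>c. {d \<in> J \<rightarrow>\<^sub>E carrier A. \<forall>j\<in>J. \<pi> [^] l \<otimes> (d j \<ominus> b j \<otimes> c p) = \<zero>}"
  have finJ: "finite (J \<rightarrow>\<^sub>E carrier A)" using J fin by (intro finite_PiE) auto
  have "card (SIGMA c:?C. ?D c) = (\<Sum>c\<in>?C. card (?D c))"
    by (rule card_SigmaI) (use finJ in auto)
  also have "\<dots> = (\<Sum>c\<in>?C. q ^ (l * card J))"
  proof (rule sum.cong[OF refl])
    fix c assume "c \<in> ?C"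
    then have "c p \<in> carrier A" using J by auto
    then show "card (?D c) = q ^ (l * card J)" using b by (intro card_congruences2 J k) auto
  qed
  also have "\<dots> = q ^ N * q ^ (k * (card J - 1)) * q ^ (l * card J)"
    using card_congruences[OF J k(1), of a, OF a] by simp
  also have "(SIGMA c:?C. ?D c) = {(c, d). c \<in> J \<rightarrow>\<^sub>E carrier A \<and> d \<in> J \<rightarrow>\<^sub>E carrier A \<and>
      (\<forall>i\<in>J. \<pi> [^] k \<otimes> (c i \<ominus> a i \<otimes> c p) = \<zero>) \<and> (\<forall>j\<in>J. \<pi> [^] l \<otimes> (d j \<ominus> b j \<otimes> c p) = \<zero>)}"
    by auto
  finally show ?thesis by (simp add: power_add)
qed

end

section \<open>Centralizer orders\<close>

lemma Collect_pair_cong: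
  "(\<And>c d. c \<in> E \<Longrightarrow> d \<in> E \<Longrightarrow> L c d \<longleftrightarrow> R c d) \<Longrightarrow>
    {(c, d). c \<in> E \<and> d \<in> E \<and> L c d} = {(c, d). c \<in> E \<and> d \<in> E \<and> R c d}"
  by auto

context cring
begin

text \<open>This and the next five identities certify the eliminations below. They express one
  relation through others, where necessary up to a multiple of \<one> - v u, which disappears when v
  is the inverse of the pivot u. Abstract ring elements in place of powers and vector entries keep
  the terms small.\<close>

lemma centralizer_identity1:
  assumes "P \<in> carrier R" "s \<in> carrier R" "v \<in> carrier R" "u \<in> carrier R" "b \<in> carrier R" "c \<in> carrier R" "d \<in> carrier R"
  shows "P \<otimes> (d \<ominus> s \<otimes> v \<otimes> b \<otimes> c) = v \<otimes> (P \<otimes> u \<otimes> d \<ominus> c \<otimes> (P \<otimes> s \<otimes> b)) \<oplus> P \<otimes> d \<otimes> (\<one> \<ominus> v \<otimes> u)"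
  by (use assms in algebra)

lemma centralizer_identity2:
  assumes "P \<in> carrier R" "s \<in> carrier R" "v \<in> carrier R" "v2 \<in> carrier R" "a \<in> carrier R" "b \<in> carrier R"
    "c \<in> carrier R" "d \<in> carrier R" "cp \<in> carrier R"
  shows "P \<otimes> s \<otimes> (c \<ominus> v \<otimes> a \<otimes> cp) = v2 \<otimes> (c \<otimes> (P \<otimes> s \<otimes> b) \<ominus> P \<otimes> a \<otimes> d)
    \<oplus> v2 \<otimes> a \<otimes> (P \<otimes> (d \<ominus> s \<otimes> v \<otimes> b \<otimes> cp)) \<oplus> P \<otimes> s \<otimes> (c \<ominus> v \<otimes> a \<otimes> cp) \<otimes> (\<one> \<ominus> v2 \<otimes> b)"
  by (use assms in algebra)

lemma centralizer_identity3:
  assumes "P \<in> carrier R" "s \<in> carrier R" "v \<in> carrier R" "a \<in> carrier R" "b \<in> carrier R"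
    "c \<in> carrier R" "d \<in> carrier R" "cp \<in> carrier R"
  shows "P \<otimes> a \<otimes> d \<ominus> c \<otimes> (P \<otimes> s \<otimes> b) = a \<otimes> (P \<otimes> (d \<ominus> s \<otimes> v \<otimes> b \<otimes> cp)) \<ominus> b \<otimes> (P \<otimes> s \<otimes> (c \<ominus> v \<otimes> a \<otimes> cp))"
  by (use assms in algebra)

lemma centralizer_identity4:
  assumes "P \<in> carrier R" "v \<in> carrier R" "x \<in> carrier R" "y \<in> carrier R" "z \<in> carrier R" "w \<in> carrier R" "zp \<in> carrier R"
  shows "z \<otimes> (P \<otimes> y) \<ominus> w \<otimes> (P \<otimes> x) = y \<otimes> (P \<otimes> (z \<ominus> v \<otimes> x \<otimes> zp)) \<ominus> x \<otimes> (P \<otimes> (w \<ominus> v \<otimes> y \<otimes> zp))"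
  by (use assms in algebra)

lemma centralizer_identity5:
  assumes "P \<in> carrier R" "v \<in> carrier R" "u \<in> carrier R" "y \<in> carrier R" "z \<in> carrier R" "zp \<in> carrier R"
  shows "P \<otimes> (z \<ominus> v \<otimes> y \<otimes> zp) = v \<otimes> (z \<otimes> (P \<otimes> u) \<ominus> zp \<otimes> (P \<otimes> y)) \<oplus> P \<otimes> z \<otimes> (\<one> \<ominus> v \<otimes> u)"
  by (use assms in algebra)

lemma centralizer_identity6:
  assumes "P \<in> carrier R" "s \<in> carrier R" "v \<in> carrier R" "ai \<in> carrier R" "aj \<in> carrier R" "bi \<in> carrier R" "bj \<in> carrier R"
    "ci \<in> carrier R" "cj \<in> carrier R" "di \<in> carrier R" "dj \<in> carrier R" "cp \<in> carrier R"
  shows "(P \<otimes> ai \<otimes> dj \<oplus> P \<otimes> aj \<otimes> di) \<ominus> (ci \<otimes> (P \<otimes> s \<otimes> bj) \<oplus> cj \<otimes> (P \<otimes> s \<otimes> bi))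
    = ai \<otimes> (P \<otimes> (dj \<ominus> s \<otimes> v \<otimes> bj \<otimes> cp)) \<oplus> aj \<otimes> (P \<otimes> (di \<ominus> s \<otimes> v \<otimes> bi \<otimes> cp))
      \<ominus> (bj \<otimes> (P \<otimes> s \<otimes> (ci \<ominus> v \<otimes> ai \<otimes> cp)) \<oplus> bi \<otimes> (P \<otimes> s \<otimes> (cj \<ominus> v \<otimes> aj \<otimes> cp)))"
  by (use assms in algebra)

end

context chain_ring
begin

definition KF :: "nat set \<Rightarrow> (nat \<Rightarrow> 'a) \<Rightarrow> (nat \<Rightarrow> 'a) set" where
  "KF J x = {z \<in> J \<rightarrow>\<^sub>E carrier A. \<forall>i\<in>J. \<forall>j\<in>J. z i \<otimes> x j = z j \<otimes> x i}"

definition KG :: "nat set \<Rightarrow> (nat \<Rightarrow> 'a) \<Rightarrow> (nat \<Rightarrow> 'a) \<Rightarrow> ((nat \<Rightarrow> 'a) \<times> (nat \<Rightarrow> 'a)) set" where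
  "KG J a b = {(c, d). c \<in> J \<rightarrow>\<^sub>E carrier A \<and> d \<in> J \<rightarrow>\<^sub>E carrier A \<and> (\<forall>i\<in>J. \<forall>j\<in>J. a i \<otimes> d j = c i \<otimes> b j)}"

text \<open>The diagonal condition is separate because the off-diagonal one would give only its
  double for i = j. In this form residue characteristic two needs no special treatment.\<close>

definition KH :: "nat set \<Rightarrow> (nat \<Rightarrow> 'a) \<Rightarrow> (nat \<Rightarrow> 'a) \<Rightarrow> ((nat \<Rightarrow> 'a) \<times> (nat \<Rightarrow> 'a)) set" where
  "KH J a b = {(c, d). c \<in> J \<rightarrow>\<^sub>E carrier A \<and> d \<in> J \<rightarrow>\<^sub>E carrier A \<and> (\<forall>i\<in>J. a i \<otimes> d i = c i \<otimes> b i) \<and>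
     (\<forall>i\<in>J. \<forall>j\<in>J. i \<noteq> j \<longrightarrow> a i \<otimes> d j \<oplus> a j \<otimes> d i = c i \<otimes> b j \<oplus> c j \<otimes> b i)}"

text \<open>Divide x by \<pi>^k and choose a position p where the result is a unit. The minors that
  involve p determine every z i by z p up to \<open>Ann k\<close>, and these congruences already
  imply that the remaining minors vanish.\<close>

lemma card_KF:
  assumes J: "finite J" "J \<noteq> {}" and k: "k \<le> N" and x: "x \<in> D J k"
  shows "card (KF J x) = q ^ (N + k * (card J - 1))"
proof -
  obtain p x' where p: "p \<in> J" "x' p \<in> Units A"
    and x': "\<And>j. j \<in> J \<Longrightarrow> x' j \<in> carrier A" "\<And>j. j \<in> J \<Longrightarrow> x j = \<pi> [^] k \<otimes> x' j"
    using D_obtain[OF x k J(2)] by metis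
  define v where "v = inv (x' p)"
  have v: "v \<in> carrier A" "v \<otimes> x' p = \<one>" unfolding v_def using p(2) by auto
  define P where "P = \<pi> [^] k"
  have P: "P \<in> carrier A" unfolding P_def by (rule pow_carr)
  have vu: "\<one> \<ominus> v \<otimes> x' p = \<zero>" using v by simp
  have "KF J x = {c \<in> J \<rightarrow>\<^sub>E carrier A. \<forall>i\<in>J. \<pi> [^] k \<otimes> (c i \<ominus> v \<otimes> x' i \<otimes> c p) = \<zero>}"
    unfolding KF_def
  proof (intro Collect_cong conj_cong refl)
    fix z assume z: "z \<in> J \<rightarrow>\<^sub>E carrier A"
    then have zc: "\<And>i. i \<in> J \<Longrightarrow> z i \<in> carrier A" by auto
    show "(\<forall>i\<in>J. \<forall>j\<in>J. z i \<otimes> x j = z j \<otimes> x i) \<longleftrightarrow> (\<forall>i\<in>J. \<pi> [^] k \<otimes> (z i \<ominus> v \<otimes> x' i \<otimes> z p) = \<zero>)"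
    proof
      assume e: "\<forall>i\<in>J. \<forall>j\<in>J. z i \<otimes> x j = z j \<otimes> x i"
      show "\<forall>i\<in>J. \<pi> [^] k \<otimes> (z i \<ominus> v \<otimes> x' i \<otimes> z p) = \<zero>"
      proof
        fix i assume i: "i \<in> J"
        have "z i \<otimes> (P \<otimes> x' p) = z p \<otimes> (P \<otimes> x' i)" using e i p x'(2) unfolding P_def by metis
        then have "z i \<otimes> (P \<otimes> x' p) \<ominus> z p \<otimes> (P \<otimes> x' i) = \<zero>" using zc i p x' P by simp
        then show "\<pi> [^] k \<otimes> (z i \<ominus> v \<otimes> x' i \<otimes> z p) = \<zero>"
          using centralizer_identity5[OF P v(1) x'(1)[OF p(1)] x'(1)[OF i] zc[OF i] zc[OF p(1)]] vu v(1) P zc[OF i]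
          by (simp add: P_def)
      qed
    next
      assume e: "\<forall>i\<in>J. \<pi> [^] k \<otimes> (z i \<ominus> v \<otimes> x' i \<otimes> z p) = \<zero>"
      show "\<forall>i\<in>J. \<forall>j\<in>J. z i \<otimes> x j = z j \<otimes> x i"
      proof (intro ballI)
        fix i j assume ij: "i \<in> J" "j \<in> J"
        have "z i \<otimes> (P \<otimes> x' j) \<ominus> z j \<otimes> (P \<otimes> x' i) = \<zero>"
          using centralizer_identity4[OF P v(1) x'(1)[OF ij(1)] x'(1)[OF ij(2)] zc[OF ij(1)] zc[OF ij(2)] zc[OF p(1)]] e ij x'
          by (simp add: P_def)
        then show "z i \<otimes> x j = z j \<otimes> x i" using ij x' zc P by (simp add: P_def)
      qed
    qed
  qed
  then show ?thesis
    using card_congruences[OF J(1) p(1) k, of "\<lambda>i. v \<otimes> x' i"] v x' by (simp add: power_add)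
qed

lemma pow_split:
  assumes "l \<le> (k::nat)" shows "\<pi> [^] k = \<pi> [^] l \<otimes> \<pi> [^] (k - l)"
  using nat_pow_mult[OF pi_carr, of l "k - l"] assms by simp

text \<open>The systems for \<G> and \<H> are different but have this same solution set: the pair
  (c, d) is, up to annihilators, a multiple of (a, b) divided by the leading power of \<pi>.\<close>

lemma card_kernel_pair:
  assumes J: "finite J" "p \<in> J" and l: "l \<le> k" "k \<le> N"
    and a: "\<And>i. i \<in> J \<Longrightarrow> a' i \<in> carrier A" and b: "\<And>i. i \<in> J \<Longrightarrow> b' i \<in> carrier A"
    and v: "v \<in> carrier A" "v \<otimes> a' p = \<one>"
  shows "card {(c, d). c \<in> J \<rightarrow>\<^sub>E carrier A \<and> d \<in> J \<rightarrow>\<^sub>E carrier A \<and>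
      (\<forall>i\<in>J. \<pi> [^] k \<otimes> (c i \<ominus> v \<otimes> a' i \<otimes> c p) = \<zero>) \<and>
      (\<forall>j\<in>J. \<pi> [^] l \<otimes> (d j \<ominus> \<pi> [^] (k - l) \<otimes> v \<otimes> b' j \<otimes> c p) = \<zero>)}
    = q ^ (N + k * (card J - 1) + l * card J)"
  using card_congruences_pair[OF J l(2) order.trans[OF l], of "\<lambda>i. v \<otimes> a' i" "\<lambda>i. \<pi> [^] (k - l) \<otimes> v \<otimes> b' i"]
    a b v pow_carr by simp

text \<open>Two pivots are used. The equations with i = p, where a' is a unit, determine d by c p up
  to \<open>Ann l\<close>; then those with j = r, where b' is a unit, determine c up to
  \<open>Ann k\<close>. Since l \<le> k, the entry \<open>c p\<close> can serve as the parameter for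
  both.\<close>

lemma card_KG:
  assumes J: "finite J" "J \<noteq> {}" and l: "l \<le> k" "k \<le> N" and a: "a \<in> D J l" and b: "b \<in> D J k"
  shows "card (KG J a b) = q ^ (N + k * (card J - 1) + l * card J)"
proof -
  have lN: "l \<le> N" using l by simp
  obtain p a' where p: "p \<in> J" "a' p \<in> Units A"
    and a': "\<And>j. j \<in> J \<Longrightarrow> a' j \<in> carrier A" "\<And>j. j \<in> J \<Longrightarrow> a j = \<pi> [^] l \<otimes> a' j"
    using D_obtain[OF a lN J(2)] by metis
  obtain r b' where r: "r \<in> J" "b' r \<in> Units A"
    and b': "\<And>j. j \<in> J \<Longrightarrow> b' j \<in> carrier A" "\<And>j. j \<in> J \<Longrightarrow> b j = \<pi> [^] k \<otimes> b' j"
    using D_obtain[OF b l(2) J(2)] by metis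
  define v where "v = inv (a' p)"
  have v: "v \<in> carrier A" "v \<otimes> a' p = \<one>" unfolding v_def using p(2) by auto
  define v2 where "v2 = inv (b' r)"
  have v2: "v2 \<in> carrier A" "v2 \<otimes> b' r = \<one>" unfolding v2_def using r(2) by auto
  define P where "P = \<pi> [^] l"
  define s where "s = \<pi> [^] (k - l)"
  have P: "P \<in> carrier A" and s: "s \<in> carrier A" unfolding P_def s_def by (rule pow_carr)+
  have Ps: "\<pi> [^] k = P \<otimes> s" unfolding P_def s_def by (rule pow_split[OF l(1)])
  have vu: "\<one> \<ominus> v \<otimes> a' p = \<zero>" "\<one> \<ominus> v2 \<otimes> b' r = \<zero>" using v v2 by simp_all
  have aP: "a j = P \<otimes> a' j" if "j \<in> J" for j using a'(2)[OF that] unfolding P_def .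
  have bP: "b j = P \<otimes> s \<otimes> b' j" if "j \<in> J" for j using b'(2)[OF that] unfolding Ps .
  have "KG J a b = {(c, d). c \<in> J \<rightarrow>\<^sub>E carrier A \<and> d \<in> J \<rightarrow>\<^sub>E carrier A \<and>
      (\<forall>i\<in>J. \<pi> [^] k \<otimes> (c i \<ominus> v \<otimes> a' i \<otimes> c p) = \<zero>) \<and>
      (\<forall>j\<in>J. \<pi> [^] l \<otimes> (d j \<ominus> \<pi> [^] (k - l) \<otimes> v \<otimes> b' j \<otimes> c p) = \<zero>)}"
    unfolding KG_def Ps P_def[symmetric] s_def[symmetric]
  proof (rule Collect_pair_cong, goal_cases)
    case (1 c d)
    then have cc: "\<And>i. i \<in> J \<Longrightarrow> c i \<in> carrier A" and dc: "\<And>i. i \<in> J \<Longrightarrow> d i \<in> carrier A" by auto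
    show ?case
    proof
      assume e: "\<forall>i\<in>J. \<forall>j\<in>J. a i \<otimes> d j = c i \<otimes> b j"
      have e0: "P \<otimes> a' i \<otimes> d j \<ominus> c i \<otimes> (P \<otimes> s \<otimes> b' j) = \<zero>" if "i \<in> J" "j \<in> J" for i j
        using e that aP bP cc dc a' b' P s by simp
      have dz: "P \<otimes> (d j \<ominus> s \<otimes> v \<otimes> b' j \<otimes> c p) = \<zero>" if j: "j \<in> J" for j
        using centralizer_identity1[OF P s v(1) a'(1)[OF p(1)] b'(1)[OF j] cc[OF p(1)] dc[OF j]] e0[OF p(1) j] vu(1) v(1) P dc[OF j]
        by simp
      have e1: "c i \<otimes> (P \<otimes> s \<otimes> b' r) \<ominus> P \<otimes> a' i \<otimes> d r = \<zero>" if "i \<in> J" for i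
        using e that r(1) aP bP cc dc a' b' P s by simp
      have "P \<otimes> s \<otimes> (c i \<ominus> v \<otimes> a' i \<otimes> c p) = \<zero>" if i: "i \<in> J" for i
        using centralizer_identity2[OF P s v(1) v2(1) a'(1)[OF i] b'(1)[OF r(1)] cc[OF i] dc[OF r(1)] cc[OF p(1)]]
          e1[OF i] dz[OF r(1)] vu(2) v(1) v2(1) P s cc[OF i] cc[OF p(1)] a'(1)[OF i] by simp
      then show "(\<forall>i\<in>J. P \<otimes> s \<otimes> (c i \<ominus> v \<otimes> a' i \<otimes> c p) = \<zero>) \<and> (\<forall>j\<in>J. P \<otimes> (d j \<ominus> s \<otimes> v \<otimes> b' j \<otimes> c p) = \<zero>)"
        using dz by blast
    next
      assume e: "(\<forall>i\<in>J. P \<otimes> s \<otimes> (c i \<ominus> v \<otimes> a' i \<otimes> c p) = \<zero>) \<and> (\<forall>j\<in>J. P \<otimes> (d j \<ominus> s \<otimes> v \<otimes> b' j \<otimes> c p) = \<zero>)"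
      show "\<forall>i\<in>J. \<forall>j\<in>J. a i \<otimes> d j = c i \<otimes> b j"
      proof (intro ballI)
        fix i j assume ij: "i \<in> J" "j \<in> J"
        have "P \<otimes> a' i \<otimes> d j \<ominus> c i \<otimes> (P \<otimes> s \<otimes> b' j) = \<zero>"
          using centralizer_identity3[OF P s v(1) a'(1)[OF ij(1)] b'(1)[OF ij(2)] cc[OF ij(1)] dc[OF ij(2)] cc[OF p(1)]]
            e ij a' b' by simp
        then show "a i \<otimes> d j = c i \<otimes> b j" using aP[OF ij(1)] bP[OF ij(2)] ij cc dc a' b' P s by simp
      qed
    qed
  qed
  then show ?thesis using card_kernel_pair[OF J(1) p(1) l, of a' b' v] a' b' v by simp
qed

text \<open>In terms of the defects f and g of the two congruences the system becomes a symmetric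
  one with coefficients a' and b', in which f p and b' p vanish. The diagonal equation at p kills g
  p, those for (p, j) kill the other g j, the diagonal equation at r kills f r, and those for (i, r)
  kill the rest. The normalization b p = 0 is what makes the equations for (p, j)
  triangular.\<close>

lemma card_KH:
  assumes J: "finite J" and p: "p \<in> J" and l: "l \<le> k" "k \<le> N"
    and a': "a' p \<in> Units A" "\<And>j. j \<in> J \<Longrightarrow> a' j \<in> carrier A" "\<And>j. j \<in> J \<Longrightarrow> a j = \<pi> [^] l \<otimes> a' j"
    and b: "b p = \<zero>" "restrict b (J - {p}) \<in> D (J - {p}) k" and ne: "J - {p} \<noteq> {}"
  shows "card (KH J a b) = q ^ (N + k * (card J - 1) + l * card J)"
proof -
  obtain r b0 where r: "r \<in> J - {p}" "b0 r \<in> Units A"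
    and b0: "\<And>j. j \<in> J - {p} \<Longrightarrow> b0 j \<in> carrier A" "\<And>j. j \<in> J - {p} \<Longrightarrow> restrict b (J - {p}) j = \<pi> [^] k \<otimes> b0 j"
    using D_obtain[OF b(2) l(2) ne] by metis
  \<comment> \<open>Any annihilator of \<pi>^k would do as quotient of b p = 0; zero makes the terms
    with b' p vanish exactly.\<close>
  define b' where "b' = b0(p := \<zero>)"
  have b'c: "b' j \<in> carrier A" if "j \<in> J" for j using b0(1)[of j] that by (auto simp: b'_def)
  have b'e: "b j = \<pi> [^] k \<otimes> b' j" if "j \<in> J" for j
    using b0(2)[of j] that b(1) pow_carr by (cases "j = p") (auto simp: b'_def)
  have b'p: "b' p = \<zero>" by (simp add: b'_def)
  have r': "r \<in> J" "b' r \<in> Units A" "r \<noteq> p" using r by (auto simp: b'_def)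
  define v where "v = inv (a' p)"
  have v: "v \<in> carrier A" "v \<otimes> a' p = \<one>" unfolding v_def using a'(1) by auto
  define v2 where "v2 = inv (b' r)"
  have v2: "v2 \<in> carrier A" "v2 \<otimes> b' r = \<one>" unfolding v2_def using r'(2) by auto
  define P where "P = \<pi> [^] l"
  define s where "s = \<pi> [^] (k - l)"
  have P: "P \<in> carrier A" and s: "s \<in> carrier A" unfolding P_def s_def by (rule pow_carr)+
  have Ps: "\<pi> [^] k = P \<otimes> s" unfolding P_def s_def by (rule pow_split[OF l(1)])
  have vu: "\<one> \<ominus> v \<otimes> a' p = \<zero>" using v by simp
  have aP: "a j = P \<otimes> a' j" if "j \<in> J" for j using a'(3)[OF that] unfolding P_def .
  have bP: "b j = P \<otimes> s \<otimes> b' j" if "j \<in> J" for j using b'e[OF that] unfolding Ps .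
  have "KH J a b = {(c, d). c \<in> J \<rightarrow>\<^sub>E carrier A \<and> d \<in> J \<rightarrow>\<^sub>E carrier A \<and>
      (\<forall>i\<in>J. \<pi> [^] k \<otimes> (c i \<ominus> v \<otimes> a' i \<otimes> c p) = \<zero>) \<and>
      (\<forall>j\<in>J. \<pi> [^] l \<otimes> (d j \<ominus> \<pi> [^] (k - l) \<otimes> v \<otimes> b' j \<otimes> c p) = \<zero>)}"
    unfolding KH_def Ps P_def[symmetric] s_def[symmetric]
  proof (rule Collect_pair_cong, goal_cases)
    case (1 c d)
    then have cc: "\<And>i. i \<in> J \<Longrightarrow> c i \<in> carrier A" and dc: "\<And>i. i \<in> J \<Longrightarrow> d i \<in> carrier A" by auto
    define f where "f i = P \<otimes> s \<otimes> (c i \<ominus> v \<otimes> a' i \<otimes> c p)" for i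
    define g where "g j = P \<otimes> (d j \<ominus> s \<otimes> v \<otimes> b' j \<otimes> c p)" for j
    have fc: "f i \<in> carrier A" and gc: "g i \<in> carrier A" if "i \<in> J" for i
      unfolding f_def g_def using that cc dc p a' b'c v P s by simp_all
    have diag: "a i \<otimes> d i = c i \<otimes> b i \<longleftrightarrow> a' i \<otimes> g i \<ominus> b' i \<otimes> f i = \<zero>" if i: "i \<in> J" for i
    proof -
      have "a i \<otimes> d i = c i \<otimes> b i \<longleftrightarrow> P \<otimes> a' i \<otimes> d i \<ominus> c i \<otimes> (P \<otimes> s \<otimes> b' i) = \<zero>"
        using aP[OF i] bP[OF i] i cc dc a' b'c P s by simp
      then show ?thesis
        unfolding centralizer_identity3[OF P s v(1) a'(2)[OF i] b'c[OF i] cc[OF i] dc[OF i] cc[OF p]] f_def g_def .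
    qed
    have off: "a i \<otimes> d j \<oplus> a j \<otimes> d i = c i \<otimes> b j \<oplus> c j \<otimes> b i \<longleftrightarrow>
        a' i \<otimes> g j \<oplus> a' j \<otimes> g i \<ominus> (b' j \<otimes> f i \<oplus> b' i \<otimes> f j) = \<zero>" if i: "i \<in> J" and j: "j \<in> J" for i j
    proof -
      have "a i \<otimes> d j \<oplus> a j \<otimes> d i = c i \<otimes> b j \<oplus> c j \<otimes> b i \<longleftrightarrow>
        (P \<otimes> a' i \<otimes> d j \<oplus> P \<otimes> a' j \<otimes> d i) \<ominus> (c i \<otimes> (P \<otimes> s \<otimes> b' j) \<oplus> c j \<otimes> (P \<otimes> s \<otimes> b' i)) = \<zero>"
        using aP[OF i] bP[OF i] aP[OF j] bP[OF j] i j cc dc a' b'c P s by simp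
      then show ?thesis
        unfolding centralizer_identity6[OF P s v(1) a'(2)[OF i] a'(2)[OF j] b'c[OF i] b'c[OF j] cc[OF i] cc[OF j] dc[OF i] dc[OF j] cc[OF p]]
          f_def g_def .
    qed
    have unit: "x = \<zero>" if "w \<otimes> y = \<one>" "y \<otimes> x = \<zero>" "w \<in> carrier A" "y \<in> carrier A" "x \<in> carrier A" for w x y
    proof -
      have "x = (w \<otimes> y) \<otimes> x" using that by simp
      also have "\<dots> = w \<otimes> (y \<otimes> x)" using that(3-5) by (rule m_assoc)
      also have "\<dots> = \<zero>" using that by simp
      finally show ?thesis .
    qed
    have fp: "f p = \<zero>" unfolding f_def using v cc[OF p] P s by (simp add: a_minus_def r_neg)
    have "(\<forall>i\<in>J. a i \<otimes> d i = c i \<otimes> b i) \<and> (\<forall>i\<in>J. \<forall>j\<in>J. i \<noteq> j \<longrightarrow> a i \<otimes> d j \<oplus> a j \<otimes> d i = c i \<otimes> b j \<oplus> c j \<otimes> b i) \<longleftrightarrow>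
      (\<forall>i\<in>J. f i = \<zero>) \<and> (\<forall>j\<in>J. g j = \<zero>)"
    proof
      assume e: "(\<forall>i\<in>J. a i \<otimes> d i = c i \<otimes> b i) \<and> (\<forall>i\<in>J. \<forall>j\<in>J. i \<noteq> j \<longrightarrow> a i \<otimes> d j \<oplus> a j \<otimes> d i = c i \<otimes> b j \<oplus> c j \<otimes> b i)"
      then have eo: "a i \<otimes> d j \<oplus> a j \<otimes> d i = c i \<otimes> b j \<oplus> c j \<otimes> b i" if "i \<in> J" "j \<in> J" "i \<noteq> j" for i j
        using that by simp
      have "a' p \<otimes> g p = \<zero>" using diag[OF p] e p b'p fc[OF p] gc[OF p] a'(2)[OF p] by (simp add: a_minus_def)
      then have gp: "g p = \<zero>" using unit[OF v(2) _ v(1) a'(2)[OF p] gc[OF p]] by simp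
      have gz: "g j = \<zero>" if j: "j \<in> J" for j
      proof (cases "j = p")
        case False
        then have "a' p \<otimes> g j \<oplus> a' j \<otimes> g p \<ominus> (b' j \<otimes> f p \<oplus> b' p \<otimes> f j) = \<zero>"
          by (intro off[OF p j, THEN iffD1] eo p j) simp
        then have "a' p \<otimes> g j = \<zero>" using gp fp b'p a'(2)[OF j] a'(2)[OF p] b'c[OF j] fc[OF j] gc[OF j]
          by (simp add: a_minus_def)
        then show ?thesis using unit[OF v(2) _ v(1) a'(2)[OF p] gc[OF j]] by simp
      qed (use gp in simp)
      have inv0: "y = \<zero>" if "y \<in> carrier A" "\<zero> \<ominus> y = \<zero>" for y using that by simp
      have "\<zero> \<ominus> b' r \<otimes> f r = \<zero>" using diag[OF r'(1)] e r'(1) gz[OF r'(1)] a'(2)[OF r'(1)] by simp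
      then have "b' r \<otimes> f r = \<zero>" by (rule inv0[OF m_closed[OF b'c[OF r'(1)] fc[OF r'(1)]]])
      then have fr: "f r = \<zero>" using unit[OF v2(2) _ v2(1) b'c[OF r'(1)] fc[OF r'(1)]] by simp
      have fz: "f i = \<zero>" if i: "i \<in> J" for i
      proof (cases "i = r")
        case False
        then have "a' i \<otimes> g r \<oplus> a' r \<otimes> g i \<ominus> (b' r \<otimes> f i \<oplus> b' i \<otimes> f r) = \<zero>"
          by (intro off[OF i r'(1), THEN iffD1] eo i r'(1)) simp
        then have "\<zero> \<ominus> b' r \<otimes> f i = \<zero>" using gz[OF i] gz[OF r'(1)] fr a'(2)[OF i] a'(2)[OF r'(1)] b'c[OF i] b'c[OF r'(1)] fc[OF i]
          by (simp add: a_minus_def)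
        then have "b' r \<otimes> f i = \<zero>" by (rule inv0[OF m_closed[OF b'c[OF r'(1)] fc[OF i]]])
        then show ?thesis using unit[OF v2(2) _ v2(1) b'c[OF r'(1)] fc[OF i]] by simp
      qed (use fr in simp)
      show "(\<forall>i\<in>J. f i = \<zero>) \<and> (\<forall>j\<in>J. g j = \<zero>)" using fz gz by blast
    next
      assume e: "(\<forall>i\<in>J. f i = \<zero>) \<and> (\<forall>j\<in>J. g j = \<zero>)"
      show "(\<forall>i\<in>J. a i \<otimes> d i = c i \<otimes> b i) \<and> (\<forall>i\<in>J. \<forall>j\<in>J. i \<noteq> j \<longrightarrow> a i \<otimes> d j \<oplus> a j \<otimes> d i = c i \<otimes> b j \<oplus> c j \<otimes> b i)"
        using diag off e a'(2) b'c by simp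
    qed
    then show ?case unfolding f_def g_def .
  qed
  then show ?thesis using card_kernel_pair[OF J p l, of a' b' v] a' b'c v by simp
qed

end

section \<open>Sums over pairs of vectors\<close>

text \<open>The multiples of t can be moved from b to d because a_i c_j + a_j c_i is symmetric in i
  and j. The equations for \<G> involve c_i a_j alone and admit no such move.\<close>

lemma (in cring) shift_identity:
  assumes "t \<in> carrier R" "ai \<in> carrier R" "aj \<in> carrier R" "ci \<in> carrier R" "cj \<in> carrier R"
    "di \<in> carrier R" "dj \<in> carrier R" "yi \<in> carrier R" "yj \<in> carrier R"
  shows "(ai \<otimes> dj \<oplus> aj \<otimes> di) \<ominus> (ci \<otimes> (t \<otimes> aj \<oplus> yj) \<oplus> cj \<otimes> (t \<otimes> ai \<oplus> yi))
    = (ai \<otimes> (dj \<ominus> t \<otimes> cj) \<oplus> aj \<otimes> (di \<ominus> t \<otimes> ci)) \<ominus> (ci \<otimes> yj \<oplus> cj \<otimes> yi)"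
  by (use assms in algebra)

lemma (in cring) shift_identity_diag:
  assumes "t \<in> carrier R" "a \<in> carrier R" "c \<in> carrier R" "d \<in> carrier R" "y \<in> carrier R"
  shows "a \<otimes> d \<ominus> c \<otimes> (t \<otimes> a \<oplus> y) = a \<otimes> (d \<ominus> t \<otimes> c) \<ominus> c \<otimes> y"
  by (use assms in algebra)

text \<open>Reduces to pairs in which a has the smaller valuation. The diagonal is counted in the
  first triangle only, so the second one starts at \<open>Suc i\<close>.\<close>

lemma sum_symmetric_triangles:
  fixes M :: "nat \<Rightarrow> nat \<Rightarrow> 'b::comm_monoid_add"
  assumes "\<And>i j. M i j = M j i"
  shows "(\<Sum>i\<le>N. \<Sum>j\<le>N. M i j) = (\<Sum>i\<le>N. (\<Sum>j=i..N. M i j) + (\<Sum>j=Suc i..N. M i j))"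
proof -
  have "(\<Sum>i\<le>N. \<Sum>j\<le>N. M i j) = (\<Sum>i\<le>N. (\<Sum>j<i. M i j) + (\<Sum>j=i..N. M i j))"
  proof (rule sum.cong[OF refl])
    fix i assume "i \<in> {..N}"
    then have "{..N} = {..<i} \<union> {i..N}" by auto
    then show "(\<Sum>j\<le>N. M i j) = (\<Sum>j<i. M i j) + (\<Sum>j=i..N. M i j)"
      by (simp add: sum.union_disjoint ivl_disj_int)
  qed
  also have "\<dots> = (\<Sum>i\<le>N. \<Sum>j<i. M i j) + (\<Sum>i\<le>N. \<Sum>j=i..N. M i j)" by (rule sum.distrib)
  also have "(\<Sum>i\<le>N. \<Sum>j<i. M i j) = (\<Sum>j<N. \<Sum>i=Suc j..N. M i j)" by (rule sum.nested_swap')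
  also have "\<dots> = (\<Sum>j\<le>N. \<Sum>i=Suc j..N. M j i)"
    using assms by (simp add: lessThan_Suc_atMost[symmetric])
  finally show ?thesis by (simp add: sum.distrib add.commute)
qed

context chain_ring
begin

lemma sum_KF:
  assumes J: "finite J" "J \<noteq> {}"
  shows "(\<Sum>x\<in>J \<rightarrow>\<^sub>E carrier A. f (card (KF J x)))
    = (\<Sum>k\<le>N. wt (card J) (N - k) * (f (q ^ (N + k * (card J - 1))) :: complex))"
  using sum_D_const[OF J(1), of 0 "\<lambda>x. f (card (KF J x))" "\<lambda>k. f (q ^ (N + k * (card J - 1)))"]
    card_KF[OF J] by (simp add: I_0 atLeast0AtMost)

lemma card_KG_sym:
  assumes "a \<in> J \<rightarrow>\<^sub>E carrier A" "b \<in> J \<rightarrow>\<^sub>E carrier A"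
  shows "card (KG J b a) = card (KG J a b)"
proof (rule bij_betw_same_card)
  have ab: "\<And>i. i \<in> J \<Longrightarrow> a i \<in> carrier A" "\<And>i. i \<in> J \<Longrightarrow> b i \<in> carrier A" using assms by auto
  have sub: "prod.swap ` KG J b a \<subseteq> KG J a b"
    if ab: "\<And>i. i \<in> J \<Longrightarrow> a i \<in> carrier A" "\<And>i. i \<in> J \<Longrightarrow> b i \<in> carrier A" for a b
  proof (rule image_subsetI)
    fix z assume "z \<in> KG J b a"
    then obtain c d where z: "z = (c, d)" "c \<in> J \<rightarrow>\<^sub>E carrier A" "d \<in> J \<rightarrow>\<^sub>E carrier A"
      "\<And>i j. i \<in> J \<Longrightarrow> j \<in> J \<Longrightarrow> b i \<otimes> d j = c i \<otimes> a j" by (auto simp: KG_def)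
    have "a i \<otimes> c j = d i \<otimes> b j" if "i \<in> J" "j \<in> J" for i j
      using z(4)[OF that(2,1)] ab that z(2,3) by (metis PiE_mem m_comm)
    then show "prod.swap z \<in> KG J a b" using z by (simp add: KG_def)
  qed
  show "bij_betw prod.swap (KG J b a) (KG J a b)"
    by (rule bij_betw_byWitness[where f' = prod.swap]) (use sub[OF ab] sub[OF ab(2,1)] in auto)
qed

lemma card_KH_sym:
  assumes "a \<in> J \<rightarrow>\<^sub>E carrier A" "b \<in> J \<rightarrow>\<^sub>E carrier A"
  shows "card (KH J b a) = card (KH J a b)"
proof (rule bij_betw_same_card)
  have ab: "\<And>i. i \<in> J \<Longrightarrow> a i \<in> carrier A" "\<And>i. i \<in> J \<Longrightarrow> b i \<in> carrier A" using assms by auto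
  have sub: "prod.swap ` KH J b a \<subseteq> KH J a b"
    if ab: "\<And>i. i \<in> J \<Longrightarrow> a i \<in> carrier A" "\<And>i. i \<in> J \<Longrightarrow> b i \<in> carrier A" for a b
  proof (rule image_subsetI)
    fix z assume "z \<in> KH J b a"
    then obtain c d where z: "z = (c, d)" "c \<in> J \<rightarrow>\<^sub>E carrier A" "d \<in> J \<rightarrow>\<^sub>E carrier A"
      "\<And>i. i \<in> J \<Longrightarrow> b i \<otimes> d i = c i \<otimes> a i"
      "\<And>i j. i \<in> J \<Longrightarrow> j \<in> J \<Longrightarrow> i \<noteq> j \<Longrightarrow> b i \<otimes> d j \<oplus> b j \<otimes> d i = c i \<otimes> a j \<oplus> c j \<otimes> a i"
      by (auto simp: KH_def)
    have cd: "\<And>i. i \<in> J \<Longrightarrow> c i \<in> carrier A" "\<And>i. i \<in> J \<Longrightarrow> d i \<in> carrier A" using z(2,3) by auto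
    have "a i \<otimes> c i = d i \<otimes> b i" if i: "i \<in> J" for i
      using z(4)[OF i] ab[OF i] cd[OF i] by (simp add: m_comm)
    moreover have "a i \<otimes> c j \<oplus> a j \<otimes> c i = d i \<otimes> b j \<oplus> d j \<otimes> b i" if i: "i \<in> J" and j: "j \<in> J" and ij: "i \<noteq> j" for i j
      using z(5)[OF i j ij] ab[OF i] ab[OF j] cd[OF i] cd[OF j] by (simp add: m_comm a_comm)
    ultimately show "prod.swap z \<in> KH J a b" using z(1-3) by (simp add: KH_def)
  qed
  show "bij_betw prod.swap (KH J b a) (KH J a b)"
    by (rule bij_betw_byWitness[where f' = prod.swap]) (use sub[OF ab] sub[OF ab(2,1)] in auto)
qed

lemma sum_KG:
  assumes J: "finite J" "J \<noteq> {}"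
  shows "(\<Sum>a\<in>J \<rightarrow>\<^sub>E carrier A. \<Sum>b\<in>J \<rightarrow>\<^sub>E carrier A. f (card (KG J a b)))
    = (\<Sum>l\<le>N. wt (card J) (N - l) * (\<Sum>k\<le>N. wt (card J) (N - k)
        * (f (q ^ (N + max l k * (card J - 1) + min l k * card J)) :: complex)))"
proof -
  define e where "e l k = N + max l k * (card J - 1) + min l k * card J" for l k :: nat
  have card: "card (KG J a b) = q ^ e l k" if lk: "l \<le> N" "k \<le> N" and a: "a \<in> D J l" and b: "b \<in> D J k" for a b l k
  proof (cases "l \<le> k")
    case True
    then show ?thesis using card_KG[OF J True lk(2) a b] by (simp add: e_def max_def min_def)
  next
    case False
    then have "k \<le> l" by simp
    have "card (KG J a b) = card (KG J b a)"
      using card_KG_sym[OF subsetD[OF D_sub b] subsetD[OF D_sub a]] .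
    then show ?thesis using card_KG[OF J \<open>k \<le> l\<close> lk(1) b a] False
      by (auto simp: e_def max_def min_def)
  qed
  have inner: "(\<Sum>b\<in>J \<rightarrow>\<^sub>E carrier A. f (card (KG J a b))) = (\<Sum>k\<le>N. wt (card J) (N - k) * f (q ^ e l k))"
    if "l \<le> N" "a \<in> D J l" for a l
    using sum_D_const[OF J(1), of 0 "\<lambda>b. f (card (KG J a b))" "\<lambda>k. f (q ^ e l k)"] card[OF that(1) _ that(2)]
    by (simp add: I_0 atLeast0AtMost)
  show ?thesis
    using sum_D_const[OF J(1), of 0 "\<lambda>a. \<Sum>b\<in>J \<rightarrow>\<^sub>E carrier A. f (card (KG J a b))"
        "\<lambda>l. \<Sum>k\<le>N. wt (card J) (N - k) * f (q ^ e l k)"] inner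
    by (simp add: I_0 atLeast0AtMost e_def)
qed

text \<open>The substitution of d - t c for d carries one solution set to the other; it is the same
  unipotent change of coordinates that takes (a, b) to (a, y).\<close>

lemma card_KH_shift:
  assumes t: "t \<in> carrier A" and a: "\<And>i. i \<in> J \<Longrightarrow> a i \<in> carrier A" and y: "\<And>i. i \<in> J \<Longrightarrow> y i \<in> carrier A"
    and b: "\<And>i. i \<in> J \<Longrightarrow> b i = t \<otimes> a i \<oplus> y i"
  shows "card (KH J a b) = card (KH J a y)"
proof (rule bij_betw_same_card)
  let ?E = "J \<rightarrow>\<^sub>E carrier A"
  have iff: "(c, d) \<in> KH J a b \<longleftrightarrow> (c, \<lambda>i\<in>J. d i \<ominus> t \<otimes> c i) \<in> KH J a y" if cd: "c \<in> ?E" "d \<in> ?E" for c d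
  proof -
    have cc: "\<And>i. i \<in> J \<Longrightarrow> c i \<in> carrier A" and dc: "\<And>i. i \<in> J \<Longrightarrow> d i \<in> carrier A" using cd by auto
    have 1: "a i \<otimes> d i = c i \<otimes> b i \<longleftrightarrow> a i \<otimes> (d i \<ominus> t \<otimes> c i) = c i \<otimes> y i" if i: "i \<in> J" for i
    proof -
      have "a i \<otimes> d i = c i \<otimes> b i \<longleftrightarrow> a i \<otimes> d i \<ominus> c i \<otimes> (t \<otimes> a i \<oplus> y i) = \<zero>"
        using i a y cc dc t by (simp add: b)
      also have "\<dots> \<longleftrightarrow> a i \<otimes> (d i \<ominus> t \<otimes> c i) = c i \<otimes> y i"
        unfolding shift_identity_diag[OF t a[OF i] cc[OF i] dc[OF i] y[OF i]] using i a y cc dc t by simp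
      finally show ?thesis .
    qed
    have 2: "a i \<otimes> d j \<oplus> a j \<otimes> d i = c i \<otimes> b j \<oplus> c j \<otimes> b i \<longleftrightarrow>
        a i \<otimes> (d j \<ominus> t \<otimes> c j) \<oplus> a j \<otimes> (d i \<ominus> t \<otimes> c i) = c i \<otimes> y j \<oplus> c j \<otimes> y i" if i: "i \<in> J" and j: "j \<in> J" for i j
    proof -
      have "a i \<otimes> d j \<oplus> a j \<otimes> d i = c i \<otimes> b j \<oplus> c j \<otimes> b i \<longleftrightarrow>
        (a i \<otimes> d j \<oplus> a j \<otimes> d i) \<ominus> (c i \<otimes> (t \<otimes> a j \<oplus> y j) \<oplus> c j \<otimes> (t \<otimes> a i \<oplus> y i)) = \<zero>"
        using i j a y cc dc t by (simp add: b)
      also have "\<dots> \<longleftrightarrow> a i \<otimes> (d j \<ominus> t \<otimes> c j) \<oplus> a j \<otimes> (d i \<ominus> t \<otimes> c i) = c i \<otimes> y j \<oplus> c j \<otimes> y i"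
        unfolding shift_identity[OF t a[OF i] a[OF j] cc[OF i] cc[OF j] dc[OF i] dc[OF j] y[OF i] y[OF j]]
        using i j a y cc dc t by simp
      finally show ?thesis .
    qed
    show ?thesis unfolding KH_def using cd 1 2 t cc dc by auto
  qed
  have cancel: "x \<ominus> z \<oplus> z = x" "x \<oplus> z \<ominus> z = x" if "x \<in> carrier A" "z \<in> carrier A" for x z
    using that by (simp_all add: a_minus_def a_assoc l_neg r_neg)
  have ext: "(\<lambda>i\<in>J. g i) = g" if "g \<in> ?E" for g using that by (auto simp: fun_eq_iff PiE_def extensional_def)
  have r1: "(\<lambda>i\<in>J. (\<lambda>i\<in>J. d i \<ominus> t \<otimes> c i) i \<oplus> t \<otimes> c i) = d"
    and r2: "(\<lambda>i\<in>J. (\<lambda>i\<in>J. d i \<oplus> t \<otimes> c i) i \<ominus> t \<otimes> c i) = d"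
    and r3: "(\<lambda>i\<in>J. d i \<oplus> t \<otimes> c i) \<in> ?E" if cd: "c \<in> ?E" "d \<in> ?E" for c d
  proof -
    have cc: "\<And>i. i \<in> J \<Longrightarrow> c i \<in> carrier A" and dc: "\<And>i. i \<in> J \<Longrightarrow> d i \<in> carrier A" using cd by auto
    have "(\<lambda>i\<in>J. (\<lambda>i\<in>J. d i \<ominus> t \<otimes> c i) i \<oplus> t \<otimes> c i) = (\<lambda>i\<in>J. d i)"
      by (rule restrict_ext) (simp add: cancel(1)[OF dc m_closed[OF t cc]])
    then show "(\<lambda>i\<in>J. (\<lambda>i\<in>J. d i \<ominus> t \<otimes> c i) i \<oplus> t \<otimes> c i) = d" using ext[OF cd(2)] by simp
    have "(\<lambda>i\<in>J. (\<lambda>i\<in>J. d i \<oplus> t \<otimes> c i) i \<ominus> t \<otimes> c i) = (\<lambda>i\<in>J. d i)"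
      by (rule restrict_ext) (simp add: cancel(2)[OF dc m_closed[OF t cc]])
    then show "(\<lambda>i\<in>J. (\<lambda>i\<in>J. d i \<oplus> t \<otimes> c i) i \<ominus> t \<otimes> c i) = d" using ext[OF cd(2)] by simp
    show "(\<lambda>i\<in>J. d i \<oplus> t \<otimes> c i) \<in> ?E" using cc dc t by auto
  qed
  have memE: "c \<in> ?E \<and> d \<in> ?E" if "(c, d) \<in> KH J a b'" for c d b' using that by (auto simp: KH_def)
  show "bij_betw (\<lambda>(c, d). (c, \<lambda>i\<in>J. d i \<ominus> t \<otimes> c i)) (KH J a b) (KH J a y)"
  proof (rule bij_betw_byWitness[where f' = "\<lambda>(c, d). (c, \<lambda>i\<in>J. d i \<oplus> t \<otimes> c i)"])
    show "\<forall>z\<in>KH J a b. (\<lambda>(c, d). (c, \<lambda>i\<in>J. d i \<oplus> t \<otimes> c i)) ((\<lambda>(c, d). (c, \<lambda>i\<in>J. d i \<ominus> t \<otimes> c i)) z) = z"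
    proof
      fix z assume "z \<in> KH J a b"
      then obtain c d where z: "z = (c, d)" "(c, d) \<in> KH J a b" by (cases z) auto
      from memE[OF z(2)] show "(\<lambda>(c, d). (c, \<lambda>i\<in>J. d i \<oplus> t \<otimes> c i)) ((\<lambda>(c, d). (c, \<lambda>i\<in>J. d i \<ominus> t \<otimes> c i)) z) = z"
        using r1[of c d] unfolding z(1) by (simp only: prod.case) 
    qed
    show "\<forall>z\<in>KH J a y. (\<lambda>(c, d). (c, \<lambda>i\<in>J. d i \<ominus> t \<otimes> c i)) ((\<lambda>(c, d). (c, \<lambda>i\<in>J. d i \<oplus> t \<otimes> c i)) z) = z"
    proof
      fix z assume "z \<in> KH J a y"
      then obtain c d where z: "z = (c, d)" "(c, d) \<in> KH J a y" by (cases z) auto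
      from memE[OF z(2)] show "(\<lambda>(c, d). (c, \<lambda>i\<in>J. d i \<ominus> t \<otimes> c i)) ((\<lambda>(c, d). (c, \<lambda>i\<in>J. d i \<oplus> t \<otimes> c i)) z) = z"
        using r2[of c d] unfolding z(1) by (simp only: prod.case)
    qed
    show "(\<lambda>(c, d). (c, \<lambda>i\<in>J. d i \<ominus> t \<otimes> c i)) ` KH J a b \<subseteq> KH J a y"
    proof (rule image_subsetI)
      fix z assume "z \<in> KH J a b"
      then obtain c d where z: "z = (c, d)" "(c, d) \<in> KH J a b" by (cases z) auto
      then show "(\<lambda>(c, d). (c, \<lambda>i\<in>J. d i \<ominus> t \<otimes> c i)) z \<in> KH J a y"
        using iff[of c d] memE[OF z(2)] by (simp only: prod.case)
    qed
    show "(\<lambda>(c, d). (c, \<lambda>i\<in>J. d i \<oplus> t \<otimes> c i)) ` KH J a y \<subseteq> KH J a b"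
    proof (rule image_subsetI)
      fix z assume "z \<in> KH J a y"
      then obtain c d where z: "z = (c, d)" "(c, d) \<in> KH J a y" by (cases z) auto
      have m: "c \<in> ?E" "d \<in> ?E" using memE[OF z(2)] by auto
      have "(c, \<lambda>i\<in>J. (\<lambda>i\<in>J. d i \<oplus> t \<otimes> c i) i \<ominus> t \<otimes> c i) \<in> KH J a y" unfolding r2[OF m] by (rule z(2))
      then have "(c, \<lambda>i\<in>J. d i \<oplus> t \<otimes> c i) \<in> KH J a b" using iff[OF m(1) r3[OF m]] by blast
      then show "(\<lambda>(c, d). (c, \<lambda>i\<in>J. d i \<oplus> t \<otimes> c i)) z \<in> KH J a b" unfolding z(1) by (simp only: prod.case)
    qed
  qed
qed

text \<open>With \<open>p\<close> a position where \<open>a\<close> attains its valuation, subtracting from \<open>b\<close> a multiple of \<open>a\<close> that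
  clears the entry at \<open>p\<close> leaves \<open>card (KH J a b)\<close> unchanged.\<close>

lemma sum_KH_inner:
  assumes J: "finite J" "card J \<ge> 2" and l: "l \<le> \<kappa>" "\<kappa> \<le> N" and a: "a \<in> D J l"
  shows "(\<Sum>b\<in>J \<rightarrow>\<^sub>E I \<kappa>. f (card (KH J a b)))
    = of_nat q ^ (N - \<kappa>) * (\<Sum>k=\<kappa>..N. wt (card J - 1) (N - k) * (f (q ^ (N + k * (card J - 1) + l * card J)) :: complex))"
proof -
  have lN: "l \<le> N" and Jne: "J \<noteq> {}" using l J by auto
  obtain p a' where p: "p \<in> J" "a' p \<in> Units A"
    and a': "\<And>j. j \<in> J \<Longrightarrow> a' j \<in> carrier A" "\<And>j. j \<in> J \<Longrightarrow> a j = \<pi> [^] l \<otimes> a' j"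
    using D_obtain[OF a lN Jne] by metis
  have ne: "J - {p} \<noteq> {}"
  proof
    assume "J - {p} = {}"
    then have "J \<subseteq> {p}" by blast
    then have "card J \<le> 1" using card_mono[of "{p}" J] by simp
    then show False using J(2) by simp
  qed
  define v where "v = inv (a' p)"
  have v: "v \<in> carrier A" "v \<otimes> a' p = \<one>" unfolding v_def using p(2) by auto
  define w where "w j = v \<otimes> a' j" for j
  have wc: "w j \<in> carrier A" if "j \<in> J" for j unfolding w_def using v a' that by simp
  have wp: "w p = \<one>" unfolding w_def by (rule v(2))
  \<comment> \<open>Coordinates (t, y) on vectors: w is a' scaled to have entry 1 at p, so t is the
    entry at p and y is what remains elsewhere after subtracting t w.\<close>
  define ex where "ex t y = (\<lambda>j\<in>J. t \<otimes> w j \<oplus> (if j = p then \<zero> else y j))" for t and y :: "nat \<Rightarrow> 'a"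
  let ?Y = "(J - {p}) \<rightarrow>\<^sub>E I \<kappa>"
  have ac: "a j \<in> carrier A" if "j \<in> J" for j using a'(1)[OF that] a'(2)[OF that] pow_carr by simp
  have Ic: "x \<in> carrier A" if "x \<in> I \<kappa>" for x using that I_sub by blast
  have shift: "card (KH J a (ex t y)) = card (KH J a (ex \<zero> y))" if t: "t \<in> I \<kappa>" and y: "y \<in> ?Y" for t y
  proof -
    have yc: "y j \<in> carrier A" if "j \<in> J" "j \<noteq> p" for j using y that by (auto intro: Ic)
    obtain t' where t': "t' \<in> carrier A" "t = \<pi> [^] \<kappa> \<otimes> t'" using t by (rule I_memE)
    \<comment> \<open>As t is divisible by \<pi>^\<kappa> and l \<le> \<kappa>, the vector t w is a
      multiple of a itself and not merely of a'. This is why b must have at least the valuation of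
      a.\<close>
    define \<tau> where "\<tau> = \<pi> [^] (\<kappa> - l) \<otimes> t' \<otimes> v"
    have \<tau>: "\<tau> \<in> carrier A" unfolding \<tau>_def using t' v pow_carr by simp
    have tw: "t \<otimes> w j = \<tau> \<otimes> a j" if j: "j \<in> J" for j
      unfolding t'(2) pow_split[OF l(1)] \<tau>_def w_def a'(2)[OF j]
      using a'(1)[OF j] v(1) t'(1) pow_carr[of l] pow_carr[of "\<kappa> - l"] by (simp add: m_ac)
    show ?thesis
    proof (rule card_KH_shift[OF \<tau> ac])
      fix j assume j: "j \<in> J"
      show "ex \<zero> y j \<in> carrier A" using j yc wc by (simp add: ex_def)
      show "ex t y j = \<tau> \<otimes> a j \<oplus> ex \<zero> y j"
        using j yc wc tw \<tau> ac by (simp add: ex_def)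
    qed
  qed
  have bij: "bij_betw (\<lambda>(t, y). ex t y) (I \<kappa> \<times> ?Y) (J \<rightarrow>\<^sub>E I \<kappa>)"
  proof (rule bij_betw_byWitness[where f' = "\<lambda>b. (b p, \<lambda>j\<in>J - {p}. b j \<ominus> b p \<otimes> w j)"])
    show "\<forall>z\<in>I \<kappa> \<times> ?Y. (\<lambda>b. (b p, \<lambda>j\<in>J - {p}. b j \<ominus> b p \<otimes> w j)) ((\<lambda>(t, y). ex t y) z) = z"
    proof
      fix z assume "z \<in> I \<kappa> \<times> ?Y"
      then obtain t y where z: "z = (t, y)" "t \<in> I \<kappa>" "y \<in> ?Y" by blast
      have tc: "t \<in> carrier A" using z Ic by blast
      have yc: "y j \<in> carrier A" if "j \<in> J" "j \<noteq> p" for j using z(3) that by (auto intro: Ic)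
      have ep: "ex t y p = t" using p tc wp by (simp add: ex_def)
      have "(\<lambda>j\<in>J - {p}. ex t y j \<ominus> t \<otimes> w j) = (\<lambda>j\<in>J - {p}. y j)"
        by (rule restrict_ext) (use yc wc tc add_minus_cancel_left in \<open>auto simp: ex_def\<close>)
      also have "\<dots> = y" using z(3) by (auto simp: fun_eq_iff PiE_def extensional_def)
      finally show "(\<lambda>b. (b p, \<lambda>j\<in>J - {p}. b j \<ominus> b p \<otimes> w j)) ((\<lambda>(t, y). ex t y) z) = z" by (simp add: z(1) ep)
    qed
    show "\<forall>b\<in>J \<rightarrow>\<^sub>E I \<kappa>. (\<lambda>(t, y). ex t y) (b p, \<lambda>j\<in>J - {p}. b j \<ominus> b p \<otimes> w j) = b"
    proof
      fix b assume b: "b \<in> J \<rightarrow>\<^sub>E I \<kappa>"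
      then have bc: "b j \<in> carrier A" if "j \<in> J" for j using that Ic by auto
      have c: "x \<oplus> (y \<ominus> x) = y" if "x \<in> carrier A" "y \<in> carrier A" for x y
        by (use that in algebra)
      have "ex (b p) (\<lambda>j\<in>J - {p}. b j \<ominus> b p \<otimes> w j) = (\<lambda>j\<in>J. b j)"
        unfolding ex_def by (rule restrict_ext) (use bc p wc wp c in auto)
      also have "\<dots> = b" using b by (auto simp: fun_eq_iff PiE_def extensional_def)
      finally show "(\<lambda>(t, y). ex t y) (b p, \<lambda>j\<in>J - {p}. b j \<ominus> b p \<otimes> w j) = b" by simp
    qed
    show "(\<lambda>(t, y). ex t y) ` (I \<kappa> \<times> ?Y) \<subseteq> J \<rightarrow>\<^sub>E I \<kappa>"
      using wc by (auto simp: ex_def intro!: I_add I_mult I_zero)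
    show "(\<lambda>b. (b p, \<lambda>j\<in>J - {p}. b j \<ominus> b p \<otimes> w j)) ` (J \<rightarrow>\<^sub>E I \<kappa>) \<subseteq> I \<kappa> \<times> ?Y"
    proof (rule image_subsetI)
      fix b assume b: "b \<in> J \<rightarrow>\<^sub>E I \<kappa>"
      have "b j \<ominus> b p \<otimes> w j \<in> I \<kappa>" if "j \<in> J - {p}" for j
        using that PiE_mem[OF b] p(1) wc by (intro I_minus I_mult) auto
      then show "(b p, \<lambda>j\<in>J - {p}. b j \<ominus> b p \<otimes> w j) \<in> I \<kappa> \<times> ?Y"
        using PiE_mem[OF b p(1)] by (simp add: restrict_PiE_iff)
    qed
  qed
  have "(\<Sum>b\<in>J \<rightarrow>\<^sub>E I \<kappa>. f (card (KH J a b))) = (\<Sum>z\<in>I \<kappa> \<times> ?Y. f (card (KH J a ((\<lambda>(t, y). ex t y) z))))"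
    by (rule sum.reindex_bij_betw[OF bij, symmetric])
  also have "\<dots> = (\<Sum>(t, y)\<in>I \<kappa> \<times> ?Y. f (card (KH J a (ex \<zero> y))))"
    by (rule sum.cong[OF refl]) (use shift in auto)
  also have "\<dots> = (\<Sum>t\<in>I \<kappa>. \<Sum>y\<in>?Y. f (card (KH J a (ex \<zero> y))))" by (rule sum.cartesian_product[symmetric])
  also have "\<dots> = of_nat q ^ (N - \<kappa>) * (\<Sum>y\<in>?Y. f (card (KH J a (ex \<zero> y))))" using card_I[OF l(2)] by simp
  also have "(\<Sum>y\<in>?Y. f (card (KH J a (ex \<zero> y))))
    = (\<Sum>k=\<kappa>..N. wt (card (J - {p})) (N - k) * f (q ^ (N + k * (card J - 1) + l * card J)))"
  proof (rule sum_D_const[OF _ l(2)])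
    show "finite (J - {p})" using J by simp
    fix k y assume k: "\<kappa> \<le> k" "k \<le> N" and y: "y \<in> D (J - {p}) k"
    have yE: "y \<in> (J - {p}) \<rightarrow>\<^sub>E carrier A" using y D_sub by blast
    have "restrict (ex \<zero> y) (J - {p}) = (\<lambda>j\<in>J - {p}. y j)"
      by (rule restrict_ext) (use PiE_mem[OF yE] wc in \<open>auto simp: ex_def\<close>)
    also have "\<dots> = y" using yE by (auto simp: fun_eq_iff PiE_def extensional_def)
    finally have re: "restrict (ex \<zero> y) (J - {p}) \<in> D (J - {p}) k" using y by simp
    have ep: "ex \<zero> y p = \<zero>" using p wp by (simp add: ex_def)
    show "f (card (KH J a (ex \<zero> y))) = f (q ^ (N + k * (card J - 1) + l * card J))"
      using card_KH[where a' = a' and a = a and b = "ex \<zero> y",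
          OF J(1) p(1) order.trans[OF l(1) k(1)] k(2) p(2) a' ep re ne] by simp
  qed
  finally show ?thesis using p J by simp
qed

text \<open>The triangle with the diagonal uses \<kappa> = l, the strict one \<kappa> = l + 1. The
  latter is empty for l = N, which explains the case distinction.\<close>

lemma sum_KH:
  assumes J: "finite J" "card J \<ge> 2"
  shows "(\<Sum>a\<in>J \<rightarrow>\<^sub>E carrier A. \<Sum>b\<in>J \<rightarrow>\<^sub>E carrier A. f (card (KH J a b)))
    = (\<Sum>l\<le>N. wt (card J) (N - l) *
        (of_nat q ^ (N - l) * (\<Sum>k=l..N. wt (card J - 1) (N - k) * f (q ^ (N + k * (card J - 1) + l * card J))) +
         (if l < N then of_nat q ^ (N - Suc l) * (\<Sum>k=Suc l..N. wt (card J - 1) (N - k) *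
            (f (q ^ (N + k * (card J - 1) + l * card J)) :: complex)) else 0)))"
proof -
  let ?E = "J \<rightarrow>\<^sub>E carrier A"
  define M where "M l k = (\<Sum>a\<in>D J l. \<Sum>b\<in>D J k. f (card (KH J a b)))" for l k
  have sumE: "(\<Sum>v\<in>?E. g v) = (\<Sum>k\<le>N. \<Sum>v\<in>D J k. g v)" for g :: "(nat \<Rightarrow> 'a) \<Rightarrow> complex"
    using sum_D[OF J(1), of 0 g] by (simp add: I_0 atLeast0AtMost)
  have "(\<Sum>a\<in>?E. \<Sum>b\<in>?E. f (card (KH J a b))) = (\<Sum>l\<le>N. \<Sum>a\<in>D J l. \<Sum>k\<le>N. \<Sum>b\<in>D J k. f (card (KH J a b)))"
    unfolding sumE by simp
  also have "\<dots> = (\<Sum>l\<le>N. \<Sum>k\<le>N. M l k)" unfolding M_def by (intro sum.cong refl sum.swap)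
  also have "\<dots> = (\<Sum>l\<le>N. (\<Sum>k=l..N. M l k) + (\<Sum>k=Suc l..N. M l k))"
  proof (rule sum_symmetric_triangles)
    fix l k
    have "M l k = (\<Sum>b\<in>D J k. \<Sum>a\<in>D J l. f (card (KH J a b)))" unfolding M_def by (rule sum.swap)
    also have "\<dots> = (\<Sum>b\<in>D J k. \<Sum>a\<in>D J l. f (card (KH J b a)))"
      by (intro sum.cong refl arg_cong[of _ _ f] card_KH_sym) (use D_sub in blast)+
    finally show "M l k = M k l" unfolding M_def .
  qed
  also have "\<dots> = (\<Sum>l\<le>N. wt (card J) (N - l) *
        (of_nat q ^ (N - l) * (\<Sum>k=l..N. wt (card J - 1) (N - k) * f (q ^ (N + k * (card J - 1) + l * card J))) +
         (if l < N then of_nat q ^ (N - Suc l) * (\<Sum>k=Suc l..N. wt (card J - 1) (N - k) *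
            f (q ^ (N + k * (card J - 1) + l * card J))) else 0)))"
  proof (rule sum.cong[OF refl])
    fix l assume "l \<in> {..N}"
    then have l: "l \<le> N" by simp
    have part: "(\<Sum>k=\<kappa>..N. M l k) = wt (card J) (N - l) *
        (of_nat q ^ (N - \<kappa>) * (\<Sum>k=\<kappa>..N. wt (card J - 1) (N - k) * f (q ^ (N + k * (card J - 1) + l * card J))))"
      if \<kappa>: "l \<le> \<kappa>" "\<kappa> \<le> N" for \<kappa>
    proof -
      have "(\<Sum>k=\<kappa>..N. M l k) = (\<Sum>a\<in>D J l. \<Sum>k=\<kappa>..N. \<Sum>b\<in>D J k. f (card (KH J a b)))"
        unfolding M_def by (rule sum.swap)
      also have "\<dots> = (\<Sum>a\<in>D J l. \<Sum>b\<in>J \<rightarrow>\<^sub>E I \<kappa>. f (card (KH J a b)))"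
        using sum_D[OF J(1) \<kappa>(2)] by simp
      also have "\<dots> = (\<Sum>a\<in>D J l. of_nat q ^ (N - \<kappa>) * (\<Sum>k=\<kappa>..N. wt (card J - 1) (N - k) * f (q ^ (N + k * (card J - 1) + l * card J))))"
        by (rule sum.cong[OF refl]) (rule sum_KH_inner[OF J \<kappa>])
      finally show ?thesis using card_D[OF J(1) l] by simp
    qed
    show "(\<Sum>k=l..N. M l k) + (\<Sum>k=Suc l..N. M l k) = wt (card J) (N - l) *
        (of_nat q ^ (N - l) * (\<Sum>k=l..N. wt (card J - 1) (N - k) * f (q ^ (N + k * (card J - 1) + l * card J))) +
         (if l < N then of_nat q ^ (N - Suc l) * (\<Sum>k=Suc l..N. wt (card J - 1) (N - k) *
            f (q ^ (N + k * (card J - 1) + l * card J))) else 0))"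
      using part[of l] part[of "Suc l"] l by (auto simp: distrib_left)
  qed
  finally show ?thesis .
qed

end

section \<open>Zeta functions over a finite chain ring\<close>

lemma bij_PiE_reindex:
  assumes g: "inj_on g J"
  shows "bij_betw (\<lambda>x. \<lambda>i\<in>J. x (g i)) (g ` J \<rightarrow>\<^sub>E S) (J \<rightarrow>\<^sub>E S)"
proof (rule bij_betw_byWitness[where f' = "\<lambda>y. \<lambda>u\<in>g ` J. y (inv_into J g u)"])
  show "\<forall>a\<in>g ` J \<rightarrow>\<^sub>E S. (\<lambda>u\<in>g ` J. (\<lambda>i\<in>J. a (g i)) (inv_into J g u)) = a"
    using g by (auto simp: fun_eq_iff PiE_def extensional_def)
  show "\<forall>a'\<in>J \<rightarrow>\<^sub>E S. (\<lambda>i\<in>J. (\<lambda>u\<in>g ` J. a' (inv_into J g u)) (g i)) = a'"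
    using g by (auto simp: fun_eq_iff PiE_def extensional_def)
qed (use g in auto)

lemma bij_PiE_pair:
  assumes g: "inj_on g J" and h: "inj_on h J" and gh: "g ` J \<inter> h ` J = {}"
  shows "bij_betw (\<lambda>x. (\<lambda>i\<in>J. x (g i), \<lambda>i\<in>J. x (h i))) (g ` J \<union> h ` J \<rightarrow>\<^sub>E S) ((J \<rightarrow>\<^sub>E S) \<times> (J \<rightarrow>\<^sub>E S))"
proof (rule bij_betw_byWitness[where
      f' = "\<lambda>(a, b). \<lambda>u\<in>g ` J \<union> h ` J. if u \<in> g ` J then a (inv_into J g u) else b (inv_into J h u)"])
  have hg: "h i \<notin> g ` J" if "i \<in> J" for i using gh that by blast
  show "\<forall>a\<in>g ` J \<union> h ` J \<rightarrow>\<^sub>E S. (\<lambda>(a, b). \<lambda>u\<in>g ` J \<union> h ` J. if u \<in> g ` J then a (inv_into J g u) else b (inv_into J h u))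
      ((\<lambda>i\<in>J. a (g i), \<lambda>i\<in>J. a (h i))) = a"
  proof
    fix a assume a: "a \<in> g ` J \<union> h ` J \<rightarrow>\<^sub>E S"
    show "(\<lambda>(a, b). \<lambda>u\<in>g ` J \<union> h ` J. if u \<in> g ` J then a (inv_into J g u) else b (inv_into J h u))
      ((\<lambda>i\<in>J. a (g i), \<lambda>i\<in>J. a (h i))) = a"
    proof
      fix u
      consider "u \<in> g ` J" | "u \<in> h ` J" "u \<notin> g ` J" | "u \<notin> g ` J \<union> h ` J" by blast
      then show "(\<lambda>(a, b). \<lambda>u\<in>g ` J \<union> h ` J. if u \<in> g ` J then a (inv_into J g u) else b (inv_into J h u))
        ((\<lambda>i\<in>J. a (g i), \<lambda>i\<in>J. a (h i))) u = a u"
        by cases (use a in \<open>auto simp: f_inv_into_f inv_into_into PiE_def extensional_def\<close>)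
    qed
  qed
  show "\<forall>z\<in>(J \<rightarrow>\<^sub>E S) \<times> (J \<rightarrow>\<^sub>E S). (\<lambda>x. (\<lambda>i\<in>J. x (g i), \<lambda>i\<in>J. x (h i))) ((\<lambda>(a, b). \<lambda>u\<in>g ` J \<union> h ` J. if u \<in> g ` J then a (inv_into J g u) else b (inv_into J h u)) z) = z"
    using g h hg by (auto simp: fun_eq_iff PiE_def extensional_def)
  show "(\<lambda>x. (\<lambda>i\<in>J. x (g i), \<lambda>i\<in>J. x (h i))) ` (g ` J \<union> h ` J \<rightarrow>\<^sub>E S) \<subseteq> (J \<rightarrow>\<^sub>E S) \<times> (J \<rightarrow>\<^sub>E S)"
    by auto
  show "(\<lambda>(a, b). \<lambda>u\<in>g ` J \<union> h ` J. if u \<in> g ` J then a (inv_into J g u) else b (inv_into J h u)) ` ((J \<rightarrow>\<^sub>E S) \<times> (J \<rightarrow>\<^sub>E S)) \<subseteq> g ` J \<union> h ` J \<rightarrow>\<^sub>E S"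
  proof (rule image_subsetI)
    fix z assume "z \<in> (J \<rightarrow>\<^sub>E S) \<times> (J \<rightarrow>\<^sub>E S)"
    then obtain a b where z: "z = (a, b)" "a \<in> J \<rightarrow>\<^sub>E S" "b \<in> J \<rightarrow>\<^sub>E S" by blast
    have "a (inv_into J g u) \<in> S" if "u \<in> g ` J" for u using PiE_mem[OF z(2) inv_into_into[OF that]] .
    moreover have "b (inv_into J h u) \<in> S" if "u \<in> h ` J" for u using PiE_mem[OF z(3) inv_into_into[OF that]] .
    ultimately show "(\<lambda>(a, b). \<lambda>u\<in>g ` J \<union> h ` J. if u \<in> g ` J then a (inv_into J g u) else b (inv_into J h u)) z \<in> g ` J \<union> h ` J \<rightarrow>\<^sub>E S"
      unfolding z(1) by auto
  qed
qed

lemma bij_betw_Collect: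
  assumes "bij_betw \<phi> E E'" "\<And>z. z \<in> E \<Longrightarrow> L z \<longleftrightarrow> L' (\<phi> z)"
  shows "card {z \<in> E. L z} = card {y \<in> E'. L' y}"
proof (rule bij_betw_same_card)
  show "bij_betw \<phi> {z \<in> E. L z} {y \<in> E'. L' y}"
    using assms unfolding bij_betw_def inj_on_def by auto
qed

lemma sum_atMost_reverse: "(\<Sum>k\<le>N. f (N - k)) = (\<Sum>l\<le>(N::nat). f l)"
  by (rule sum.reindex_bij_witness[where i = "\<lambda>l. N - l" and j = "\<lambda>k. N - k"]) auto

lemma sum_interval_reverse: "l \<le> N \<Longrightarrow> (\<Sum>k=l..N. f (N - k)) = (\<Sum>k\<le>N - (l::nat). f k)"
  by (rule sum.reindex_bij_witness[where i = "\<lambda>l. N - l" and j = "\<lambda>k. N - k"]) auto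

section \<open>Brackets whose coordinates have one or two terms\<close>

context class2_points
begin

lemma finsum_delta: "p \<in> basis \<Lambda> \<Longrightarrow> t \<in> carrier A \<Longrightarrow> (\<Oplus>j\<in>basis \<Lambda>. if p = j then t else \<zero>) = t"
  using finsum_singleton[OF _ finB, of p "\<lambda>_. t"] by simp

lemma if_closed: "t \<in> carrier A \<Longrightarrow> (if b then t else \<zero>) \<in> carrier A" by simp

text \<open>The sign arises because \<open>beta\<close> retains pairs with the larger index first,
  where the bracket is minus a basis element.\<close>

lemma beta_one:
  assumes pr: "p \<in> Xs" "r \<in> Xs" and c: "\<And>u v. beta_coeff \<Lambda> u v w = (if u = p \<and> v = r then - 1 else 0)"
    and g: "g \<in> V" "h \<in> V"
  shows "beta \<Lambda> A g h w = \<ominus> (g p \<otimes> h r)"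
proof -
  have m1: "[(- 1 :: int)] \<cdot>\<^bsub>A\<^esub> x = \<ominus> x" if "x \<in> carrier A" for x
    using that add.int_pow_neg[of x 1] by (simp add: add.int_pow_1)
  have t: "\<ominus> (g p \<otimes> h r) \<in> carrier A" using g pr V_memD by simp
  have B: "p \<in> basis \<Lambda>" "r \<in> basis \<Lambda>" using pr X_sub by auto
  have 1: "[beta_coeff \<Lambda> u v w] \<cdot>\<^bsub>A\<^esub> (g u \<otimes> h v) = (if r = v then (if p = u then \<ominus> (g p \<otimes> h r) else \<zero>) else \<zero>)" for u v
    using m1[of "g p \<otimes> h r"] g pr V_memD by (auto simp: c zero_smult)
  have 2: "(\<Oplus>v\<in>basis \<Lambda>. [beta_coeff \<Lambda> u v w] \<cdot>\<^bsub>A\<^esub> (g u \<otimes> h v)) = (if p = u then \<ominus> (g p \<otimes> h r) else \<zero>)" for u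
    unfolding 1 by (rule finsum_delta[OF B(2) if_closed[OF t]])
  show ?thesis unfolding beta_def 2
    by (rule finsum_delta[OF B(1) t])
qed

lemma beta_two:
  assumes pr: "p \<in> Xs" "r \<in> Xs" "p' \<in> Xs" "r' \<in> Xs" "p \<noteq> p'"
    and c: "\<And>u v. beta_coeff \<Lambda> u v w = (if u = p \<and> v = r \<or> u = p' \<and> v = r' then - 1 else 0)"
    and g: "g \<in> V" "h \<in> V"
  shows "beta \<Lambda> A g h w = \<ominus> (g p \<otimes> h r) \<oplus> \<ominus> (g p' \<otimes> h r')"
proof -
  have m1: "[(- 1 :: int)] \<cdot>\<^bsub>A\<^esub> x = \<ominus> x" if "x \<in> carrier A" for x
    using that add.int_pow_neg[of x 1] by (simp add: add.int_pow_1)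
  have t: "\<ominus> (g p \<otimes> h r) \<in> carrier A" "\<ominus> (g p' \<otimes> h r') \<in> carrier A" using g pr V_memD by simp_all
  have B: "p \<in> basis \<Lambda>" "r \<in> basis \<Lambda>" "p' \<in> basis \<Lambda>" "r' \<in> basis \<Lambda>" using pr X_sub by auto
  have 1: "[beta_coeff \<Lambda> u v w] \<cdot>\<^bsub>A\<^esub> (g u \<otimes> h v) =
      (if r = v then (if p = u then \<ominus> (g p \<otimes> h r) else \<zero>) else \<zero>) \<oplus>
      (if r' = v then (if p' = u then \<ominus> (g p' \<otimes> h r') else \<zero>) else \<zero>)" for u v
    using m1[of "g p \<otimes> h r"] m1[of "g p' \<otimes> h r'"] g pr V_memD t by (auto simp: c zero_smult)
  have 2: "(\<Oplus>v\<in>basis \<Lambda>. [beta_coeff \<Lambda> u v w] \<cdot>\<^bsub>A\<^esub> (g u \<otimes> h v)) =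
      (if p = u then \<ominus> (g p \<otimes> h r) else \<zero>) \<oplus> (if p' = u then \<ominus> (g p' \<otimes> h r') else \<zero>)" for u
  proof -
    have "(\<Oplus>v\<in>basis \<Lambda>. [beta_coeff \<Lambda> u v w] \<cdot>\<^bsub>A\<^esub> (g u \<otimes> h v)) =
      (\<Oplus>v\<in>basis \<Lambda>. if r = v then (if p = u then \<ominus> (g p \<otimes> h r) else \<zero>) else \<zero>) \<oplus>
      (\<Oplus>v\<in>basis \<Lambda>. if r' = v then (if p' = u then \<ominus> (g p' \<otimes> h r') else \<zero>) else \<zero>)"
      by (rule finsum_split) (use 1 t in auto)
    moreover have "(\<Oplus>v\<in>basis \<Lambda>. if r = v then (if p = u then \<ominus> (g p \<otimes> h r) else \<zero>) else \<zero>) = (if p = u then \<ominus> (g p \<otimes> h r) else \<zero>)"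
      by (rule finsum_delta[OF B(2) if_closed[OF t(1)]])
    moreover have "(\<Oplus>v\<in>basis \<Lambda>. if r' = v then (if p' = u then \<ominus> (g p' \<otimes> h r') else \<zero>) else \<zero>) = (if p' = u then \<ominus> (g p' \<otimes> h r') else \<zero>)"
      by (rule finsum_delta[OF B(4) if_closed[OF t(2)]])
    ultimately show ?thesis by (simp only:)
  qed
  have "beta \<Lambda> A g h w = (\<Oplus>u\<in>basis \<Lambda>. if p = u then \<ominus> (g p \<otimes> h r) else \<zero>) \<oplus> (\<Oplus>u\<in>basis \<Lambda>. if p' = u then \<ominus> (g p' \<otimes> h r') else \<zero>)"
    unfolding beta_def 2 by (rule finsum_split) (use t in auto)
  then show ?thesis by (simp only: finsum_delta[OF B(1) t(1)] finsum_delta[OF B(3) t(2)])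
qed

lemma lie_one_zero_iff:
  assumes pr: "p \<in> Xs" "r \<in> Xs" and c: "\<And>u v. beta_coeff \<Lambda> u v w = (if u = p \<and> v = r then - 1 else 0)"
    and g: "z \<in> V" "x \<in> V"
  shows "lie z x w = \<zero> \<longleftrightarrow> x r \<otimes> z p = z r \<otimes> x p"
proof -
  have m: "z p \<in> carrier A" "z r \<in> carrier A" "x p \<in> carrier A" "x r \<in> carrier A" using g pr V_memD by auto
  have "lie z x w = \<zero> \<longleftrightarrow> \<ominus> (z p \<otimes> x r) = \<ominus> (x p \<otimes> z r)"
    unfolding lie_def beta_one[OF pr c g] beta_one[OF pr c g(2,1)] using m by simp
  also have "\<dots> \<longleftrightarrow> z p \<otimes> x r = x p \<otimes> z r" using m by (metis m_closed minus_minus)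
  finally show ?thesis using m by (simp add: m_comm)
qed

lemma lie_two_zero_iff:
  assumes pr: "p \<in> Xs" "r \<in> Xs" "p' \<in> Xs" "r' \<in> Xs" "p \<noteq> p'"
    and c: "\<And>u v. beta_coeff \<Lambda> u v w = (if u = p \<and> v = r \<or> u = p' \<and> v = r' then - 1 else 0)"
    and g: "z \<in> V" "x \<in> V"
  shows "lie z x w = \<zero> \<longleftrightarrow> x r \<otimes> z p \<oplus> x r' \<otimes> z p' = z r \<otimes> x p \<oplus> z r' \<otimes> x p'"
proof -
  have m: "z p \<in> carrier A" "z r \<in> carrier A" "x p \<in> carrier A" "x r \<in> carrier A"
    "z p' \<in> carrier A" "z r' \<in> carrier A" "x p' \<in> carrier A" "x r' \<in> carrier A" using g pr V_memD by auto
  have n: "\<ominus> a \<oplus> \<ominus> b = \<ominus> (a \<oplus> b)" if "a \<in> carrier A" "b \<in> carrier A" for a b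
    using that by (simp add: minus_add)
  have "lie z x w = \<zero> \<longleftrightarrow> \<ominus> (z p \<otimes> x r \<oplus> z p' \<otimes> x r') = \<ominus> (x p \<otimes> z r \<oplus> x p' \<otimes> z r')"
    unfolding lie_def beta_two[OF pr c g] beta_two[OF pr c g(2,1)] using m by (simp add: n)
  also have "\<dots> \<longleftrightarrow> z p \<otimes> x r \<oplus> z p' \<otimes> x r' = x p \<otimes> z r \<oplus> x p' \<otimes> z r'"
    using m by (metis a_closed m_closed minus_minus)
  finally show ?thesis using m by (simp add: m_comm)
qed

end

section \<open>The three families over a chain ring\<close>

context chain_ring
begin

text \<open>The weight of a group element is S^j when its class has q^j elements.\<close>

definition S :: "complex \<Rightarrow> complex" where "S s = of_nat q powr (- (1 + s))"

lemma quotient_powr: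
  assumes "e \<le> M"
  shows "of_real (real (q ^ M) / real (q ^ e)) powr (- (1 + s)) = S s ^ (M - e)"
proof -
  have "real (q ^ M) / real (q ^ e) = real q ^ (M - e)"
    using q assms by (simp add: power_diff)
  then have "of_real (real (q ^ M) / real (q ^ e)) = (of_nat q ^ (M - e) :: complex)" by simp
  moreover have "(of_nat q ^ j :: complex) powr z = (of_nat q powr z) ^ j" for j z
  proof (induction j)
    case (Suc j)
    have "(of_nat q ^ Suc j :: complex) powr z = (of_nat q * of_nat (q ^ j)) powr z" by simp
    also have "\<dots> = of_nat q powr z * of_nat (q ^ j) powr z" by (rule powr_times_real) auto
    finally show ?case using Suc by simp
  qed simp
  ultimately show ?thesis by (simp add: S_def)
qed

text \<open>A vector of valuation k leads to classes of q^((m - 1)(N - k)) elements. Summation over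
  l = N - k makes the sum depend on N through its range alone, apart from the power of q that counts
  the central coordinates.\<close>

theorem zeta_F:
  fixes n \<delta> :: nat
  defines "m \<equiv> 2 * n + \<delta>"
  assumes m: "m \<ge> 1"
  shows "zeta_cc (group_points (lattice_F n \<delta>) A) s =
    of_nat q ^ (N * (m choose 2)) * (\<Sum>l\<le>N. wt m l * S s ^ (l * (m - 1)))"
proof -
  define J where "J = {1..m}"
  define \<Lambda> where "\<Lambda> = lattice_F n \<delta>"
  have Yset: "{Gy i j | i j. 1 \<le> i \<and> i < j \<and> j \<le> m} = (\<lambda>(i, j). Gy i j) ` (SIGMA j:{1..m}. {1..<j})\<inverse>"
    by (auto simp: image_iff)
  have finY: "finite {Gy i j | i j. 1 \<le> i \<and> i < j \<and> j \<le> m}" unfolding Yset by (intro finite_imageI finite_converse[THEN iffD2]) auto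
  have Xset: "{Gx k | k. 1 \<le> k \<and> k \<le> m} = Gx ` J" by (auto simp: J_def)
  interpret P: class2_points A \<Lambda>
  proof (intro class2_points.intro class2_points_axioms.intro)
    show "finite (basis \<Lambda>)" using finY Xset by (simp add: \<Lambda>_def lattice_F_def m_def[symmetric] J_def)
    show "w \<in> range (\<lambda>(i, j). Gy i j)" if "(u, v, w) \<in> relations \<Lambda>" for u v w
      using that by (auto simp: \<Lambda>_def lattice_F_def)
  qed (use fin is_cring in auto)
  have Xs: "P.Xs = Gx ` J" unfolding P.Xs_def by (auto simp: \<Lambda>_def lattice_F_def m_def[symmetric] J_def)
  have Ys: "P.Ys = {Gy i j | i j. 1 \<le> i \<and> i < j \<and> j \<le> m}"
    unfolding P.Ys_def Xs by (auto simp: \<Lambda>_def lattice_F_def m_def[symmetric] J_def)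
  have cardY: "card P.Ys = m choose 2"
  proof -
    have "card P.Ys = card (SIGMA j:{1..m}. {1..<j})"
      unfolding Ys Yset by (subst card_image) (auto simp: inj_on_def card_inverse)
    also have "\<dots> = (\<Sum>j=1..m. j - 1)" by (subst card_SigmaI) auto
    also have "\<dots> = m choose 2"
      by (induction m) (auto simp: numeral_2_eq_2)
    finally show ?thesis .
  qed
  have cardX: "card P.Xs = m" unfolding Xs by (subst card_image) (auto simp: inj_on_def J_def)
  define \<phi> where "\<phi> x = (\<lambda>i\<in>J. x (Gx i))" for x :: "gen \<Rightarrow> 'a"
  have bij: "bij_betw \<phi> (P.Xs \<rightarrow>\<^sub>E carrier A) (J \<rightarrow>\<^sub>E carrier A)"
    unfolding \<phi>_def Xs by (rule bij_PiE_reindex) (simp add: inj_on_def)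
  have coeff: "beta_coeff \<Lambda> u v (Gy i j) = (if u = Gx j \<and> v = Gx i then - 1 else 0)"
    if "1 \<le> i" "i < j" "j \<le> m" for i j u v
    using that by (cases u; cases v) (auto simp: \<Lambda>_def lattice_F_def bracket_coeff_def m_def)
  have ker: "card (P.Ker x) = card (KF J (\<phi> x))" if x: "x \<in> P.Xs \<rightarrow>\<^sub>E carrier A" for x
    unfolding P.Ker_def KF_def
  proof (rule bij_betw_Collect[OF bij])
    fix z assume z: "z \<in> P.Xs \<rightarrow>\<^sub>E carrier A"
    have zc: "z (Gx i) \<in> carrier A" "x (Gx i) \<in> carrier A" if "i \<in> J" for i using z x that Xs by auto
    have lie: "P.lie z x (Gy i j) = \<zero> \<longleftrightarrow> x (Gx i) \<otimes> z (Gx j) = z (Gx i) \<otimes> x (Gx j)"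
      if "1 \<le> i" "i < j" "j \<le> m" for i j
      by (rule P.lie_one_zero_iff[OF _ _ coeff[OF that] P.XE_V[OF z] P.XE_V[OF x]]) (use that in \<open>auto simp: Xs J_def\<close>)
    have "(\<forall>w\<in>P.Ys. P.lie z x w = \<zero>) \<longleftrightarrow> (\<forall>i j. 1 \<le> i \<and> i < j \<and> j \<le> m \<longrightarrow> z (Gx i) \<otimes> x (Gx j) = z (Gx j) \<otimes> x (Gx i))"
      (is "_ \<longleftrightarrow> ?R")
    proof -
      have "(\<forall>w\<in>P.Ys. P.lie z x w = \<zero>) \<longleftrightarrow> (\<forall>i j. 1 \<le> i \<and> i < j \<and> j \<le> m \<longrightarrow> P.lie z x (Gy i j) = \<zero>)"
        unfolding Ys by blast
      also have "\<dots> \<longleftrightarrow> ?R"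
      proof (intro iff_allI imp_cong refl)
        fix i j assume ij: "1 \<le> i \<and> i < j \<and> j \<le> m"
        then have "i \<in> J" "j \<in> J" by (auto simp: J_def)
        then show "P.lie z x (Gy i j) = \<zero> \<longleftrightarrow> z (Gx i) \<otimes> x (Gx j) = z (Gx j) \<otimes> x (Gx i)"
          using lie[of i j] ij zc by (auto simp: m_comm)
      qed
      finally show ?thesis .
    qed
    also have "\<dots> \<longleftrightarrow> (\<forall>i\<in>J. \<forall>j\<in>J. z (Gx i) \<otimes> x (Gx j) = z (Gx j) \<otimes> x (Gx i))"
    proof
      assume r: ?R
      show "\<forall>i\<in>J. \<forall>j\<in>J. z (Gx i) \<otimes> x (Gx j) = z (Gx j) \<otimes> x (Gx i)"
      proof (intro ballI)
        fix i j assume "i \<in> J" "j \<in> J"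
        then show "z (Gx i) \<otimes> x (Gx j) = z (Gx j) \<otimes> x (Gx i)"
          using r by (cases i j rule: linorder_cases) (auto simp: J_def)
      qed
    qed (auto simp: J_def)
    also have "\<dots> \<longleftrightarrow> (\<forall>i\<in>J. \<forall>j\<in>J. \<phi> z i \<otimes> \<phi> x j = \<phi> z j \<otimes> \<phi> x i)" by (simp add: \<phi>_def)
    finally show "(\<forall>w\<in>P.Ys. P.lie z x w = \<zero>) \<longleftrightarrow> (\<forall>i\<in>J. \<forall>j\<in>J. \<phi> z i \<otimes> \<phi> x j = \<phi> z j \<otimes> \<phi> x i)" .
  qed
  define f where "f k = of_real (real (q ^ (N * m)) / real k) powr (- (1 + s))" for k :: nat
  have J: "finite J" "J \<noteq> {}" "card J = m" using m by (auto simp: J_def)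
  have "zeta_cc (group_points \<Lambda> A) s = of_nat ((q ^ N) ^ (m choose 2)) * (\<Sum>x\<in>P.Xs \<rightarrow>\<^sub>E carrier A. f (card (KF J (\<phi> x))))"
    unfolding P.zeta_cc_class2 card_carrier cardY cardX f_def by (simp add: ker power_mult)
  also have "(\<Sum>x\<in>P.Xs \<rightarrow>\<^sub>E carrier A. f (card (KF J (\<phi> x)))) = (\<Sum>y\<in>J \<rightarrow>\<^sub>E carrier A. f (card (KF J y)))"
    by (rule sum.reindex_bij_betw[OF bij])
  also have "\<dots> = (\<Sum>k\<le>N. wt m (N - k) * f (q ^ (N + k * (m - 1))))"
    using sum_KF[OF J(1,2), of f] by (simp add: J(3))
  also have "\<dots> = (\<Sum>k\<le>N. wt m (N - k) * S s ^ ((N - k) * (m - 1)))"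
  proof (rule sum.cong[OF refl])
    fix k assume "k \<in> {..N}"
    then have k: "k \<le> N" by simp
    obtain m' where m': "m = Suc m'" using m by (cases m) auto
    have "N * m = (N + k * (m - 1)) + (N - k) * (m - 1)" using k by (simp add: m' algebra_simps diff_mult_distrib)
    then have "N + k * (m - 1) \<le> N * m" "N * m - (N + k * (m - 1)) = (N - k) * (m - 1)" by simp_all
    then show "wt m (N - k) * f (q ^ (N + k * (m - 1))) = wt m (N - k) * S s ^ ((N - k) * (m - 1))"
      using quotient_powr[of "N + k * (m - 1)" "N * m" s] by (simp add: f_def)
  qed
  also have "\<dots> = (\<Sum>l\<le>N. wt m l * S s ^ (l * (m - 1)))" by (rule sum_atMost_reverse)
  finally show ?thesis by (simp add: \<Lambda>_def power_mult)
qed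

text \<open>Replacing valuations by remaining lengths exchanges minimum and maximum: the vector of
  smaller valuation has the larger length, which enters with coefficient n, and the other length
  with n - 1.\<close>

theorem zeta_G:
  fixes n :: nat
  assumes n: "n \<ge> 1"
  shows "zeta_cc (group_points (lattice_G n) A) s =
    of_nat q ^ (N * n ^ 2) * (\<Sum>l\<le>N. \<Sum>k\<le>N. wt n l * wt n k * S s ^ ((n - 1) * min l k + n * max l k))"
proof -
  define J where "J = {1..n}"
  define \<Lambda> where "\<Lambda> = lattice_G n"
  have Yset: "{Gy i j | i j. i \<in> {1..n} \<and> j \<in> {1..n}} = (\<lambda>(i, j). Gy i j) ` ({1..n} \<times> {1..n})"
    by (auto simp: image_iff)
  have finY: "finite {Gy i j | i j. i \<in> {1..n} \<and> j \<in> {1..n}}" unfolding Yset by (intro finite_imageI) auto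
  have Xset: "{Gx k | k. 1 \<le> k \<and> k \<le> 2 * n} = Gx ` J \<union> (\<lambda>i. Gx (n + i)) ` J"
  proof (intro equalityI subsetI)
    fix u assume "u \<in> {Gx k | k. 1 \<le> k \<and> k \<le> 2 * n}"
    then obtain k where k: "u = Gx k" "1 \<le> k" "k \<le> 2 * n" by blast
    show "u \<in> Gx ` J \<union> (\<lambda>i. Gx (n + i)) ` J"
    proof (cases "k \<le> n")
      case False
      then have "u = Gx (n + (k - n))" "k - n \<in> J" using k by (auto simp: J_def)
      then show ?thesis by blast
    qed (use k in \<open>auto simp: J_def\<close>)
  qed (auto simp: J_def)
  interpret P: class2_points A \<Lambda>
  proof (intro class2_points.intro class2_points_axioms.intro)
    show "finite (basis \<Lambda>)" using finY Xset by (simp add: \<Lambda>_def lattice_G_def J_def)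
    show "w \<in> range (\<lambda>(i, j). Gy i j)" if "(u, v, w) \<in> relations \<Lambda>" for u v w
      using that by (auto simp: \<Lambda>_def lattice_G_def)
  qed (use fin is_cring in auto)
  have "P.Xs = {Gx k | k. 1 \<le> k \<and> k \<le> 2 * n}" unfolding P.Xs_def by (auto simp: \<Lambda>_def lattice_G_def)
  then have Xs: "P.Xs = Gx ` J \<union> (\<lambda>i. Gx (n + i)) ` J" using Xset by simp
  have Ys: "P.Ys = {Gy i j | i j. i \<in> {1..n} \<and> j \<in> {1..n}}"
    unfolding P.Ys_def P.Xs_def by (auto simp: \<Lambda>_def lattice_G_def)
  have "card P.Ys = card ({1..n} \<times> {1..n})"
    unfolding Ys Yset by (rule card_image) (auto simp: inj_on_def)
  also have "\<dots> = n * n" by simp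
  finally have cardY: "card P.Ys = n ^ 2" by (simp only: monoid_mult_class.power2_eq_square)
  have inj: "inj_on Gx J" "inj_on (\<lambda>i. Gx (n + i)) J" and disj: "Gx ` J \<inter> (\<lambda>i. Gx (n + i)) ` J = {}"
    by (auto simp: inj_on_def J_def)
  have J: "finite J" "card J = n" "J \<noteq> {}" using n by (auto simp: J_def)
  have cardX: "card P.Xs = 2 * n"
    unfolding Xs using disj J by (subst card_Un_disjoint) (auto simp: card_image inj)
  define \<phi> where "\<phi> x = (\<lambda>i\<in>J. x (Gx i), \<lambda>i\<in>J. x (Gx (n + i)))" for x :: "gen \<Rightarrow> 'a"
  have bij: "bij_betw \<phi> (P.Xs \<rightarrow>\<^sub>E carrier A) ((J \<rightarrow>\<^sub>E carrier A) \<times> (J \<rightarrow>\<^sub>E carrier A))"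
    unfolding \<phi>_def Xs by (rule bij_PiE_pair[OF inj disj])
  have coeff: "beta_coeff \<Lambda> u v (Gy i j) = (if u = Gx (n + j) \<and> v = Gx i then - 1 else 0)"
    if "i \<in> J" "j \<in> J" for i j u v
    using that by (cases u; cases v) (auto simp: \<Lambda>_def lattice_G_def bracket_coeff_def J_def)
  have ker: "card (P.Ker x) = card (KG J (fst (\<phi> x)) (snd (\<phi> x)))" if x: "x \<in> P.Xs \<rightarrow>\<^sub>E carrier A" for x
  proof -
    let ?a = "fst (\<phi> x)" and ?b = "snd (\<phi> x)"
    let ?Q = "\<lambda>z. \<forall>i\<in>J. \<forall>j\<in>J. ?a i \<otimes> snd z j = fst z i \<otimes> ?b j"
    have "card (P.Ker x) = card {z \<in> (J \<rightarrow>\<^sub>E carrier A) \<times> (J \<rightarrow>\<^sub>E carrier A). ?Q z}"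
      unfolding P.Ker_def
    proof (rule bij_betw_Collect[OF bij])
      fix z assume z: "z \<in> P.Xs \<rightarrow>\<^sub>E carrier A"
      have mem: "Gx i \<in> P.Xs" "Gx (n + i) \<in> P.Xs" if "i \<in> J" for i using that Xs by auto
      have "(\<forall>w\<in>P.Ys. P.lie z x w = \<zero>) \<longleftrightarrow> (\<forall>i\<in>J. \<forall>j\<in>J. P.lie z x (Gy i j) = \<zero>)"
        unfolding Ys J_def by blast
      also have "\<dots> \<longleftrightarrow> (\<forall>i\<in>J. \<forall>j\<in>J. x (Gx i) \<otimes> z (Gx (n + j)) = z (Gx i) \<otimes> x (Gx (n + j)))"
        by (intro ball_cong refl P.lie_one_zero_iff coeff mem P.XE_V z x)
      also have "\<dots> \<longleftrightarrow> ?Q (\<phi> z)" by (simp add: \<phi>_def)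
      finally show "(\<forall>w\<in>P.Ys. P.lie z x w = \<zero>) \<longleftrightarrow> ?Q (\<phi> z)" .
    qed
    also have "{z \<in> (J \<rightarrow>\<^sub>E carrier A) \<times> (J \<rightarrow>\<^sub>E carrier A). ?Q z} = KG J ?a ?b"
      unfolding KG_def by auto
    finally show ?thesis .
  qed
  define f where "f k = of_real (real (q ^ (N * (2 * n))) / real k) powr (- (1 + s))" for k :: nat
  have "zeta_cc (group_points \<Lambda> A) s = of_nat ((q ^ N) ^ card P.Ys) * (\<Sum>x\<in>P.Xs \<rightarrow>\<^sub>E carrier A. f (card (KG J (fst (\<phi> x)) (snd (\<phi> x)))))"
    unfolding P.zeta_cc_class2 card_carrier cardX f_def by (simp add: ker power_mult)
  also have "(\<Sum>x\<in>P.Xs \<rightarrow>\<^sub>E carrier A. f (card (KG J (fst (\<phi> x)) (snd (\<phi> x)))))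
    = (\<Sum>y\<in>(J \<rightarrow>\<^sub>E carrier A) \<times> (J \<rightarrow>\<^sub>E carrier A). f (card (KG J (fst y) (snd y))))"
    by (rule sum.reindex_bij_betw[OF bij])
  also have "\<dots> = (\<Sum>a\<in>J \<rightarrow>\<^sub>E carrier A. \<Sum>b\<in>J \<rightarrow>\<^sub>E carrier A. f (card (KG J a b)))"
    by (simp add: sum.cartesian_product case_prod_unfold)
  also have "\<dots> = (\<Sum>l\<le>N. wt n (N - l) * (\<Sum>k\<le>N. wt n (N - k) * f (q ^ (N + max l k * (n - 1) + min l k * n))))"
    using sum_KG[OF J(1,3), of f] by (simp only: J(2))
  also have "\<dots> = (\<Sum>l\<le>N. \<Sum>k\<le>N. wt n (N - l) * wt n (N - k) * S s ^ ((n - 1) * min (N - l) (N - k) + n * max (N - l) (N - k)))"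
    unfolding sum_distrib_left
  proof (intro sum.cong refl)
    fix l k assume "l \<in> {..N}" "k \<in> {..N}"
    then have lk: "l \<le> N" "k \<le> N" by auto
    obtain n' where n': "n = Suc n'" using n by (cases n) auto
    have main: "N * (2 * n) = (N + b * (n - 1) + a * n) + ((n - 1) * (N - b) + n * (N - a))"
      if ab: "a \<le> b" "b \<le> N" for a b
    proof -
      obtain d where "b = a + d" using ab(1) le_Suc_ex by blast
      moreover obtain e where "N = b + e" using ab(2) le_Suc_ex by blast
      ultimately show ?thesis by (simp add: n' algebra_simps)
    qed
    have "N * (2 * n) = (N + max l k * (n - 1) + min l k * n) + ((n - 1) * min (N - l) (N - k) + n * max (N - l) (N - k))"
    proof (cases "l \<le> k")
      case True
      then have "max l k = k" "min l k = l" "min (N - l) (N - k) = N - k" "max (N - l) (N - k) = N - l" by auto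
      then show ?thesis using main[OF True lk(2)] by (simp only:)
    next
      case False
      then have "max l k = l" "min l k = k" "min (N - l) (N - k) = N - l" "max (N - l) (N - k) = N - k" by auto
      then show ?thesis using main[of k l] False lk by simp
    qed
    then have "N + max l k * (n - 1) + min l k * n \<le> N * (2 * n)"
      "N * (2 * n) - (N + max l k * (n - 1) + min l k * n) = (n - 1) * min (N - l) (N - k) + n * max (N - l) (N - k)" by simp_all
    then have "f (q ^ (N + max l k * (n - 1) + min l k * n)) = S s ^ ((n - 1) * min (N - l) (N - k) + n * max (N - l) (N - k))"
      using quotient_powr[of "N + max l k * (n - 1) + min l k * n" "N * (2 * n)" s] by (simp only: f_def)
    then show "wt n (N - l) * (wt n (N - k) * f (q ^ (N + max l k * (n - 1) + min l k * n))) =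
      wt n (N - l) * wt n (N - k) * S s ^ ((n - 1) * min (N - l) (N - k) + n * max (N - l) (N - k))" by simp
  qed
  also have "\<dots> = (\<Sum>l\<le>N. \<Sum>k\<le>N. wt n (N - l) * wt n k * S s ^ ((n - 1) * min (N - l) k + n * max (N - l) k))"
    by (rule sum.cong[OF refl])
      (rule sum_atMost_reverse[where f = "\<lambda>k. wt n (N - l) * wt n k * S s ^ ((n - 1) * min (N - l) k + n * max (N - l) k)" for l])
  also have "\<dots> = (\<Sum>l\<le>N. \<Sum>k\<le>N. wt n l * wt n k * S s ^ ((n - 1) * min l k + n * max l k))"
    by (rule sum_atMost_reverse[where f = "\<lambda>l. \<Sum>k\<le>N. wt n l * wt n k * S s ^ ((n - 1) * min l k + n * max l k)"])
  finally show ?thesis unfolding cardY power_mult[symmetric] of_nat_power unfolding \<Lambda>_def .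
qed

text \<open>Here l is the length left by a, and k that of b after clearing an entry. The factors q^l
  and q^(l - 1) count the multiples t that were split off from b, for the triangle with and without
  the diagonal.\<close>

theorem zeta_H:
  fixes n :: nat
  assumes n: "n \<ge> 2"
  shows "zeta_cc (group_points (lattice_H n) A) s =
    of_nat q ^ (N * ((n + 1) choose 2)) * (\<Sum>l\<le>N. wt n l *
      (of_nat q ^ l * (\<Sum>k\<le>l. wt (n - 1) k * S s ^ (k * (n - 1) + l * n)) +
       (if l = 0 then 0 else of_nat q ^ (l - 1) * (\<Sum>k\<le>l - 1. wt (n - 1) k * S s ^ (k * (n - 1) + l * n)))))"
proof -
  define J where "J = {1..n}"
  define \<Lambda> where "\<Lambda> = lattice_H n"
  have Yset: "{Gy i j | i j. 1 \<le> i \<and> i \<le> j \<and> j \<le> n} = (\<lambda>(i, j). Gy i j) ` (SIGMA i:{1..n}. {i..n})"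
    by (auto simp: image_iff)
  have finY: "finite {Gy i j | i j. 1 \<le> i \<and> i \<le> j \<and> j \<le> n}" unfolding Yset by (intro finite_imageI) auto
  have Xset: "{Gx k | k. 1 \<le> k \<and> k \<le> 2 * n} = Gx ` J \<union> (\<lambda>i. Gx (n + i)) ` J"
  proof (intro equalityI subsetI)
    fix u assume "u \<in> {Gx k | k. 1 \<le> k \<and> k \<le> 2 * n}"
    then obtain k where k: "u = Gx k" "1 \<le> k" "k \<le> 2 * n" by blast
    show "u \<in> Gx ` J \<union> (\<lambda>i. Gx (n + i)) ` J"
    proof (cases "k \<le> n")
      case False
      then have "u = Gx (n + (k - n))" "k - n \<in> J" using k by (auto simp: J_def)
      then show ?thesis by blast
    qed (use k in \<open>auto simp: J_def\<close>)
  qed (auto simp: J_def)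
  interpret P: class2_points A \<Lambda>
  proof (intro class2_points.intro class2_points_axioms.intro)
    show "finite (basis \<Lambda>)" using finY Xset by (simp add: \<Lambda>_def lattice_H_def J_def)
    show "w \<in> range (\<lambda>(i, j). Gy i j)" if "(u, v, w) \<in> relations \<Lambda>" for u v w
      using that by (auto simp: \<Lambda>_def lattice_H_def)
  qed (use fin is_cring in auto)
  have "P.Xs = {Gx k | k. 1 \<le> k \<and> k \<le> 2 * n}" unfolding P.Xs_def by (auto simp: \<Lambda>_def lattice_H_def)
  then have Xs: "P.Xs = Gx ` J \<union> (\<lambda>i. Gx (n + i)) ` J" using Xset by simp
  have Ys: "P.Ys = {Gy i j | i j. 1 \<le> i \<and> i \<le> j \<and> j \<le> n}"
    unfolding P.Ys_def P.Xs_def by (auto simp: \<Lambda>_def lattice_H_def)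
  have cardY: "card P.Ys = (n + 1) choose 2"
  proof -
    have "card P.Ys = card (SIGMA i:{1..n}. {i..n})"
      unfolding Ys Yset by (subst card_image) (auto simp: inj_on_def)
    also have "\<dots> = (\<Sum>i=1..n. Suc n - i)" by (subst card_SigmaI) auto
    also have "\<dots> = (\<Sum>i=1..n. i)"
      by (rule sum.reindex_bij_witness[where i = "\<lambda>i. Suc n - i" and j = "\<lambda>i. Suc n - i"]) auto
    also have "\<dots> = (n + 1) choose 2"
      by (induction n) (auto simp: numeral_2_eq_2)
    finally show ?thesis .
  qed
  have inj: "inj_on Gx J" "inj_on (\<lambda>i. Gx (n + i)) J" and disj: "Gx ` J \<inter> (\<lambda>i. Gx (n + i)) ` J = {}"
    by (auto simp: inj_on_def J_def)
  have J: "finite J" "card J = n" "J \<noteq> {}" using n by (auto simp: J_def)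
  have cardX: "card P.Xs = 2 * n"
    unfolding Xs using disj J by (subst card_Un_disjoint) (auto simp: card_image inj)
  define \<phi> where "\<phi> x = (\<lambda>i\<in>J. x (Gx i), \<lambda>i\<in>J. x (Gx (n + i)))" for x :: "gen \<Rightarrow> 'a"
  have bij: "bij_betw \<phi> (P.Xs \<rightarrow>\<^sub>E carrier A) ((J \<rightarrow>\<^sub>E carrier A) \<times> (J \<rightarrow>\<^sub>E carrier A))"
    unfolding \<phi>_def Xs by (rule bij_PiE_pair[OF inj disj])
  \<comment> \<open>For i = j the two families of relations give the same triple, and a set contains
    it once: the coefficient is -1 and not -2.\<close>
  have coeff1: "beta_coeff \<Lambda> u v (Gy i i) = (if u = Gx (n + i) \<and> v = Gx i then - 1 else 0)"
    if "i \<in> J" for i u v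
    using that by (cases u; cases v) (auto simp: \<Lambda>_def lattice_H_def bracket_coeff_def J_def)
  have coeff2: "beta_coeff \<Lambda> u v (Gy i j) = (if u = Gx (n + j) \<and> v = Gx i \<or> u = Gx (n + i) \<and> v = Gx j then - 1 else 0)"
    if "i \<in> J" "j \<in> J" "i < j" for i j u v
    using that by (cases u; cases v) (auto simp: \<Lambda>_def lattice_H_def bracket_coeff_def J_def)
  have ker: "card (P.Ker x) = card (KH J (fst (\<phi> x)) (snd (\<phi> x)))" if x: "x \<in> P.Xs \<rightarrow>\<^sub>E carrier A" for x
  proof -
    let ?a = "fst (\<phi> x)" and ?b = "snd (\<phi> x)"
    let ?Q = "\<lambda>z. (\<forall>i\<in>J. ?a i \<otimes> snd z i = fst z i \<otimes> ?b i) \<and>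
      (\<forall>i\<in>J. \<forall>j\<in>J. i \<noteq> j \<longrightarrow> ?a i \<otimes> snd z j \<oplus> ?a j \<otimes> snd z i = fst z i \<otimes> ?b j \<oplus> fst z j \<otimes> ?b i)"
    have "card (P.Ker x) = card {z \<in> (J \<rightarrow>\<^sub>E carrier A) \<times> (J \<rightarrow>\<^sub>E carrier A). ?Q z}"
      unfolding P.Ker_def
    proof (rule bij_betw_Collect[OF bij])
      fix z assume z: "z \<in> P.Xs \<rightarrow>\<^sub>E carrier A"
      have mem: "Gx i \<in> P.Xs" "Gx (n + i) \<in> P.Xs" if "i \<in> J" for i using that Xs by auto
      have zc: "z (Gx i) \<in> carrier A" "x (Gx i) \<in> carrier A" "z (Gx (n + i)) \<in> carrier A" "x (Gx (n + i)) \<in> carrier A"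
        if "i \<in> J" for i using PiE_mem[OF z] PiE_mem[OF x] mem[OF that] by auto
      have diag: "P.lie z x (Gy i i) = \<zero> \<longleftrightarrow> x (Gx i) \<otimes> z (Gx (n + i)) = z (Gx i) \<otimes> x (Gx (n + i))" if "i \<in> J" for i
        by (intro P.lie_one_zero_iff coeff1 mem P.XE_V z x that)
      have off: "P.lie z x (Gy i j) = \<zero> \<longleftrightarrow> x (Gx i) \<otimes> z (Gx (n + j)) \<oplus> x (Gx j) \<otimes> z (Gx (n + i)) =
          z (Gx i) \<otimes> x (Gx (n + j)) \<oplus> z (Gx j) \<otimes> x (Gx (n + i))" if ij: "i \<in> J" "j \<in> J" "i < j" for i j
        by (rule P.lie_two_zero_iff[OF mem(2)[OF ij(2)] mem(1)[OF ij(1)] mem(2)[OF ij(1)] mem(1)[OF ij(2)] _ coeff2[OF ij] P.XE_V[OF z] P.XE_V[OF x]])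
          (use ij in simp)
      have "(\<forall>w\<in>P.Ys. P.lie z x w = \<zero>) \<longleftrightarrow> (\<forall>i\<in>J. P.lie z x (Gy i i) = \<zero>) \<and> (\<forall>i\<in>J. \<forall>j\<in>J. i < j \<longrightarrow> P.lie z x (Gy i j) = \<zero>)"
        unfolding Ys J_def by (auto simp: le_less)
      also have "\<dots> \<longleftrightarrow> (\<forall>i\<in>J. x (Gx i) \<otimes> z (Gx (n + i)) = z (Gx i) \<otimes> x (Gx (n + i))) \<and>
        (\<forall>i\<in>J. \<forall>j\<in>J. i < j \<longrightarrow> x (Gx i) \<otimes> z (Gx (n + j)) \<oplus> x (Gx j) \<otimes> z (Gx (n + i)) =
          z (Gx i) \<otimes> x (Gx (n + j)) \<oplus> z (Gx j) \<otimes> x (Gx (n + i)))"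
        by (intro conj_cong ball_cong imp_cong refl diag off)
      also have "\<dots> \<longleftrightarrow> (\<forall>i\<in>J. x (Gx i) \<otimes> z (Gx (n + i)) = z (Gx i) \<otimes> x (Gx (n + i))) \<and>
        (\<forall>i\<in>J. \<forall>j\<in>J. i \<noteq> j \<longrightarrow> x (Gx i) \<otimes> z (Gx (n + j)) \<oplus> x (Gx j) \<otimes> z (Gx (n + i)) =
          z (Gx i) \<otimes> x (Gx (n + j)) \<oplus> z (Gx j) \<otimes> x (Gx (n + i)))" (is "?D \<and> ?L \<longleftrightarrow> ?D \<and> ?R")
      proof -
        have "?R" if L: "?L"
        proof (intro ballI impI)
          fix i j assume ij: "i \<in> J" "j \<in> J" "i \<noteq> j"
          show "x (Gx i) \<otimes> z (Gx (n + j)) \<oplus> x (Gx j) \<otimes> z (Gx (n + i)) = z (Gx i) \<otimes> x (Gx (n + j)) \<oplus> z (Gx j) \<otimes> x (Gx (n + i))"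
          proof (cases "i < j")
            case True
            then show ?thesis using L ij by simp
          next
            case False
            then have "j < i" using ij by simp
            then have "x (Gx j) \<otimes> z (Gx (n + i)) \<oplus> x (Gx i) \<otimes> z (Gx (n + j)) = z (Gx j) \<otimes> x (Gx (n + i)) \<oplus> z (Gx i) \<otimes> x (Gx (n + j))"
              using L ij by simp
            then show ?thesis using zc[OF ij(1)] zc[OF ij(2)] by (simp add: a_comm)
          qed
        qed
        then show ?thesis by auto
      qed
      also have "\<dots> \<longleftrightarrow> ?Q (\<phi> z)" by (simp add: \<phi>_def)
      finally show "(\<forall>w\<in>P.Ys. P.lie z x w = \<zero>) \<longleftrightarrow> ?Q (\<phi> z)" .
    qed
    also have "{z \<in> (J \<rightarrow>\<^sub>E carrier A) \<times> (J \<rightarrow>\<^sub>E carrier A). ?Q z} = KH J ?a ?b"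
      unfolding KH_def by auto
    finally show ?thesis .
  qed
  define f where "f k = of_real (real (q ^ (N * (2 * n))) / real k) powr (- (1 + s))" for k :: nat
  have "zeta_cc (group_points \<Lambda> A) s = of_nat ((q ^ N) ^ card P.Ys) * (\<Sum>x\<in>P.Xs \<rightarrow>\<^sub>E carrier A. f (card (KH J (fst (\<phi> x)) (snd (\<phi> x)))))"
    unfolding P.zeta_cc_class2 card_carrier cardX f_def by (simp add: ker power_mult)
  also have "(\<Sum>x\<in>P.Xs \<rightarrow>\<^sub>E carrier A. f (card (KH J (fst (\<phi> x)) (snd (\<phi> x)))))
    = (\<Sum>y\<in>(J \<rightarrow>\<^sub>E carrier A) \<times> (J \<rightarrow>\<^sub>E carrier A). f (card (KH J (fst y) (snd y))))"
    by (rule sum.reindex_bij_betw[OF bij])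
  also have "\<dots> = (\<Sum>a\<in>J \<rightarrow>\<^sub>E carrier A. \<Sum>b\<in>J \<rightarrow>\<^sub>E carrier A. f (card (KH J a b)))"
    by (simp add: sum.cartesian_product case_prod_unfold)
  also have "\<dots> = (\<Sum>l\<le>N. wt n (N - l) *
        (of_nat q ^ (N - l) * (\<Sum>k=l..N. wt (n - 1) (N - k) * f (q ^ (N + k * (n - 1) + l * n))) +
         (if l < N then of_nat q ^ (N - Suc l) * (\<Sum>k=Suc l..N. wt (n - 1) (N - k) * f (q ^ (N + k * (n - 1) + l * n))) else 0)))"
    using sum_KH[OF J(1), of f] n by (simp only: J(2))
  also have "\<dots> = (\<Sum>l\<le>N. wt n (N - l) *
      (of_nat q ^ (N - l) * (\<Sum>k\<le>N - l. wt (n - 1) k * S s ^ (k * (n - 1) + (N - l) * n)) +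
       (if N - l = 0 then 0 else of_nat q ^ (N - l - 1) * (\<Sum>k\<le>N - l - 1. wt (n - 1) k * S s ^ (k * (n - 1) + (N - l) * n)))))"
  proof (rule sum.cong[OF refl])
    fix l assume "l \<in> {..N}"
    then have l: "l \<le> N" by simp
    obtain n' where n': "n = Suc n'" using n by (cases n) auto
    have f: "f (q ^ (N + k * (n - 1) + l * n)) = S s ^ ((N - k) * (n - 1) + (N - l) * n)" if k: "k \<le> N" for k
    proof -
      obtain d where d: "N = k + d" using k le_Suc_ex by blast
      obtain e where e: "N = l + e" using l le_Suc_ex by blast
      have "N * (2 * n) = N * 1 + N * (n - 1) + N * n" by (simp add: n' algebra_simps)
      also have "\<dots> = N + (k + d) * (n - 1) + (l + e) * n" using d e by simp
      also have "\<dots> = (N + k * (n - 1) + l * n) + (d * (n - 1) + e * n)" by (simp add: n' algebra_simps)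
      also have "d = N - k" using d by simp
      also have "e = N - l" using e by simp
      finally have "N * (2 * n) = (N + k * (n - 1) + l * n) + ((N - k) * (n - 1) + (N - l) * n)" .
      then have "N + k * (n - 1) + l * n \<le> N * (2 * n)"
        "N * (2 * n) - (N + k * (n - 1) + l * n) = (N - k) * (n - 1) + (N - l) * n" by simp_all
      then show ?thesis using quotient_powr[of "N + k * (n - 1) + l * n" "N * (2 * n)" s] by (simp only: f_def)
    qed
    have part: "(\<Sum>k=\<kappa>..N. wt (n - 1) (N - k) * f (q ^ (N + k * (n - 1) + l * n)))
      = (\<Sum>k\<le>N - \<kappa>. wt (n - 1) k * S s ^ (k * (n - 1) + (N - l) * n))" if "\<kappa> \<le> N" for \<kappa>
    proof -
      have "(\<Sum>k=\<kappa>..N. wt (n - 1) (N - k) * f (q ^ (N + k * (n - 1) + l * n)))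
        = (\<Sum>k=\<kappa>..N. wt (n - 1) (N - k) * S s ^ ((N - k) * (n - 1) + (N - l) * n))"
        by (rule sum.cong[OF refl], subst f) auto
      also have "\<dots> = (\<Sum>k\<le>N - \<kappa>. wt (n - 1) k * S s ^ (k * (n - 1) + (N - l) * n))"
        by (rule sum_interval_reverse[OF that, where f = "\<lambda>k. wt (n - 1) k * S s ^ (k * (n - 1) + (N - l) * n)"])
      finally show ?thesis .
    qed
    show "wt n (N - l) *
        (of_nat q ^ (N - l) * (\<Sum>k=l..N. wt (n - 1) (N - k) * f (q ^ (N + k * (n - 1) + l * n))) +
         (if l < N then of_nat q ^ (N - Suc l) * (\<Sum>k=Suc l..N. wt (n - 1) (N - k) * f (q ^ (N + k * (n - 1) + l * n))) else 0)) =
      wt n (N - l) *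
      (of_nat q ^ (N - l) * (\<Sum>k\<le>N - l. wt (n - 1) k * S s ^ (k * (n - 1) + (N - l) * n)) +
       (if N - l = 0 then 0 else of_nat q ^ (N - l - 1) * (\<Sum>k\<le>N - l - 1. wt (n - 1) k * S s ^ (k * (n - 1) + (N - l) * n))))"
    proof (cases "l < N")
      case True
      then show ?thesis using part[OF l] part[of "Suc l"] by simp
    next
      case False
      then show ?thesis using part[OF l] l by simp
    qed
  qed
  also have "\<dots> = (\<Sum>l\<le>N. wt n l *
      (of_nat q ^ l * (\<Sum>k\<le>l. wt (n - 1) k * S s ^ (k * (n - 1) + l * n)) +
       (if l = 0 then 0 else of_nat q ^ (l - 1) * (\<Sum>k\<le>l - 1. wt (n - 1) k * S s ^ (k * (n - 1) + l * n)))))"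
    by (rule sum_atMost_reverse[where f = "\<lambda>l. wt n l *
      (of_nat q ^ l * (\<Sum>k\<le>l. wt (n - 1) k * S s ^ (k * (n - 1) + l * n)) +
       (if l = 0 then 0 else of_nat q ^ (l - 1) * (\<Sum>k\<le>l - 1. wt (n - 1) k * S s ^ (k * (n - 1) + l * n))))"])
  finally show ?thesis unfolding cardY power_mult[symmetric] of_nat_power unfolding \<Lambda>_def .
qed

end

section \<open>The generating functions\<close>

text \<open>Connects three views of the prime: the ideal of the ring record, the locale
  \<open>integer_prime\<close> with field arithmetic, which provides \<pi> and s, and the abstract
  setting \<open>locally_principal\<close>, which provides the chain rings.\<close>

lemma chain_ring_at_prime:
  fixes K :: "'a::field_char_0 set"
  assumes K: "number_field K" and pp: "primeideal \<pp> (ring_of_integers K)" and nz: "\<pp> \<noteq> {0}"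
  defines "R \<equiv> ring_of_integers K"
  shows "ideal_index R \<pp> \<ge> 2 \<and>
    (\<forall>N. \<exists>\<omega>. chain_ring (completion R \<pp> Quot ideal_pow (completion R \<pp>) (the_max_ideal (completion R \<pp>)) N) \<omega> (ideal_index R \<pp>) N)"
proof -
  note cl = integers_closed[OF K]
  have R [simp]: "carrier R = integers K" "\<And>x y. x \<otimes>\<^bsub>R\<^esub> y = x * y" "\<one>\<^bsub>R\<^esub> = 1" "\<And>x y. x \<oplus>\<^bsub>R\<^esub> y = x + y" "\<zero>\<^bsub>R\<^esub> = 0"
    by (simp_all add: R_def ring_of_integers_def ring_of_type_algebra_def integers_def)
  have "cring R"
  proof (rule cringI)
    show "abelian_group R"
      by (rule abelian_groupI) (auto simp: cl add.assoc add.commute intro: bexI[of _ "- _"])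
    show "Group.comm_monoid R"
      by (rule comm_monoidI) (auto simp: cl mult.assoc mult.commute)
  qed (simp add: distrib_right)
  then interpret R: domain R by (rule domain.intro) (simp add: domain_axioms_def)
  interpret P: primeideal \<pp> R using pp unfolding R_def .
  have minus: "x \<ominus>\<^bsub>R\<^esub> y = x - y" if "x \<in> integers K" "y \<in> integers K" for x y
  proof -
    have "\<ominus>\<^bsub>R\<^esub> y = - y" by (rule R.minus_equality) (use that cl in auto)
    then show ?thesis by (simp add: a_minus_def)
  qed
  have sub: "\<pp> \<subseteq> integers K" using P.a_subset by simp
  have one: "1 \<notin> \<pp>" using P.one_imp_carrier P.I_notcarr by auto
  interpret I: integer_prime K \<pp>
  proof
    show "0 \<in> \<pp>" using P.zero_closed by simp
    show "x + y \<in> \<pp>" if "x \<in> \<pp>" "y \<in> \<pp>" for x y using P.a_closed[OF that] by simp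
    show "x * y \<in> \<pp>" if "x \<in> \<pp>" "y \<in> integers K" for x y using P.I_r_closed[of x y] that by simp
    show "x \<in> \<pp> \<or> y \<in> \<pp>" if "x \<in> integers K" "y \<in> integers K" "x * y \<in> \<pp>" for x y using P.I_prime[of x y] that by simp
  qed (use K sub one nz in auto)
  obtain F \<pi> s where u: "finite F" "F \<subseteq> integers K" "\<And>x. x \<in> integers K \<Longrightarrow> \<exists>r\<in>F. x - r \<in> \<pp>"
    "\<pi> \<in> \<pp>" "\<pi> \<noteq> 0" "s \<in> integers K" "s \<notin> \<pp>" "\<And>y. y \<in> \<pp> \<Longrightarrow> \<exists>z\<in>integers K. s * y = \<pi> * z"
    by (rule I.uniformizer) (rule that)
  interpret L: locally_principal R \<pp> F \<pi> s
  proof (intro locally_principal.intro locally_principal_axioms.intro R.domain_axioms P.ideal_axioms)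
    show "\<exists>r\<in>F. x \<ominus>\<^bsub>R\<^esub> r \<in> \<pp>" if "x \<in> carrier R" for x
      using u(3)[of x] that u(2) minus by (metis R(1) subsetD)
    show "\<exists>t\<in>carrier R. y \<otimes>\<^bsub>R\<^esub> t \<ominus>\<^bsub>R\<^esub> \<one>\<^bsub>R\<^esub> \<in> \<pp>" if "y \<in> carrier R" "y \<notin> \<pp>" for y
    proof -
      obtain t where t: "t \<in> integers K" "y * t - 1 \<in> \<pp>" using I.inverse_mod[of y thesis] \<open>y \<in> carrier R\<close> \<open>y \<notin> \<pp>\<close> by auto
      have "y * t \<in> integers K" using t(1) that(1) cl(2) by simp
      then show ?thesis using t minus[of "y * t" 1] cl(7) by (intro bexI[of _ t]) simp_all
    qed
  qed (use u one P.I_prime in auto)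
  have q: "ideal_index R \<pp> = L.q" by (simp add: ideal_index_def L.q_def)
  show ?thesis unfolding q using L.q_ge_2 L.chain_ring_completion_quotient by blast
qed

section \<open>Convolutions of geometric progressions and their sums\<close>

lemma symmetric_square_sum:
  fixes M :: "nat \<Rightarrow> nat \<Rightarrow> complex"
  assumes "\<And>i j. M i j = M j i"
  shows "(\<Sum>i\<le>N. \<Sum>j\<le>N. M i j) = (\<Sum>i\<le>N. M i i + 2 * (\<Sum>j<i. M i j))"
proof (induction N)
  case (Suc N)
  have "(\<Sum>i\<le>Suc N. \<Sum>j\<le>Suc N. M i j) = (\<Sum>i\<le>N. \<Sum>j\<le>N. M i j) + (\<Sum>i\<le>N. M i (Suc N)) + (\<Sum>j\<le>N. M (Suc N) j) + M (Suc N) (Suc N)"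
    by (simp add: sum.distrib)
  also have "(\<Sum>i\<le>N. M i (Suc N)) = (\<Sum>j<Suc N. M (Suc N) j)" using assms by (simp add: lessThan_Suc_atMost)
  also have "(\<Sum>j\<le>N. M (Suc N) j) = (\<Sum>j<Suc N. M (Suc N) j)" by (simp add: lessThan_Suc_atMost)
  finally show ?case using Suc.IH by simp
qed simp

text \<open>From index 1 on, a combines two geometric sequences and their convolution. Each piece is
  absolutely summable, so both Cauchy products, the inner one of B with C and the outer one with
  powers of A, have the expected value.\<close>

lemma convolution_sums:
  fixes A B C :: complex
  assumes A: "cmod A < 1" and B: "cmod B < 1" and C: "cmod C < 1"
    and a: "a 0 = 1"
      "\<And>l. l \<ge> 1 \<Longrightarrow> a l = \<alpha> * B ^ l + \<beta> * C ^ l + \<gamma> * (\<Sum>k\<in>{1..<l}. B ^ k * C ^ (l - k))"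
  shows "(\<lambda>N. \<Sum>l\<le>N. a l * A ^ (N - l)) sums
    ((1 + \<alpha> * (B / (1 - B)) + \<beta> * (C / (1 - C)) + \<gamma> * (B / (1 - B) * (C / (1 - C)))) / (1 - A))"
proof -
  \<comment> \<open>The geometric sequence without its zeroth term, as the formula for a starts at
    1; the value \<open>a 0 = 1\<close> is supplied by \<open>z\<close>.\<close>
  define g where "g x l = (if l = 0 then 0 else x ^ l)" for x :: complex and l :: nat
  have g_norm: "summable (\<lambda>l. cmod (g x l))" if "cmod x < 1" for x
    by (rule summable_comparison_test'[OF summable_geometric[of "cmod x"], of 0])
      (use that in \<open>auto simp: g_def norm_power\<close>)
  have g_sums: "g x sums (x / (1 - x))" if x: "cmod x < 1" for x
  proof -
    have "(\<lambda>l. x ^ Suc l) sums (1 / (1 - x) - 1)"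
      using geometric_sums[OF x] sums_Suc_iff[of "\<lambda>l. x ^ l" "1 / (1 - x) - 1"] by simp
    then have "(\<lambda>l. g x (Suc l)) sums (1 / (1 - x) - 1)" by (simp add: g_def)
    then have "g x sums (1 / (1 - x) - 1)" using sums_Suc_iff[of "g x" "1 / (1 - x) - 1"] by (simp add: g_def)
    moreover have "1 / (1 - x) - 1 = x / (1 - x)"
    proof -
      have "x \<noteq> 1" using x by auto
      then show ?thesis by (simp add: diff_frac_eq divide_simps)
    qed
    ultimately show ?thesis by simp
  qed
  define h where "h l = (\<Sum>k\<le>l. g B k * g C (l - k))" for l
  have h_sums: "h sums (B / (1 - B) * (C / (1 - C)))"
    unfolding h_def using Cauchy_product_sums[OF g_norm[OF B] g_norm[OF C]] g_sums[OF B] g_sums[OF C]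
    by (simp add: sums_iff)
  have h_norm: "summable (\<lambda>l. cmod (h l))"
  proof (rule summable_comparison_test')
    show "summable (\<lambda>l. \<Sum>k\<le>l. cmod (g B k) * cmod (g C (l - k)))"
      by (rule summable_Cauchy_product) (use g_norm[OF B] g_norm[OF C] in simp_all)
    show "norm_class.norm (cmod (h l)) \<le> (\<Sum>k\<le>l. cmod (g B k) * cmod (g C (l - k)))" if "l \<ge> 0" for l
      unfolding h_def by (simp add: norm_mult[symmetric] norm_sum)
  qed
  define z where "z l = (if l = 0 then 1 else 0 :: complex)" for l :: nat
  have z_sums: "z sums 1" unfolding z_def using sums_single[of 0 "\<lambda>_. 1 :: complex"] by simp
  have z_norm: "summable (\<lambda>l. cmod (z l))"
    by (rule summable_finite[of "{0}"]) (auto simp: z_def)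
  have a_eq: "a = (\<lambda>l. z l + \<alpha> * g B l + \<beta> * g C l + \<gamma> * h l)"
  proof
    fix l
    show "a l = z l + \<alpha> * g B l + \<beta> * g C l + \<gamma> * h l"
    proof (cases "l = 0")
      case False
      have "h l = (\<Sum>k\<in>{1..<l}. g B k * g C (l - k))"
        unfolding h_def by (rule sum.mono_neutral_right) (auto simp: g_def)
      also have "\<dots> = (\<Sum>k\<in>{1..<l}. B ^ k * C ^ (l - k))" by (rule sum.cong) (auto simp: g_def)
      finally show ?thesis using a(2)[of l] False by (simp add: z_def g_def)
    qed (simp add: a(1) z_def g_def h_def)
  qed
  have a_sums: "a sums (1 + \<alpha> * (B / (1 - B)) + \<beta> * (C / (1 - C)) + \<gamma> * (B / (1 - B) * (C / (1 - C))))"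
    unfolding a_eq by (intro sums_add sums_mult z_sums g_sums B C h_sums)
  have a_norm: "summable (\<lambda>l. cmod (a l))"
  proof (rule summable_comparison_test')
    show "summable (\<lambda>l. cmod (z l) + cmod \<alpha> * cmod (g B l) + cmod \<beta> * cmod (g C l) + cmod \<gamma> * cmod (h l))"
      by (intro summable_add summable_mult z_norm g_norm B C h_norm)
    show "norm_class.norm (cmod (a l)) \<le> cmod (z l) + cmod \<alpha> * cmod (g B l) + cmod \<beta> * cmod (g C l) + cmod \<gamma> * cmod (h l)" if "l \<ge> 0" for l
      unfolding a_eq real_norm_def abs_norm_cancel
      by (intro order.trans[OF norm_triangle_ineq] add_mono) (simp_all add: norm_mult)
  qed
  have A_norm: "summable (\<lambda>l. cmod (A ^ l))" using A by (simp add: norm_power summable_geometric)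
  show ?thesis
    using Cauchy_product_sums[OF a_norm A_norm] a_sums geometric_sums[OF A] by (simp add: sums_iff)
qed

text \<open>Equates the computed numerator with the stated one. It is used with Q = q^n, t = 1 / Q,
  b = T1^(n - 1) and M = q^(2 (n choose 2)) T1^n T2, so that the two nontrivial poles are at Q M = 1
  and Q M q b = 1.\<close>

lemma rational_identity_G:
  fixes M Q t q b :: complex
  assumes "Q * t = 1"
  shows "(1 - Q * M * q * b) * (1 - Q * M) + (1 - t)\<^sup>2 * (Q * M * q * b) * (1 - Q * M) + 2 * (1 - t) * (Q * M) * (1 - Q * M * q * b)
     + 2 * (1 - t)\<^sup>2 * ((Q * M * q * b) * (Q * M))
    = (1 - M) * (1 - M * q * b) + Q * M * (1 - t) * (1 - q * t * b)"
  using assms by Groebner_Basis.algebra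

text \<open>The analogue for \<H>, with r = 1 / q and M = q^(n choose 2) T1^n T2; the factor 1 + r
  comes from the two triangles.\<close>

lemma rational_identity_H:
  fixes M Q t q r b :: complex
  assumes "Q * t = 1" "q * r = 1"
  shows "(1 - Q * q * M * b) * (1 - Q * q * M) + (1 - t) * (1 - q * t) * (Q * q * M * b) * (1 - Q * q * M)
     + (1 - t) * (1 + r) * (Q * q * M) * (1 - Q * q * M * b)
     + (1 - t) * (1 + r) * (1 - q * t) * ((Q * q * M * b) * (Q * q * M))
    = (1 - M) * (1 - M * q\<^sup>2 * b) + Q * M * (1 - q * t) * (1 - q * t * b)"
  using assms by Groebner_Basis.algebra

lemma combine_fractions:
  fixes B C :: complex
  assumes "B \<noteq> 1" "C \<noteq> 1"
  shows "1 + \<alpha> * (B / (1 - B)) + \<beta> * (C / (1 - C)) + \<gamma> * (B / (1 - B) * (C / (1 - C)))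
    = ((1 - B) * (1 - C) + \<alpha> * B * (1 - C) + \<beta> * C * (1 - B) + \<gamma> * (B * C)) / ((1 - C) * (1 - B))"
proof -
  have n: "1 - B \<noteq> 0" "1 - C \<noteq> 0" using assms by auto
  have 1: "1 = (1 - B) * (1 - C) / ((1 - C) * (1 - B))" using n by simp
  have 2: "\<alpha> * (B / (1 - B)) = \<alpha> * B * (1 - C) / ((1 - C) * (1 - B))" using n by simp
  have 3: "\<beta> * (C / (1 - C)) = \<beta> * C * (1 - B) / ((1 - C) * (1 - B))" using n by simp
  have 4: "\<gamma> * (B / (1 - B) * (C / (1 - C))) = \<gamma> * (B * C) / ((1 - C) * (1 - B))" by (simp add: mult.commute)
  show ?thesis unfolding 2 3 4 by (subst 1) (simp only: add_divide_distrib)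
qed

text \<open>A^N times a partial sum of p is the convolution of A^l p(l) with the powers of A, so
  \<open>convolution_sums\<close> applies with ratios A x and A y.\<close>

lemma weighted_power_sums:
  fixes A x y :: complex
  assumes A: "cmod A < 1" and x: "cmod (A * x) < 1" and y: "cmod (A * y) < 1"
    and p: "p 0 = 1" "\<And>l. l \<ge> 1 \<Longrightarrow> p l = \<alpha> * x ^ l + \<beta> * y ^ l + \<gamma> * (\<Sum>k\<in>{1..<l}. x ^ k * y ^ (l - k))"
  shows "(\<lambda>N. A ^ N * (\<Sum>l\<le>N. p l)) sums
    (((1 - A * x) * (1 - A * y) + \<alpha> * (A * x) * (1 - A * y) + \<beta> * (A * y) * (1 - A * x) + \<gamma> * ((A * x) * (A * y)))
      / ((1 - A) * (1 - A * y) * (1 - A * x)))"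
proof -
  have "(\<lambda>N. \<Sum>l\<le>N. (A ^ l * p l) * A ^ (N - l)) sums
    ((1 + \<alpha> * (A * x / (1 - A * x)) + \<beta> * (A * y / (1 - A * y)) + \<gamma> * (A * x / (1 - A * x) * (A * y / (1 - A * y)))) / (1 - A))"
  proof (rule convolution_sums[OF A x y])
    fix l :: nat assume l: "l \<ge> 1"
    have "A ^ l * (\<Sum>k\<in>{1..<l}. x ^ k * y ^ (l - k)) = (\<Sum>k\<in>{1..<l}. (A * x) ^ k * (A * y) ^ (l - k))"
      unfolding sum_distrib_left
    proof (rule sum.cong[OF refl])
      fix k assume "k \<in> {1..<l}"
      then have "A ^ l = A ^ k * A ^ (l - k)" by (simp add: power_add[symmetric])
      then show "A ^ l * (x ^ k * y ^ (l - k)) = (A * x) ^ k * (A * y) ^ (l - k)" by (simp add: power_mult_distrib)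
    qed
    then show "A ^ l * p l = \<alpha> * (A * x) ^ l + \<beta> * (A * y) ^ l + \<gamma> * (\<Sum>k\<in>{1..<l}. (A * x) ^ k * (A * y) ^ (l - k))"
      unfolding p(2)[OF l] distrib_left by (simp add: power_mult_distrib mult.left_commute)
  qed (simp add: p)
  moreover have "(\<Sum>l\<le>N. (A ^ l * p l) * A ^ (N - l)) = A ^ N * (\<Sum>l\<le>N. p l)" for N
    unfolding sum_distrib_left
  proof (rule sum.cong[OF refl])
    fix l assume "l \<in> {..N}"
    then have "A ^ N = A ^ l * A ^ (N - l)" by (simp add: power_add[symmetric])
    then show "A ^ l * p l * A ^ (N - l) = A ^ N * p l" by simp
  qed
  moreover have ne: "A * x \<noteq> 1" "A * y \<noteq> 1" using x y by auto
  moreover have "(1 - A) * (1 - A * y) * (1 - A * x) = (1 - A * y) * (1 - A * x) * (1 - A)" by (simp add: mult_ac)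
  ultimately show ?thesis by (simp only: combine_fractions[OF ne] divide_divide_eq_left)
qed

lemma weight_eq:
  fixes Q :: complex
  assumes "Q \<noteq> 0" "l \<ge> 1"
  shows "Q ^ (n * l) - Q ^ (n * (l - 1)) = (1 - 1 / Q ^ n) * (Q ^ n) ^ l"
proof -
  obtain l' where "l = Suc l'" using assms(2) by (cases l) auto
  then show ?thesis using assms(1) by (simp only: power_mult diff_Suc_1) (simp add: left_diff_distrib)
qed

text \<open>Only one progression occurs; the second one is filled with y = 0 and coefficients
  0.\<close>

lemma sums_F:
  fixes A Q S :: complex and w :: "nat \<Rightarrow> complex"
  assumes Q: "Q \<noteq> 0" and w: "\<And>l. w l = (if l = 0 then 1 else Q ^ (m * l) - Q ^ (m * (l - 1)))"
    and norms: "cmod A < 1" "cmod (A * (Q ^ m * S ^ (m - 1))) < 1"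
  shows "(\<lambda>N. A ^ N * (\<Sum>l\<le>N. w l * S ^ (l * (m - 1)))) sums
    ((1 - A * (Q ^ m * S ^ (m - 1)) / Q ^ m) / ((1 - A) * (1 - A * (Q ^ m * S ^ (m - 1)))))"
proof -
  let ?x = "Q ^ m * S ^ (m - 1)"
  have wl: "w l = (1 - 1 / Q ^ m) * (Q ^ m) ^ l" if "l \<ge> 1" for l
    using that weight_eq[OF Q that] by (simp add: w)
  have "(\<lambda>N. A ^ N * (\<Sum>l\<le>N. w l * S ^ (l * (m - 1)))) sums
    (((1 - A * ?x) * (1 - A * 0) + (1 - 1 / Q ^ m) * (A * ?x) * (1 - A * 0) + 0 * (A * 0) * (1 - A * ?x) + 0 * ((A * ?x) * (A * 0)))
      / ((1 - A) * (1 - A * 0) * (1 - A * ?x)))"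
  proof (rule weighted_power_sums)
    fix l :: nat assume l: "l \<ge> 1"
    have "S ^ (l * (m - 1)) = (S ^ (m - 1)) ^ l" by (simp add: power_mult[symmetric] mult.commute)
    then show "w l * S ^ (l * (m - 1)) = (1 - 1 / Q ^ m) * ?x ^ l + 0 * 0 ^ l + 0 * (\<Sum>k\<in>{1..<l}. ?x ^ k * 0 ^ (l - k))"
      by (simp add: wl[OF l] power_mult_distrib)
  qed (use norms in \<open>simp_all add: w\<close>)
  moreover have "(1 - A * ?x) * (1 - A * 0) + (1 - 1 / Q ^ m) * (A * ?x) * (1 - A * 0) + 0 * (A * 0) * (1 - A * ?x) + 0 * ((A * ?x) * (A * 0))
    = 1 - A * ?x / Q ^ m"
    by (simp add: left_diff_distrib)
  ultimately show ?thesis by (simp only: mult_zero_right diff_zero mult_1_right)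
qed

text \<open>For k \<le> l the powers form z^k y^l = x^k y^(l - k) with x = z y. The weight of k = 0
  is 1 and not a multiple of u, so that term is split off and yields the coefficient 2 u; the
  diagonal gives x^l, and the rest is the convolution.\<close>

lemma sums_G:
  fixes A Q S :: complex and w :: "nat \<Rightarrow> complex"
  assumes Q: "Q \<noteq> 0" and n: "n \<ge> 1" and w: "\<And>l. w l = (if l = 0 then 1 else Q ^ (n * l) - Q ^ (n * (l - 1)))"
    and X: "X1 = A * (Q ^ (2 * n) * S ^ (2 * n - 1))" and Y: "Y1 = A * (Q ^ n * S ^ n)" and u: "u = 1 - 1 / Q ^ n"
    and norms: "cmod A < 1" "cmod X1 < 1" "cmod Y1 < 1"
  shows "(\<lambda>N. A ^ N * (\<Sum>l\<le>N. \<Sum>k\<le>N. w l * w k * S ^ ((n - 1) * min l k + n * max l k))) sums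
    (((1 - X1) * (1 - Y1) + u\<^sup>2 * X1 * (1 - Y1) + 2 * u * Y1 * (1 - X1) + 2 * u\<^sup>2 * (X1 * Y1)) / ((1 - A) * (1 - Y1) * (1 - X1)))"
proof -
  let ?z = "Q ^ n * S ^ (n - 1)" and ?y = "Q ^ n * S ^ n"
  define x where "x = Q ^ (2 * n) * S ^ (2 * n - 1)"
  have x: "x = ?z * ?y"
  proof -
    obtain n' where "n = Suc n'" using n by (cases n) auto
    then show ?thesis by (simp add: x_def mult_2 power_add)
  qed
  have wl: "w l = u * (Q ^ n) ^ l" if "l \<ge> 1" for l
    using that weight_eq[OF Q that] by (simp add: w u)
  let ?M = "\<lambda>l k. w l * w k * S ^ ((n - 1) * min l k + n * max l k)"
  have M: "?M l k = w l * w k * ((S ^ (n - 1)) ^ k * (S ^ n) ^ l)" if "k \<le> l" for l k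
    using that by (simp add: min_absorb2 max_absorb1 power_add power_mult)
  have "(\<lambda>N. A ^ N * (\<Sum>l\<le>N. ?M l l + 2 * (\<Sum>k<l. ?M l k))) sums
    (((1 - A * x) * (1 - A * ?y) + u\<^sup>2 * (A * x) * (1 - A * ?y) + (2 * u) * (A * ?y) * (1 - A * x) + (2 * u\<^sup>2) * ((A * x) * (A * ?y)))
      / ((1 - A) * (1 - A * ?y) * (1 - A * x)))"
  proof (rule weighted_power_sums)
    fix l :: nat assume l: "l \<ge> 1"
    have diag: "?M l l = u\<^sup>2 * x ^ l"
      unfolding M[OF order.refl] x by (simp add: wl[OF l] power_mult_distrib monoid_mult_class.power2_eq_square)
    have "(\<Sum>k<l. ?M l k) = ?M l 0 + (\<Sum>k\<in>{1..<l}. ?M l k)"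
    proof -
      have "{..<l} = insert 0 {1..<l}" using l by auto
      then show ?thesis by simp
    qed
    also have "?M l 0 = u * ?y ^ l" unfolding M[OF le0] using w[of 0] by (simp add: wl[OF l] power_mult_distrib)
    also have "(\<Sum>k\<in>{1..<l}. ?M l k) = u\<^sup>2 * (\<Sum>k\<in>{1..<l}. x ^ k * ?y ^ (l - k))"
      unfolding sum_distrib_left
    proof (rule sum.cong[OF refl])
      fix k assume k: "k \<in> {1..<l}"
      then have "x ^ k * ?y ^ (l - k) = ?z ^ k * ?y ^ l"
        unfolding x power_mult_distrib[of ?z] by (simp add: power_add[symmetric])
      also have "u\<^sup>2 * \<dots> = ?M l k"
        using k by (subst M) (simp_all add: wl[OF l] wl[of k] power_mult_distrib monoid_mult_class.power2_eq_square)
      finally show "?M l k = u\<^sup>2 * (x ^ k * ?y ^ (l - k))" by simp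
    qed
    finally show "?M l l + 2 * (\<Sum>k<l. ?M l k) = u\<^sup>2 * x ^ l + (2 * u) * ?y ^ l + (2 * u\<^sup>2) * (\<Sum>k\<in>{1..<l}. x ^ k * ?y ^ (l - k))"
      using diag by (simp add: distrib_left)
  qed (use norms in \<open>simp_all add: w X Y x_def\<close>)
  moreover have "(\<Sum>l\<le>N. \<Sum>k\<le>N. ?M l k) = (\<Sum>l\<le>N. ?M l l + 2 * (\<Sum>k<l. ?M l k))" for N
    by (rule symmetric_square_sum) (simp add: min.commute max.commute mult.commute)
  ultimately show ?thesis by (simp only: X Y x_def)
qed

text \<open>The two inner sums agree for k < l up to the factors Q^l and Q^(l - 1), which gives 1 +
  1 / Q. The term k = l occurs only in the first sum, and therefore x^l has the coefficient u v
  without that factor.\<close>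

lemma sums_H:
  fixes A Q S :: complex and w w' :: "nat \<Rightarrow> complex"
  assumes Q: "Q \<noteq> 0" and n: "n \<ge> 2" and w: "\<And>l. w l = (if l = 0 then 1 else Q ^ (n * l) - Q ^ (n * (l - 1)))"
    and w': "\<And>l. w' l = (if l = 0 then 1 else Q ^ ((n - 1) * l) - Q ^ ((n - 1) * (l - 1)))"
    and X: "X1 = A * (Q ^ (2 * n) * S ^ (2 * n - 1))" and Y: "Y1 = A * (Q ^ (n + 1) * S ^ n)"
    and u: "u = 1 - 1 / Q ^ n" and v: "v = 1 - 1 / Q ^ (n - 1)"
    and norms: "cmod A < 1" "cmod X1 < 1" "cmod Y1 < 1"
  shows "(\<lambda>N. A ^ N * (\<Sum>l\<le>N. w l * (Q ^ l * (\<Sum>k\<le>l. w' k * S ^ (k * (n - 1) + l * n)) +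
      (if l = 0 then 0 else Q ^ (l - 1) * (\<Sum>k\<le>l - 1. w' k * S ^ (k * (n - 1) + l * n)))))) sums
    (((1 - X1) * (1 - Y1) + u * v * X1 * (1 - Y1) + u * (1 + 1 / Q) * Y1 * (1 - X1) + u * (1 + 1 / Q) * v * (X1 * Y1))
      / ((1 - A) * (1 - Y1) * (1 - X1)))"
proof -
  let ?z = "Q ^ (n - 1) * S ^ (n - 1)" and ?y = "Q ^ (n + 1) * S ^ n"
  define x where "x = Q ^ (2 * n) * S ^ (2 * n - 1)"
  have x: "x = ?z * ?y"
  proof -
    obtain n' where "n = Suc n'" using n by (cases n) auto
    then show ?thesis by (simp add: x_def mult_2 power_add)
  qed
  have wl: "w l = u * (Q ^ n) ^ l" if "l \<ge> 1" for l
    using that weight_eq[OF Q that] by (simp add: w u)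
  have wl': "w' l = v * (Q ^ (n - 1)) ^ l" if "l \<ge> 1" for l
    using that weight_eq[OF Q that] by (simp add: w' v)
  have inner: "w l * Q ^ l * (\<Sum>k\<le>r. w' k * S ^ (k * (n - 1) + l * n)) = u * (?y ^ l + v * (\<Sum>k\<in>{1..<Suc r}. ?z ^ k * ?y ^ l))"
    if l: "l \<ge> 1" for l r
  proof -
    have "{..r} = insert 0 {1..<Suc r}" by auto
    then have "(\<Sum>k\<le>r. w' k * S ^ (k * (n - 1) + l * n)) = S ^ (l * n) + (\<Sum>k\<in>{1..<Suc r}. w' k * S ^ (k * (n - 1) + l * n))"
      by (simp add: w')
    also have "S ^ (l * n) = (S ^ n) ^ l" by (simp add: power_mult[symmetric] mult.commute)
    also have "(\<Sum>k\<in>{1..<Suc r}. w' k * S ^ (k * (n - 1) + l * n)) = v * (\<Sum>k\<in>{1..<Suc r}. ?z ^ k * (S ^ n) ^ l)"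
      unfolding sum_distrib_left
    proof (rule sum.cong[OF refl])
      fix k assume "k \<in> {1..<Suc r}"
      then have "w' k = v * (Q ^ (n - 1)) ^ k" using wl' by simp
      moreover have "S ^ (k * (n - 1) + l * n) = (S ^ (n - 1)) ^ k * (S ^ n) ^ l"
        by (simp add: power_add power_mult[symmetric] mult.commute)
      ultimately show "w' k * S ^ (k * (n - 1) + l * n) = v * (?z ^ k * (S ^ n) ^ l)" by (simp add: power_mult_distrib)
    qed
    finally have "w l * Q ^ l * (\<Sum>k\<le>r. w' k * S ^ (k * (n - 1) + l * n))
      = u * ((Q ^ n) ^ l * Q ^ l * (S ^ n) ^ l + v * (\<Sum>k\<in>{1..<Suc r}. ?z ^ k * ((Q ^ n) ^ l * Q ^ l * (S ^ n) ^ l)))"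
      by (simp add: wl[OF l] distrib_left sum_distrib_left mult_ac)
    also have "(Q ^ n) ^ l * Q ^ l * (S ^ n) ^ l = ?y ^ l" by (simp add: power_mult_distrib)
    finally show ?thesis .
  qed
  have "(\<lambda>N. A ^ N * (\<Sum>l\<le>N. w l * (Q ^ l * (\<Sum>k\<le>l. w' k * S ^ (k * (n - 1) + l * n)) +
      (if l = 0 then 0 else Q ^ (l - 1) * (\<Sum>k\<le>l - 1. w' k * S ^ (k * (n - 1) + l * n)))))) sums
    (((1 - A * x) * (1 - A * ?y) + (u * v) * (A * x) * (1 - A * ?y) + (u * (1 + 1 / Q)) * (A * ?y) * (1 - A * x) + (u * (1 + 1 / Q) * v) * ((A * x) * (A * ?y)))
      / ((1 - A) * (1 - A * ?y) * (1 - A * x)))"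
  proof (rule weighted_power_sums)
    fix l :: nat assume l: "l \<ge> 1"
    let ?s = "\<Sum>k\<in>{1..<l}. ?z ^ k * ?y ^ l"
    have s: "?s = (\<Sum>k\<in>{1..<l}. x ^ k * ?y ^ (l - k))"
    proof (rule sum.cong[OF refl])
      fix k assume "k \<in> {1..<l}"
      then have "?y ^ l = ?y ^ k * ?y ^ (l - k)" by (simp add: power_add[symmetric])
      then show "?z ^ k * ?y ^ l = x ^ k * ?y ^ (l - k)" unfolding x power_mult_distrib[of ?z ?y] by (simp only: mult.assoc)
    qed
    have pred: "Q ^ (l - 1) = Q ^ l / Q" using l Q by (cases l) simp_all
    have "w l * (Q ^ l * (\<Sum>k\<le>l. w' k * S ^ (k * (n - 1) + l * n)) +
        (if l = 0 then 0 else Q ^ (l - 1) * (\<Sum>k\<le>l - 1. w' k * S ^ (k * (n - 1) + l * n))))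
      = w l * Q ^ l * (\<Sum>k\<le>l. w' k * S ^ (k * (n - 1) + l * n)) +
        w l * Q ^ l * (\<Sum>k\<le>l - 1. w' k * S ^ (k * (n - 1) + l * n)) / Q"
      unfolding pred using l by (simp add: distrib_left mult.assoc)
    also have "\<dots> = u * (?y ^ l + v * (\<Sum>k\<in>{1..<Suc l}. ?z ^ k * ?y ^ l)) + u * (?y ^ l + v * ?s) / Q"
      unfolding inner[OF l] using l by simp
    also have "(\<Sum>k\<in>{1..<Suc l}. ?z ^ k * ?y ^ l) = ?s + x ^ l"
      using l unfolding x power_mult_distrib[of ?z ?y] by simp
    also have "u * (?y ^ l + v * (?s + x ^ l)) + u * (?y ^ l + v * ?s) / Q
      = (u * v) * x ^ l + (u * (1 + 1 / Q)) * ?y ^ l + (u * (1 + 1 / Q) * v) * ?s"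
      by (simp add: add_divide_distrib distrib_left distrib_right mult_ac)
    finally show "w l * (Q ^ l * (\<Sum>k\<le>l. w' k * S ^ (k * (n - 1) + l * n)) +
        (if l = 0 then 0 else Q ^ (l - 1) * (\<Sum>k\<le>l - 1. w' k * S ^ (k * (n - 1) + l * n))))
      = (u * v) * x ^ l + (u * (1 + 1 / Q)) * ?y ^ l + (u * (1 + 1 / Q) * v) * (\<Sum>k\<in>{1..<l}. x ^ k * ?y ^ (l - k))"
      unfolding s .
  qed (use norms in \<open>simp_all add: w w' X Y x_def\<close>)
  then show ?thesis by (simp only: X Y x_def)
qed

section \<open>From the local formulas to the theorem\<close>

lemma square_eq_choose: "n ^ 2 = 2 * (n choose 2) + (n :: nat)"
  by (induction n) (simp_all add: monoid_mult_class.power2_eq_square numeral_2_eq_2)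

lemma powr_combine:
  fixes Q s1 s2 :: complex
  assumes "Q \<noteq> 0"
  shows "Q powr (of_nat a - of_nat b * s1 - s2) = Q ^ a * (Q powr (- s1)) ^ b * Q powr (- s2)"
proof -
  have "Q powr (of_nat a - of_nat b * s1 - s2) = Q powr (of_nat a) * Q powr (of_nat b * (- s1)) * Q powr (- s2)"
    by (simp add: powr_add[symmetric])
  moreover have "Q powr (of_nat b * (- s1)) = (Q powr (- s1)) ^ b"
    using assms by (simp add: powr_def exp_of_nat_mult[symmetric] mult_ac)
  ultimately show ?thesis using assms by (simp add: powr_nat)
qed

text \<open>The bound is uniform in q: powers of q^(-s1) have modulus at most 1, and the remaining
  modulus q^(a - Re s2) is below 1 as soon as Re s2 > a. One half-plane thus serves all
  primes.\<close>

lemma cmod_monomial_less_one: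
  fixes q :: nat
  assumes q: "q \<ge> 2" and s: "Re s1 \<ge> 0" "real a < Re s2"
  shows "cmod (of_nat q ^ a * (of_nat q powr (- s1)) ^ b * of_nat q powr (- s2)) < 1"
proof -
  have n: "cmod (of_nat q powr s) = real q powr Re s" for s
    using norm_powr_real_powr[of "of_nat q" s] q by simp
  have "real q powr (- Re s1) \<le> 1" using q s powr_mono[of "- Re s1" 0 "real q"] by simp
  then have "cmod ((of_nat q powr (- s1)) ^ b) \<le> 1" by (simp add: n norm_power power_le_one)
  moreover have "cmod (of_nat q ^ a * of_nat q powr (- s2)) < 1"
  proof -
    have "cmod (of_nat q ^ a * of_nat q powr (- s2)) = real q powr (real a - Re s2)"
      using q by (simp add: n norm_mult norm_power powr_realpow[symmetric] powr_add[symmetric])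
    also have "\<dots> < real q powr 0" using q s by (intro powr_less_mono) auto
    finally show ?thesis using q by simp
  qed
  ultimately have "cmod ((of_nat q powr (- s1)) ^ b) * cmod (of_nat q ^ a * of_nat q powr (- s2)) < 1"
    by (meson mult_left_le_one_le norm_ge_zero order.strict_trans1)
  then show ?thesis by (simp add: norm_mult mult_ac)
qed

text \<open>Separates the two tasks that remain for each family: the formula over chain rings and
  the summation over N. The carrier type is that of quotients of the completion.\<close>

lemma local_series:
  fixes K :: "'a::field_char_0 set"
  assumes K: "number_field K" and pp: "primeideal \<pp> (ring_of_integers K)" "\<pp> \<noteq> {0}"
    and q: "q = ideal_index (ring_of_integers K) \<pp>"
    and zeta: "\<And>A \<omega> N. chain_ring (A :: (nat \<Rightarrow> 'a set) set ring) \<omega> q N \<Longrightarrow>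
      zeta_cc (group_points \<Lambda> A) s1 = of_nat q ^ (N * c) * p N"
    and sums: "(\<lambda>N. (of_nat q ^ c * of_nat q powr (- s2)) ^ N * p N) sums z"
  shows "summable (Zcc_term \<Lambda> K \<pp> s1 s2) \<and> Zcc \<Lambda> K \<pp> s1 s2 = z"
proof -
  have q0: "(of_nat q :: complex) \<noteq> 0" using chain_ring_at_prime[OF K pp] by (simp add: q)
  have "Zcc_term \<Lambda> K \<pp> s1 s2 N = (of_nat q ^ c * of_nat q powr (- s2)) ^ N * p N" for N
  proof -
    obtain \<omega> where "chain_ring (completion (ring_of_integers K) \<pp> Quot
        ideal_pow (completion (ring_of_integers K) \<pp>) (the_max_ideal (completion (ring_of_integers K) \<pp>)) N) \<omega> q N"
      using chain_ring_at_prime[OF K pp] q by blast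
    note zeta[OF this]
    moreover have "(of_nat q :: complex) powr (- of_nat N * s2) = (of_nat q powr (- s2)) ^ N"
      using q0 by (simp add: powr_def exp_of_nat_mult[symmetric] mult_ac)
    ultimately show ?thesis
      by (simp add: Zcc_term_def Let_def q[symmetric] power_mult_distrib power_mult[symmetric] mult_ac)
  qed
  then have "Zcc_term \<Lambda> K \<pp> s1 s2 = (\<lambda>N. (of_nat q ^ c * of_nat q powr (- s2)) ^ N * p N)" by (rule ext)
  then have "Zcc_term \<Lambda> K \<pp> s1 s2 sums z" using sums by (simp only:)
  then show ?thesis by (auto simp: Zcc_def sums_iff)
qed

theorem theorem1p4:
  fixes K :: "'a::field_char_0 set" and n \<delta> :: nat
  assumes "number_field K" and "n \<ge> 1" and "\<delta> \<in> {0, 1}"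
  shows "\<exists>\<sigma>::real. \<forall>\<pp>. primeideal \<pp> (ring_of_integers K) \<and> \<pp> \<noteq> {0} \<longrightarrow>
    (\<forall>s1 s2 :: complex. Re s1 > \<sigma> \<and> Re s2 > \<sigma> \<longrightarrow>
      (let q = (of_nat (ideal_index (ring_of_integers K) \<pp>) :: complex);
           T1 = q powr (- s1);
           T2 = q powr (- s2);
           m = 2 * n + \<delta>
       in
        (summable (Zcc_term (lattice_F n \<delta>) K \<pp> s1 s2) \<and>
         Zcc (lattice_F n \<delta>) K \<pp> s1 s2 =
           (1 - q powr (of_nat ((m - 1) choose 2) - of_nat (m - 1) * s1 - s2)) /
           ((1 - q powr (of_nat (m choose 2) - s2)) *
            (1 - q powr (of_nat (m choose 2) + 1 - of_nat (m - 1) * s1 - s2)))) \<and>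
        (n \<ge> 2 \<longrightarrow>
         summable (Zcc_term (lattice_G n) K \<pp> s1 s2) \<and>
         Zcc (lattice_G n) K \<pp> s1 s2 =
           ((1 - q ^ (2 * (n choose 2)) * T1 ^ n * T2) *
            (1 - q ^ (2 * (n choose 2) + 1) * T1 ^ (2 * n - 1) * T2)
            + q ^ (n ^ 2) * T1 ^ n * T2 * (1 - q powi (- int n)) *
              (1 - q powi (- (int n - 1)) * T1 ^ (n - 1))) /
           ((1 - q ^ (n ^ 2) * T2) *
            (1 - q ^ (n ^ 2) * T1 ^ n * T2) *
            (1 - q ^ (n ^ 2 + 1) * T1 ^ (2 * n - 1) * T2))) \<and>
        (n \<ge> 2 \<longrightarrow>
         summable (Zcc_term (lattice_H n) K \<pp> s1 s2) \<and>
         Zcc (lattice_H n) K \<pp> s1 s2 =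
           ((1 - q ^ (n choose 2) * T1 ^ n * T2) *
            (1 - q ^ ((n choose 2) + 2) * T1 ^ (2 * n - 1) * T2)
            + q ^ ((n + 1) choose 2) * T1 ^ n * T2 * (1 - q powi (- int n + 1)) *
              (1 - q powi (- (int n - 1)) * T1 ^ (n - 1))) /
           ((1 - q ^ ((n + 1) choose 2) * T2) *
            (1 - q ^ (((n + 1) choose 2) + 1) * T1 ^ n * T2) *
            (1 - q ^ (((n + 1) choose 2) + 1) * T1 ^ (2 * n - 1) * T2)))))"
proof -
  let ?m = "2 * n + \<delta>"
  \<comment> \<open>A crude bound that exceeds every exponent of q among the ratios of the three
    families; it depends on n and \<delta> but not on the prime.\<close>
  define \<sigma> where "\<sigma> = real ((?m choose 2) + n ^ 2 + ((n + 1) choose 2) + 1)"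
  show ?thesis
  proof (rule exI[of _ \<sigma>], intro allI impI, goal_cases)
    case (1 \<pp> s1 s2)
    note pp = conjunct1[OF 1(1)] conjunct2[OF 1(1)]
    define p where "p = ideal_index (ring_of_integers K) \<pp>"
    define q where "q = (of_nat p :: complex)"
    define T1 where "T1 = q powr (- s1)"
    define T2 where "T2 = q powr (- s2)"
    define S where "S = of_nat p powr (- (1 + s1))"
    define w where "w n l = (if l = 0 then 1 else q ^ (n * l) - q ^ (n * (l - 1)))" for n l :: nat
    have p2: "p \<ge> 2" using chain_ring_at_prime[OF assms(1) pp] by (simp add: p_def)
    then have q0: "q \<noteq> 0" by (simp add: q_def)
    \<comment> \<open>Translates the weight S of the chain ring formulas into T1; every factor S
      lowers the exponent of q by one.\<close>
    have S: "S = T1 / q"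
    proof -
      have "- (1 + s1) = - s1 - 1" by simp
      then have "S = q powr (- s1 - 1)" by (simp only: S_def q_def)
      then show ?thesis using q0 by (simp add: powr_diff T1_def)
    qed
    have S_chain: "chain_ring.S p s1 = S" and w_chain: "chain_ring.wt p = w"
      if "chain_ring (A :: (nat \<Rightarrow> 'a set) set ring) \<omega> p N" for A \<omega> N
      using that by (simp_all add: fun_eq_iff chain_ring.S_def chain_ring.wt_def S_def w_def q_def)
    have \<sigma>: "Re s1 \<ge> 0" using 1(2) unfolding \<sigma>_def by linarith
    have small: "cmod (q ^ a * T1 ^ b * T2) < 1" if "real a \<le> \<sigma>" for a b
      unfolding q_def T1_def T2_def by (rule cmod_monomial_less_one[OF p2 \<sigma>]) (use 1(2) that in linarith)
    have inv: "q powi (- int n) = 1 / q ^ n" by (simp add: power_int_minus field_simps)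
    have inv1: "q powi (- (int n - 1)) = q * (1 / q ^ n)" "q powi (- int n + 1) = q * (1 / q ^ n)"
      using q0 assms(2) by (simp_all add: power_int_diff power_int_add power_int_minus field_simps)
    obtain n' where n': "n = Suc n'" using assms(2) by (cases n) auto

    have F: "summable (Zcc_term (lattice_F n \<delta>) K \<pp> s1 s2) \<and>
         Zcc (lattice_F n \<delta>) K \<pp> s1 s2 =
           (1 - q ^ ((?m - 1) choose 2) * T1 ^ (?m - 1) * T2) /
           ((1 - q ^ (?m choose 2) * T2) * (1 - q ^ ((?m choose 2) + 1) * T1 ^ (?m - 1) * T2))"
    proof -
      obtain m' where m': "?m = Suc m'" using n' by simp
      then have m1: "?m \<ge> 1" by simp
      let ?A = "q ^ (?m choose 2) * T2"
      have B: "?A * (q ^ ?m * S ^ (?m - 1)) = q ^ ((?m choose 2) + 1) * T1 ^ (?m - 1) * T2"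
        using q0 unfolding S m' by (simp add: power_divide)
      \<comment> \<open>With m for \<open>?m\<close>, the exponents match by (m choose 2) + 1 - m =
        (m - 1) choose 2.\<close>
      have B': "q ^ ((?m choose 2) + 1) * T1 ^ (?m - 1) * T2 / q ^ ?m = q ^ ((?m - 1) choose 2) * T1 ^ (?m - 1) * T2"
        using q0 unfolding m' by (simp add: numeral_2_eq_2 power_add)
      show ?thesis
      proof (rule local_series[OF assms(1) pp p_def])
        fix A :: "(nat \<Rightarrow> 'a set) set ring" and \<omega> N assume C: "chain_ring A \<omega> p N"
        show "zeta_cc (group_points (lattice_F n \<delta>) A) s1 = of_nat p ^ (N * (?m choose 2)) * (\<Sum>l\<le>N. w ?m l * S ^ (l * (?m - 1)))"
          using chain_ring.zeta_F[OF C m1, where s = s1] by (simp only: S_chain[OF C] w_chain[OF C])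
      next
        have "(\<lambda>N. ?A ^ N * (\<Sum>l\<le>N. w ?m l * S ^ (l * (?m - 1)))) sums
          ((1 - ?A * (q ^ ?m * S ^ (?m - 1)) / q ^ ?m) / ((1 - ?A) * (1 - ?A * (q ^ ?m * S ^ (?m - 1)))))"
        proof (rule sums_F[OF q0])
          show "cmod ?A < 1" using small[of "?m choose 2" 0] by (simp add: \<sigma>_def)
          show "cmod (?A * (q ^ ?m * S ^ (?m - 1))) < 1" unfolding B by (rule small) (simp add: \<sigma>_def)
        qed (simp add: w_def)
        then show "(\<lambda>N. (of_nat p ^ (?m choose 2) * of_nat p powr (- s2)) ^ N * (\<Sum>l\<le>N. w ?m l * S ^ (l * (?m - 1)))) sums
          ((1 - q ^ ((?m - 1) choose 2) * T1 ^ (?m - 1) * T2) /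
           ((1 - ?A) * (1 - q ^ ((?m choose 2) + 1) * T1 ^ (?m - 1) * T2)))"
          unfolding B B' by (simp only: q_def T2_def)
      qed
    qed

    have G: "summable (Zcc_term (lattice_G n) K \<pp> s1 s2) \<and>
         Zcc (lattice_G n) K \<pp> s1 s2 =
           ((1 - q ^ (2 * (n choose 2)) * T1 ^ n * T2) *
            (1 - q ^ (2 * (n choose 2) + 1) * T1 ^ (2 * n - 1) * T2)
            + q ^ (n ^ 2) * T1 ^ n * T2 * (1 - 1 / q ^ n) * (1 - q * (1 / q ^ n) * T1 ^ (n - 1))) /
           ((1 - q ^ (n ^ 2) * T2) * (1 - q ^ (n ^ 2) * T1 ^ n * T2) * (1 - q ^ (n ^ 2 + 1) * T1 ^ (2 * n - 1) * T2))"
    proof -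
      let ?A = "q ^ (n ^ 2) * T2" and ?X = "q ^ (n ^ 2 + 1) * T1 ^ (2 * n - 1) * T2" and ?Y = "q ^ (n ^ 2) * T1 ^ n * T2"
      let ?M = "q ^ (2 * (n choose 2)) * T1 ^ n * T2"
      have X: "?X = ?A * (q ^ (2 * n) * S ^ (2 * n - 1))" using q0 unfolding S n' by (simp add: power_divide)
      have Y: "?Y = ?A * (q ^ n * S ^ n)" using q0 unfolding S by (simp add: power_divide)
      have YM: "?Y = q ^ n * ?M" unfolding square_eq_choose by (simp add: power_add)
      have T1: "T1 ^ (2 * n - 1) = T1 ^ n * T1 ^ (n - 1)" unfolding n' by (simp add: power_add[symmetric] mult_2)
      have XM: "?X = q ^ n * ?M * q * T1 ^ (n - 1)" unfolding square_eq_choose T1 by (simp add: power_add)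
      have MX: "q ^ (2 * (n choose 2) + 1) * T1 ^ (2 * n - 1) * T2 = ?M * q * T1 ^ (n - 1)" unfolding T1 by simp
      show ?thesis
      proof (rule local_series[OF assms(1) pp p_def])
        fix A :: "(nat \<Rightarrow> 'a set) set ring" and \<omega> N assume C: "chain_ring A \<omega> p N"
        show "zeta_cc (group_points (lattice_G n) A) s1 = of_nat p ^ (N * n ^ 2) *
            (\<Sum>l\<le>N. \<Sum>k\<le>N. w n l * w n k * S ^ ((n - 1) * min l k + n * max l k))"
          using chain_ring.zeta_G[OF C assms(2), of s1] by (simp only: S_chain[OF C] w_chain[OF C])
      next
        have "(\<lambda>N. ?A ^ N * (\<Sum>l\<le>N. \<Sum>k\<le>N. w n l * w n k * S ^ ((n - 1) * min l k + n * max l k))) sums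
          (((1 - ?X) * (1 - ?Y) + (1 - 1 / q ^ n)\<^sup>2 * ?X * (1 - ?Y) + 2 * (1 - 1 / q ^ n) * ?Y * (1 - ?X)
            + 2 * (1 - 1 / q ^ n)\<^sup>2 * (?X * ?Y)) / ((1 - ?A) * (1 - ?Y) * (1 - ?X)))"
        proof (rule sums_G[OF q0 assms(2) w_def X Y refl])
          show "cmod ?A < 1" using small[of "n ^ 2" 0] by (simp add: \<sigma>_def)
        qed (rule small, simp add: \<sigma>_def)+
        also have "(1 - ?X) * (1 - ?Y) + (1 - 1 / q ^ n)\<^sup>2 * ?X * (1 - ?Y) + 2 * (1 - 1 / q ^ n) * ?Y * (1 - ?X)
            + 2 * (1 - 1 / q ^ n)\<^sup>2 * (?X * ?Y)
          = (1 - ?M) * (1 - ?M * q * T1 ^ (n - 1)) + ?Y * (1 - 1 / q ^ n) * (1 - q * (1 / q ^ n) * T1 ^ (n - 1))"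
          unfolding XM unfolding YM by (rule rational_identity_G) (use q0 in simp)
        finally show "(\<lambda>N. (of_nat p ^ (n ^ 2) * of_nat p powr (- s2)) ^ N * (\<Sum>l\<le>N. \<Sum>k\<le>N. w n l * w n k * S ^ ((n - 1) * min l k + n * max l k))) sums
          (((1 - ?M) * (1 - q ^ (2 * (n choose 2) + 1) * T1 ^ (2 * n - 1) * T2)
            + ?Y * (1 - 1 / q ^ n) * (1 - q * (1 / q ^ n) * T1 ^ (n - 1))) /
           ((1 - ?A) * (1 - ?Y) * (1 - ?X)))"
          unfolding MX by (simp only: q_def T2_def)
      qed
    qed

    have H: "summable (Zcc_term (lattice_H n) K \<pp> s1 s2) \<and>
         Zcc (lattice_H n) K \<pp> s1 s2 =
           ((1 - q ^ (n choose 2) * T1 ^ n * T2) * (1 - q ^ ((n choose 2) + 2) * T1 ^ (2 * n - 1) * T2)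
            + q ^ ((n + 1) choose 2) * T1 ^ n * T2 * (1 - q * (1 / q ^ n)) * (1 - q * (1 / q ^ n) * T1 ^ (n - 1))) /
           ((1 - q ^ ((n + 1) choose 2) * T2) * (1 - q ^ (((n + 1) choose 2) + 1) * T1 ^ n * T2) *
            (1 - q ^ (((n + 1) choose 2) + 1) * T1 ^ (2 * n - 1) * T2))" if n2: "n \<ge> 2"
    proof -
      let ?c = "(n + 1) choose 2"
      have c: "?c = (n choose 2) + n" by (simp add: numeral_2_eq_2)
      let ?A = "q ^ ?c * T2" and ?X = "q ^ (?c + 1) * T1 ^ (2 * n - 1) * T2" and ?Y = "q ^ (?c + 1) * T1 ^ n * T2"
      let ?M = "q ^ (n choose 2) * T1 ^ n * T2" and ?u = "1 - 1 / q ^ n" and ?v = "1 - 1 / q ^ (n - 1)"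
      let ?p = "\<lambda>N. \<Sum>l\<le>N. w n l * (q ^ l * (\<Sum>k\<le>l. w (n - 1) k * S ^ (k * (n - 1) + l * n)) +
          (if l = 0 then 0 else q ^ (l - 1) * (\<Sum>k\<le>l - 1. w (n - 1) k * S ^ (k * (n - 1) + l * n))))"
      have X: "?X = ?A * (q ^ (2 * n) * S ^ (2 * n - 1))" using q0 unfolding S n' by (simp add: power_divide)
      have Y: "?Y = ?A * (q ^ (n + 1) * S ^ n)" using q0 unfolding S by (simp add: power_divide)
      have v: "?v = 1 - q * (1 / q ^ n)" using q0 unfolding n' by simp
      have YM: "?Y = q ^ n * q * ?M" unfolding c by (simp add: power_add)
      have T1: "T1 ^ (2 * n - 1) = T1 ^ n * T1 ^ (n - 1)" unfolding n' by (simp add: power_add[symmetric] mult_2)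
      have XM: "?X = q ^ n * q * ?M * T1 ^ (n - 1)" unfolding c T1 by (simp add: power_add)
      have MX: "q ^ ((n choose 2) + 2) * T1 ^ (2 * n - 1) * T2 = ?M * q\<^sup>2 * T1 ^ (n - 1)" unfolding T1 power_add by (simp only: mult_ac)
      have cM: "q ^ ?c * T1 ^ n * T2 = q ^ n * ?M" unfolding c by (simp add: power_add)
      show ?thesis
      proof (rule local_series[OF assms(1) pp p_def])
        fix A :: "(nat \<Rightarrow> 'a set) set ring" and \<omega> N assume C: "chain_ring A \<omega> p N"
        show "zeta_cc (group_points (lattice_H n) A) s1 = of_nat p ^ (N * ?c) * ?p N"
          using chain_ring.zeta_H[OF C n2, of s1] by (simp only: S_chain[OF C] w_chain[OF C] q_def)
      next
        have "(\<lambda>N. ?A ^ N * ?p N) sums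
          (((1 - ?X) * (1 - ?Y) + ?u * ?v * ?X * (1 - ?Y) + ?u * (1 + 1 / q) * ?Y * (1 - ?X)
            + ?u * (1 + 1 / q) * ?v * (?X * ?Y)) / ((1 - ?A) * (1 - ?Y) * (1 - ?X)))"
        proof (rule sums_H[OF q0 n2 w_def w_def X Y refl refl])
          show "cmod ?A < 1" using small[of ?c 0] by (simp add: \<sigma>_def)
        qed (rule small, simp add: \<sigma>_def)+
        also have "(1 - ?X) * (1 - ?Y) + ?u * ?v * ?X * (1 - ?Y) + ?u * (1 + 1 / q) * ?Y * (1 - ?X)
            + ?u * (1 + 1 / q) * ?v * (?X * ?Y)
          = (1 - ?M) * (1 - ?M * q\<^sup>2 * T1 ^ (n - 1)) + q ^ n * ?M * (1 - q * (1 / q ^ n)) * (1 - q * (1 / q ^ n) * T1 ^ (n - 1))"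
          unfolding XM v unfolding YM by (rule rational_identity_H) (use q0 in simp_all)
        finally show "(\<lambda>N. (of_nat p ^ ?c * of_nat p powr (- s2)) ^ N * ?p N) sums
          (((1 - ?M) * (1 - q ^ ((n choose 2) + 2) * T1 ^ (2 * n - 1) * T2)
            + q ^ ?c * T1 ^ n * T2 * (1 - q * (1 / q ^ n)) * (1 - q * (1 / q ^ n) * T1 ^ (n - 1))) /
           ((1 - ?A) * (1 - ?Y) * (1 - ?X)))"
          unfolding MX cM by (simp only: q_def T2_def)
      qed
    qed

    have powr: "q powr (of_nat a - of_nat b * s1 - s2) = q ^ a * T1 ^ b * T2"
      "q powr (of_nat a - s2) = q ^ a * T2"
      "q powr (of_nat a + 1 - of_nat b * s1 - s2) = q ^ (a + 1) * T1 ^ b * T2" for a b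
      using powr_combine[OF q0, of a b s1 s2] powr_combine[OF q0, of a 0 s1 s2] powr_combine[OF q0, of "a + 1" b s1 s2]
      by (simp_all add: T1_def T2_def add.commute)
    show ?case
      unfolding Let_def p_def[symmetric] q_def[symmetric] T1_def[symmetric] T2_def[symmetric] powr inv inv1
      by (rule conjI[OF F], rule conjI, rule impI, rule G, rule impI, erule H)
  qed
qed

end
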